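(* Let $L$ be one of the following lattices: $E_6^*$ (dimension $6$), $E_7^*$ (dimension $7$), the Coxeter-Todd lattice $K_{12}$ (dimension $12$), or the Barnes-Wall lattice $BW_{16}$ (dimension $16$), and let $V$ be the real vector space spanned by $L$. Then every deep hole $c \in V$ of $L$ is a stable cold spot of $L$; that is, there exists a finite $\alpha_0$ such that for every $\alpha \geq \alpha_0$ the point $c$ is a minimizer of the function $z \mapsto \sum_{x \in L} e^{-\alpha\|x-z\|^2}$ over $V$.
   Context: A deep hole of a lattice $L$ spanning $V$ is a point $c \in V$ with $\min_{x\in L}\|x-c\| = \max_{z \in V}\min_{x \in L}\|x-z\|$. $E_6$ and $E_7$ are the root lattices generated by the root systems of type $E_6$, $E_7$ (roots of squared norm $2$), and $L^* = \{x \in V : x\cdot v \in \mathbb{Z} \text{ for all } v \in L\}$ denotes the dual lattice in the span $V$ of $L$. Up to isometry and scaling (the claim is invariant under both), $K_{12}$ is the real lattice underlying $\{x \in \mathcal{E}^6 : x_1 \equiv x_2 \equiv \dots \equiv x_6 \pmod{\theta},\ \sum_{i} x_i \equiv 0 \pmod 3\} \subseteq \mathbb{C}^6 \cong \mathbb{R}^{12}$, where $\mathcal{E} = \mathbb{Z}[\omega]$, $\omega = e^{2\pi i/3}$, $\theta = \omega - \bar{\omega} = \sqrt{-3}$; and $BW_{16}$ is $\frac{1}{\sqrt{2}}\{x \in \mathbb{Z}^{16} : x \bmod 2 \in RM(1,4),\ \sum_i x_i \equiv 0 \pmod 4\}$, where $RM(1,4)\subseteq \mathbb{F}_2^{16}$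 is the first-order Reed-Muller code of length $16$. *)

theory Defs
  imports "HOL-Analysis.Analysis" "HOL-Computational_Algebra.Group_Closure"
begin

section \<open>Deep holes and stable cold spots\<close>

text \<open>The space \<open>V\<close> spanned by \<open>L\<close> is \<open>span L\<close> inside an ambient Euclidean space,
  which may be larger. For a lattice \<open>L\<close> the infimum in \<open>infdist\<close> is attained.\<close>

definition deep_hole :: "'a::euclidean_space set \<Rightarrow> 'a \<Rightarrow> bool" where
  "deep_hole L c \<longleftrightarrow> is_arg_max (\<lambda>z. infdist z L) (\<lambda>z. z \<in> span L) c"

definition gaussian_sum :: "'a::euclidean_space set \<Rightarrow> real \<Rightarrow> 'a \<Rightarrow> real" where
  "gaussian_sum L \<alpha> z = (\<Sum>\<^sub>\<infinity>x\<in>L. exp (- \<alpha> * (norm (x - z))\<^sup>2))"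

text \<open>Positivity of \<open>\<alpha>\<^sub>0\<close> is no loss of generality; it only keeps out the parameters
  \<open>\<alpha> \<le> 0\<close>, for which the sum diverges and \<open>infsum\<close> is 0 by convention.\<close>

definition stable_cold_spot :: "'a::euclidean_space set \<Rightarrow> 'a \<Rightarrow> bool" where
  "stable_cold_spot L c \<longleftrightarrow>
     (\<exists>\<alpha>\<^sub>0>0. \<forall>\<alpha>\<ge>\<alpha>\<^sub>0. is_arg_min (gaussian_sum L \<alpha>) (\<lambda>z. z \<in> span L) c)"

section \<open>The lattices\<close>

definition dual_lattice :: "'a::euclidean_space set \<Rightarrow> 'a set" where
  "dual_lattice L = {x \<in> span L. \<forall>v\<in>L. x \<bullet> v \<in> \<int>}"

subsection \<open>\<open>E\<^sub>6\<close> and \<open>E\<^sub>7\<close>\<close>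

text \<open>Bourbaki's coordinates. The index type \<open>8\<close> is the integers modulo 8, so the last
  coordinate \<open>x $ 8\<close> is also \<open>x $ 0\<close>.\<close>

definition E8_roots :: "(real ^ 8) set" where
  "E8_roots = {x. ((\<forall>i. x $ i \<in> \<int>) \<or> (\<forall>i. x $ i - 1 / 2 \<in> \<int>)) \<and>
                  (\<Sum>i\<in>UNIV. x $ i) / 2 \<in> \<int> \<and> (norm x)\<^sup>2 = 2}"

definition E7_roots :: "(real ^ 8) set" where
  "E7_roots = {x \<in> E8_roots. x $ 7 = - x $ 8}"

definition E6_roots :: "(real ^ 8) set" where
  "E6_roots = {x \<in> E8_roots. x $ 6 = x $ 7 \<and> x $ 7 = - x $ 8}"

definition E7_lattice :: "(real ^ 8) set" where
  "E7_lattice = group_closure E7_roots"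

definition E6_lattice :: "(real ^ 8) set" where
  "E6_lattice = group_closure E6_roots"

subsection \<open>The Coxeter-Todd lattice\<close>

definition \<omega> :: complex where
  "\<omega> = exp (2 * of_real pi * \<i> / 3)"

definition \<theta> :: complex where
  "\<theta> = \<omega> - cnj \<omega>"

definition eisenstein_integers :: "complex set" where
  "eisenstein_integers = {of_int a + of_int b * \<omega> | a b. True}"

definition eisenstein_cong :: "complex \<Rightarrow> complex \<Rightarrow> complex \<Rightarrow> bool" where
  "eisenstein_cong m x y \<longleftrightarrow> (\<exists>e\<in>eisenstein_integers. x - y = m * e)"

text \<open>The type \<open>complex ^ 6\<close> is a real inner product space of dimension 12 whose norm is the
  usual one of \<open>\<complex>\<^sup>6\<close>.\<close>

definition K12 :: "(complex ^ 6) set" where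
  "K12 = {x. (\<forall>i. x $ i \<in> eisenstein_integers) \<and>
             (\<forall>i j. eisenstein_cong \<theta> (x $ i) (x $ j)) \<and>
             eisenstein_cong 3 (\<Sum>i\<in>UNIV. x $ i) 0}"

subsection \<open>The Barnes-Wall lattice\<close>

text \<open>The numeral type \<open>2\<close>, with its arithmetic modulo 2, serves as \<open>\<bbbF>\<^sub>2\<close>, and the 16
  coordinates are indexed by the points of \<open>\<bbbF>\<^sub>2\<^sup>4\<close>. The codewords of \<open>RM(1,4)\<close> are
  the value tables of the affine functions on \<open>\<bbbF>\<^sub>2\<^sup>4\<close>.\<close>

definition RM_1_4 :: "(2 ^ (2 ^ 4)) set" where
  "RM_1_4 = {\<chi> p. (\<Sum>k\<in>UNIV. a $ k * p $ k) + b | (a :: 2 ^ 4) (b :: 2). True}"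

definition BW16 :: "(real ^ (2 ^ 4)) set" where
  "BW16 = (\<lambda>u. (1 / sqrt 2) *\<^sub>R (\<chi> p. real_of_int (u $ p))) `
            {u :: int ^ (2 ^ 4). (\<chi> p. of_int (u $ p)) \<in> RM_1_4 \<and> 4 dvd (\<Sum>p\<in>UNIV. u $ p)}"

end

theory Submission
  imports Defs
begin

text \<open>In each of the four lattices all deep holes \<open>c\<close> are equivalent under the isometries of the
  lattice, and every point that is not a deep hole is strictly closer to the lattice, so by
  compactness the Gaussian sum is larger there for large \<open>\<alpha>\<close>, outside a neighbourhood of the deep
  holes. Near \<open>c\<close> one uses symmetries \<open>g\<^sub>0 = 1, \<dots>, g\<^sub>k\<^sub>-\<^sub>1\<close> of the lattice fixing \<open>c\<close> with
  \<open>\<Sum>\<^sub>j g\<^sub>j = 0\<close> around \<open>c\<close>: the inversion in \<open>c\<close> for \<open>E\<^sub>7\<^sup>*\<close> and \<open>BW\<^sub>1\<^sub>6\<close>, where \<open>2 c\<close> is a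
  lattice vector, and a fixed-point-free rotation of order 3 for \<open>E\<^sub>6\<^sup>*\<close> and \<open>K\<^sub>1\<^sub>2\<close>. Averaging over
  them removes the linear terms, and the remaining decrease by \<open>exp (- \<alpha> |u|\<^sup>2)\<close> is outweighed by a
  nearest lattice point \<open>x\<close> of \<open>c\<close> for which \<open>x - c\<close> has positive inner product with the
  displacement \<open>u\<close>.\<close>

text \<open>The neighbourhood of a deep hole on which the local estimate holds must not shrink as
  \<alpha> grows, so a second-order expansion at \<open>c\<close> for each fixed \<alpha> is not
  enough. A fixed ball suffices because in every direction \<open>u\<close> some nearest point has
  inner product at least \<open>\<kappa> * norm u\<close> with \<open>u\<close>, and the resulting
  gain, exponential in \<open>2 * \<alpha> * \<kappa> * norm u\<close>, beats the loss in \<alpha>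
  |u|^2 as long as \<open>norm u\<close> is at most \<kappa>. The lattice-specific work is a sharp
  covering bound with its equality case. For the two dual root lattices a point is moved into a Weyl
  chamber, where an identity between simple roots and fundamental weights gives the bound; for the
  other two, explicit roundings of a point are compared. There, equality leaves integral points and
  points halfway in all coordinates (half-integers, or centroids of Eisenstein triangles). A
  symmetry that is not monomial, a Hadamard transform or the reflection in the all-ones vector, is
  what links the integral type to the other one.\<close>

section \<open>Discrete subgroups and convergence of Gaussian sums\<close>

definition discrete_subgroup :: "'a::euclidean_space set \<Rightarrow> bool" where
  "discrete_subgroup L \<longleftrightarrow> 0 \<in> L \<and> (\<forall>x\<in>L. \<forall>y\<in>L. x - y \<in> L) \<and>
     (\<exists>d>0. \<forall>x\<in>L. x \<noteq> 0 \<longrightarrow> d \<le> norm x)"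

lemma discrete_subgroup_zero: "discrete_subgroup L \<Longrightarrow> 0 \<in> L"
  by (simp add: discrete_subgroup_def)

lemma discrete_subgroup_diff: "discrete_subgroup L \<Longrightarrow> x \<in> L \<Longrightarrow> y \<in> L \<Longrightarrow> x - y \<in> L"
  by (simp add: discrete_subgroup_def)

lemma discrete_subgroup_minus: "discrete_subgroup L \<Longrightarrow> x \<in> L \<Longrightarrow> - x \<in> L"
  using discrete_subgroup_diff[of L 0 x] discrete_subgroup_zero by auto

lemma discrete_subgroup_add: "discrete_subgroup L \<Longrightarrow> x \<in> L \<Longrightarrow> y \<in> L \<Longrightarrow> x + y \<in> L"
  using discrete_subgroup_diff[of L x "- y"] discrete_subgroup_minus by auto

lemma discrete_subgroup_closed:
  assumes "discrete_subgroup L"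
  shows "closed L"
proof -
  obtain d where d: "d > 0" "\<And>x. x \<in> L \<Longrightarrow> x \<noteq> 0 \<Longrightarrow> d \<le> norm x"
    using assms unfolding discrete_subgroup_def by blast
  show ?thesis
  proof (rule discrete_imp_closed[OF d(1)], intro ballI impI)
    fix x y assume xy: "x \<in> L" "y \<in> L" "dist y x < d"
    then have "y - x \<in> L" using assms by (simp add: discrete_subgroup_diff)
    then show "y = x" using d(2)[of "y - x"] xy(3) by (force simp: dist_norm)
  qed
qed

text \<open>Two points of \<open>L\<close> in one grid cell of side \<open>1 / N\<close> would be
  closer than the minimal distance. The labelling by cells replaces a lattice basis: finiteness of
  balls and convergence of Gaussian sums become statements about integer vectors.\<close>

lemma discrete_subgroup_grid:
  fixes L :: "'a::euclidean_space set"
  assumes "discrete_subgroup L"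
  obtains N :: real where "N > 0" "inj_on (\<lambda>x. restrict (\<lambda>b. \<lfloor>N * (x \<bullet> b)\<rfloor>) Basis) L"
proof -
  obtain d where d: "d > 0" "\<And>x. x \<in> L \<Longrightarrow> x \<noteq> 0 \<Longrightarrow> d \<le> norm x"
    using assms unfolding discrete_subgroup_def by blast
  define N where "N = (DIM('a) + 1) / d"
  have N: "N > 0" using d by (simp add: N_def)
  have "inj_on (\<lambda>x. restrict (\<lambda>b. \<lfloor>N * (x \<bullet> b)\<rfloor>) Basis) L"
  proof (rule inj_onI)
    fix x y assume xy: "x \<in> L" "y \<in> L"
      and eq: "restrict (\<lambda>b. \<lfloor>N * (x \<bullet> b)\<rfloor>) Basis = restrict (\<lambda>b. \<lfloor>N * (y \<bullet> b)\<rfloor>) Basis"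
    have *: "\<bar>(x - y) \<bullet> b\<bar> \<le> 1 / N" if "b \<in> Basis" for b
    proof -
      have "\<lfloor>N * (x \<bullet> b)\<rfloor> = \<lfloor>N * (y \<bullet> b)\<rfloor>"
        using fun_cong[OF eq, of b] that by simp
      then have "\<bar>N * (x \<bullet> b) - N * (y \<bullet> b)\<bar> \<le> 1" by linarith
      then have "N * \<bar>(x - y) \<bullet> b\<bar> \<le> 1"
        using N by (simp add: inner_diff_left abs_mult flip: right_diff_distrib)
      then show ?thesis using N by (simp add: field_simps)
    qed
    have "norm (x - y) \<le> (\<Sum>b\<in>Basis. \<bar>(x - y) \<bullet> b\<bar>)" by (rule norm_le_l1)
    also have "\<dots> \<le> (\<Sum>b\<in>(Basis::'a set). 1 / N)" using * by (intro sum_mono) auto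
    also have "\<dots> = DIM('a) / N" by simp
    also have "\<dots> < d"
      using d(1) by (simp add: N_def field_simps)
    finally have "norm (x - y) < d" .
    moreover have "x - y \<in> L" using xy assms by (simp add: discrete_subgroup_diff)
    ultimately show "x = y" using d(2)[of "x - y"] by force
  qed
  then show ?thesis using that N by blast
qed

lemma discrete_subgroup_finite_cball:
  fixes L :: "'a::euclidean_space set"
  assumes "discrete_subgroup L"
  shows "finite (L \<inter> cball z r)"
proof -
  obtain N :: real where N: "N > 0" "inj_on (\<lambda>x. restrict (\<lambda>b. \<lfloor>N * (x \<bullet> b)\<rfloor>) Basis) L"
    by (rule discrete_subgroup_grid[OF assms])
  define K where "K = \<lceil>N * (norm z + \<bar>r\<bar>)\<rceil> + 1"
  let ?k = "\<lambda>x. restrict (\<lambda>b. \<lfloor>N * (x \<bullet> b)\<rfloor>) Basis"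
  have "?k ` (L \<inter> cball z r) \<subseteq> PiE Basis (\<lambda>_. {-K..K})"
  proof (safe intro!: PiE_I; clarsimp)
    fix x b assume x: "dist z x \<le> r" and b: "b \<in> (Basis :: 'a set)"
    have "norm x \<le> norm z + \<bar>r\<bar>"
      using x norm_triangle_ineq2[of x z] by (simp add: dist_norm norm_minus_commute)
    moreover have "\<bar>x \<bullet> b\<bar> \<le> norm x" by (rule Basis_le_norm[OF b])
    ultimately have "N * \<bar>x \<bullet> b\<bar> \<le> N * (norm z + \<bar>r\<bar>)" using N by (intro mult_left_mono) auto
    then have "\<bar>N * (x \<bullet> b)\<bar> \<le> N * (norm z + \<bar>r\<bar>)" using N by (simp add: abs_mult)
    then show "- K \<le> \<lfloor>N * (x \<bullet> b)\<rfloor> \<and> \<lfloor>N * (x \<bullet> b)\<rfloor> \<le> K"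
      unfolding K_def by linarith
  qed
  moreover have "finite (PiE (Basis :: 'a set) (\<lambda>_. {-K..K}))"
    by (intro finite_PiE) auto
  ultimately have "finite (?k ` (L \<inter> cball z r))" by (rule finite_subset)
  then show ?thesis
    using inj_on_subset[OF N(2)] by (metis finite_imageD inf_le1)
qed

lemma sum_half_power_abs: "(\<Sum>k\<in>{-int K..int K}. (1/2::real) ^ nat \<bar>k\<bar>) = 3 - 2 * (1/2) ^ K"
proof (induction K)
  case (Suc K)
  have "{-int (Suc K)..int (Suc K)} = insert (- int (Suc K)) (insert (int (Suc K)) {-int K..int K})"
    by auto
  then show ?case by (simp add: Suc nat_add_distrib)
qed simp

text \<open>In each coordinate the Gaussian factor is dominated by a geometric term in the cell
  index, because a downward parabola lies below a suitable line of slope \<open>- N\<close>. The sum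
  over cells then factors into one-dimensional geometric series.\<close>

lemma gaussian_summable:
  fixes L :: "'a::euclidean_space set"
  assumes "discrete_subgroup L" "\<alpha> > 0"
  shows "(\<lambda>x. exp (- \<alpha> * (norm (x - z))\<^sup>2)) summable_on L"
proof -
  obtain N :: real where N: "N > 0" "inj_on (\<lambda>x. restrict (\<lambda>b. \<lfloor>N * (x \<bullet> b)\<rfloor>) Basis) L"
    by (rule discrete_subgroup_grid[OF assms(1)])
  let ?k = "\<lambda>x. restrict (\<lambda>b. \<lfloor>N * (x \<bullet> b)\<rfloor>) (Basis :: 'a set)"
  \<comment> \<open>In the exponent, 1 pays for the floor, \<open>N * norm z\<close> for the shift
    of the centre, and \<open>N\<^sup>2 / (4 * \<alpha>)\<close> for completing the square.\<close>
  define c where "c = exp (1 + N * norm z + N\<^sup>2 / (4 * \<alpha>))"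
  define G where "G = (\<lambda>k::'a \<Rightarrow> int. \<Prod>b\<in>Basis. c * (1/2) ^ nat \<bar>k b\<bar>)"
  have c: "c > 0" by (simp add: c_def)
  have G0: "G k \<ge> 0" for k unfolding G_def using c by (intro prod_nonneg) auto
  have le: "exp (- \<alpha> * (norm (x - z))\<^sup>2) \<le> G (?k x)" for x :: 'a
  proof -
    have "(norm (x - z))\<^sup>2 = (\<Sum>b\<in>Basis. ((x - z) \<bullet> b)\<^sup>2)"
      unfolding power2_norm_eq_inner euclidean_inner[of "x - z" "x - z"] by (simp add: power2_eq_square)
    then have "exp (- \<alpha> * (norm (x - z))\<^sup>2) = (\<Prod>b\<in>Basis. exp (- \<alpha> * ((x - z) \<bullet> b)\<^sup>2))"
      by (simp add: sum_distrib_left exp_sum flip: sum_negf)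
    also have "\<dots> \<le> G (?k x)" unfolding G_def
    proof (rule prod_mono, safe)
      fix b :: 'a assume b: "b \<in> Basis"
      define t where "t = \<bar>(x - z) \<bullet> b\<bar>"
      define n where "n = nat \<bar>\<lfloor>N * (x \<bullet> b)\<rfloor>\<bar>"
      have "0 \<le> (t * sqrt \<alpha> - N / (2 * sqrt \<alpha>))\<^sup>2" by simp
      also have "\<dots> = \<alpha> * t\<^sup>2 - N * t + N\<^sup>2 / (4 * \<alpha>)"
        using assms(2) by (simp add: power2_diff power_mult_distrib power_divide)
      finally have 1: "- \<alpha> * t\<^sup>2 \<le> - N * t + N\<^sup>2 / (4 * \<alpha>)" by simp
      have "x \<bullet> b = (x - z) \<bullet> b + z \<bullet> b" by (simp add: inner_diff_left)
      then have "\<bar>x \<bullet> b\<bar> \<le> t + \<bar>z \<bullet> b\<bar>" unfolding t_def by linarith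
      also have "\<dots> \<le> t + norm z" using Basis_le_norm[OF b, of z] by simp
      finally have "N * \<bar>x \<bullet> b\<bar> \<le> N * (t + norm z)" using N by (intro mult_left_mono) auto
      then have "\<bar>N * (x \<bullet> b)\<bar> \<le> N * t + N * norm z" using N by (simp add: abs_mult distrib_left)
      then have "real n \<le> N * t + N * norm z + 1" unfolding n_def by linarith
      then have "- \<alpha> * t\<^sup>2 \<le> (1 + N * norm z + N\<^sup>2 / (4 * \<alpha>)) + real n * (- 1)" using 1 by simp
      then have "exp (- \<alpha> * t\<^sup>2) \<le> c * exp (real n * (- 1))"
        unfolding c_def by (simp flip: exp_add)
      also have "exp (real n * (- 1)) = exp (- 1) ^ n" by (rule exp_of_nat_mult)
      also have "\<dots> \<le> (1 / 2) ^ n"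
      proof (rule power_mono)
        have "(2::real) \<le> exp 1" using exp_ge_add_one_self[of "1::real"] by simp
        then show "exp (- 1) \<le> (1 / 2::real)" by (simp add: exp_minus field_simps)
      qed simp
      finally show "exp (- \<alpha> * ((x - z) \<bullet> b)\<^sup>2) \<le> c * (1 / 2) ^ nat \<bar>?k x b\<bar>"
        using c b by (simp add: t_def n_def)
    qed simp
    finally show ?thesis .
  qed
  show ?thesis
  proof (rule nonneg_bdd_above_summable_on)
    show "bdd_above (sum (\<lambda>x. exp (- \<alpha> * (norm (x - z))\<^sup>2)) ` {F. F \<subseteq> L \<and> finite F})"
    proof (rule bdd_aboveI2)
      fix F assume F: "F \<in> {F. F \<subseteq> L \<and> finite F}"
      define K where "K = nat (Max (insert 0 ((\<lambda>(x,b). \<bar>\<lfloor>N * (x \<bullet> b)\<rfloor>\<bar>) ` (F \<times> Basis))))"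
      have K: "\<bar>\<lfloor>N * (x \<bullet> b)\<rfloor>\<bar> \<le> int K" if "x \<in> F" "b \<in> Basis" for x b
      proof -
        have "\<bar>\<lfloor>N * (x \<bullet> b)\<rfloor>\<bar> \<le> Max (insert 0 ((\<lambda>(x,b). \<bar>\<lfloor>N * (x \<bullet> b)\<rfloor>\<bar>) ` (F \<times> Basis)))"
          by (rule Max_ge) (use F that in auto)
        then show ?thesis unfolding K_def by linarith
      qed
      have "(\<Sum>x\<in>F. exp (- \<alpha> * (norm (x - z))\<^sup>2)) \<le> (\<Sum>x\<in>F. G (?k x))"
        by (intro sum_mono le)
      also have "\<dots> = (\<Sum>k\<in>?k ` F. G k)"
        using F by (subst sum.reindex) (auto intro: inj_on_subset[OF N(2)])
      also have "\<dots> \<le> (\<Sum>k\<in>PiE Basis (\<lambda>_. {-int K..int K}). G k)"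
      proof (rule sum_mono2)
        show "?k ` F \<subseteq> PiE Basis (\<lambda>_. {-int K..int K})"
        proof (safe intro!: PiE_I; clarsimp)
          fix x b assume "x \<in> F" "b \<in> (Basis :: 'a set)"
          then show "- int K \<le> \<lfloor>N * (x \<bullet> b)\<rfloor> \<and> \<lfloor>N * (x \<bullet> b)\<rfloor> \<le> int K"
            using K[of x b] by linarith
        qed
      qed (auto intro!: finite_PiE G0)
      also have "\<dots> = (\<Prod>b\<in>(Basis :: 'a set). \<Sum>k\<in>{-int K..int K}. c * (1/2) ^ nat \<bar>k\<bar>)"
        unfolding G_def by (subst prod_sum_PiE) auto
      \<comment> \<open>The full series of (1/2)^|k| over the integers has sum 3.\<close>
      also have "\<dots> \<le> (\<Prod>b\<in>(Basis :: 'a set). c * 3)"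
      proof (rule prod_mono, safe)
        show "(\<Sum>k\<in>{-int K..int K}. c * (1/2) ^ nat \<bar>k\<bar>) \<le> c * 3"
          using c by (simp add: sum_half_power_abs flip: sum_distrib_left)
      qed (use c in \<open>auto intro!: sum_nonneg\<close>)
      finally show "(\<Sum>x\<in>F. exp (- \<alpha> * (norm (x - z))\<^sup>2)) \<le> (\<Prod>b\<in>(Basis :: 'a set). c * 3)" .
    qed
  qed simp
qed

section \<open>Equivalence of points under lattice isometries\<close>

text \<open>The isometries act on the ambient space and may be affine, so that translations by
  lattice vectors are included; the clause on \<open>span L\<close> keeps holes inside the space
  spanned by \<open>L\<close>.\<close>

definition lattice_equiv :: "'a::euclidean_space set \<Rightarrow> 'a \<Rightarrow> 'a \<Rightarrow> bool" where
  "lattice_equiv L z w \<longleftrightarrow> (\<exists>g. (\<forall>x y. dist (g x) (g y) = dist x y) \<and> surj g \<and> g ` L = L \<and>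
     g ` span L = span L \<and> g z = w)"

lemma lattice_equiv_refl: "lattice_equiv L z z"
  unfolding lattice_equiv_def by (rule exI[of _ id]) auto

lemma lattice_equiv_trans:
  assumes "lattice_equiv L z w" "lattice_equiv L w v"
  shows "lattice_equiv L z v"
proof -
  obtain g h where
    "\<forall>x y. dist (g x) (g y) = dist x y" "surj g" "g ` L = L" "g ` span L = span L" "g z = w"
    "\<forall>x y. dist (h x) (h y) = dist x y" "surj h" "h ` L = L" "h ` span L = span L" "h w = v"
    using assms unfolding lattice_equiv_def by blast
  then have "(\<forall>x y. dist ((h \<circ> g) x) ((h \<circ> g) y) = dist x y) \<and> surj (h \<circ> g) \<and> (h \<circ> g) ` L = L \<and>
     (h \<circ> g) ` span L = span L \<and> (h \<circ> g) z = v"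
    by (metis comp_apply comp_surj image_comp)
  then show ?thesis unfolding lattice_equiv_def by blast
qed

lemma lattice_equiv_sym:
  assumes "lattice_equiv L z w"
  shows "lattice_equiv L w z"
proof -
  obtain g where g: "\<And>x y. dist (g x) (g y) = dist x y" "surj g" "g ` L = L"
    "g ` span L = span L" "g z = w"
    using assms unfolding lattice_equiv_def by blast
  have "inj g" by (rule injI) (metis g(1) dist_eq_0_iff)
  then have i: "inv g (g x) = x" "g (inv g x) = x" for x
    using g(2) by (simp_all add: surj_f_inv_f)
  have "dist (inv g x) (inv g y) = dist x y" for x y
    by (metis g(1) i(2))
  moreover have "surj (inv g)" by (metis i(1) surjI)
  moreover have "inv g ` L = L" "inv g ` span L = span L"
    by (metis g(3,4) \<open>inj g\<close> image_inv_f_f)+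
  moreover have "inv g w = z" using g(5) i(1) by blast
  ultimately show ?thesis unfolding lattice_equiv_def by blast
qed

lemma lattice_equiv_span: "lattice_equiv L z w \<Longrightarrow> z \<in> span L \<Longrightarrow> w \<in> span L"
  unfolding lattice_equiv_def by blast

lemma gaussian_sum_equiv:
  assumes "lattice_equiv L z w"
  shows "gaussian_sum L \<alpha> w = gaussian_sum L \<alpha> z"
proof -
  obtain g where g: "\<And>x y. dist (g x) (g y) = dist x y" "g ` L = L" "g z = w"
    using assms unfolding lattice_equiv_def by blast
  have "inj g" by (rule injI) (metis g(1) dist_eq_0_iff)
  then have "inj_on g L" by (rule inj_on_subset) simp
  have "gaussian_sum L \<alpha> w = infsum (\<lambda>x. exp (- \<alpha> * (norm (x - w))\<^sup>2)) (g ` L)"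
    by (simp add: gaussian_sum_def g(2))
  also have "\<dots> = infsum ((\<lambda>x. exp (- \<alpha> * (norm (x - w))\<^sup>2)) \<circ> g) L"
    by (rule infsum_reindex[OF \<open>inj_on g L\<close>])
  also have "\<dots> = gaussian_sum L \<alpha> z"
    unfolding gaussian_sum_def o_def g(3)[symmetric] by (simp add: g(1) flip: dist_norm)
  finally show ?thesis .
qed

lemma infdist_equiv:
  assumes "lattice_equiv L z w"
  shows "infdist w L = infdist z L"
proof -
  obtain g where g: "\<And>x y. dist (g x) (g y) = dist x y" "g ` L = L" "g z = w"
    using assms unfolding lattice_equiv_def by blast
  have "infdist w (g ` L) = infdist z L"
    unfolding infdist_def g(3)[symmetric] by (simp add: image_image g(1))
  then show ?thesis by (simp add: g(2))
qed

lemma lattice_equiv_translate: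
  assumes L: "discrete_subgroup L" and v: "v \<in> L"
  shows "lattice_equiv L z (z + v)"
  unfolding lattice_equiv_def
proof (intro exI[of _ "\<lambda>x. x + v"] conjI allI)
  show "surj (\<lambda>x. x + v)" by (rule surjI[of _ "\<lambda>x. x - v"]) simp
  have "(\<lambda>x. x + v) ` S = S" if "\<And>x. x \<in> S \<Longrightarrow> x + v \<in> S" "\<And>x. x \<in> S \<Longrightarrow> x - v \<in> S" for S
  proof
    show "S \<subseteq> (\<lambda>x. x + v) ` S"
      using that(2) by (intro subsetI image_eqI[where x = "_ - v"]) auto
  qed (use that in auto)
  then show "(\<lambda>x. x + v) ` L = L" "(\<lambda>x. x + v) ` span L = span L"
    using L v by (simp_all add: discrete_subgroup_add discrete_subgroup_diff span_add span_diff span_base)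
qed simp_all

lemma lattice_equiv_linear:
  assumes g: "linear g" "\<And>x. norm (g x) = norm x" and gL: "g ` L = L"
  shows "lattice_equiv L z (g z)"
  unfolding lattice_equiv_def
proof (intro exI[of _ g] conjI allI)
  show "dist (g x) (g y) = dist x y" for x y
    by (simp add: dist_norm g(2) flip: linear_diff[OF g(1)])
  have "inj g" unfolding linear_inj_iff_eq_0[OF g(1)] using g(2) by (metis norm_eq_zero)
  then show "surj g" using g(1) linear_injective_imp_surjective by blast
  show "g ` span L = span L" using linear_span_image[OF g(1), of L] gL by simp
qed (use gL in auto)

lemma lattice_equiv_involution:
  assumes "linear g" "\<And>x. norm (g x) = norm x" "\<And>x. x \<in> L \<Longrightarrow> g x \<in> L" "\<And>x. g (g x) = x"
  shows "lattice_equiv L z (g z)"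
  by (rule lattice_equiv_linear) (use assms in \<open>auto intro: image_eqI[where x = "g _"]\<close>)

lemma lattice_equiv_reflect_point:
  assumes L: "discrete_subgroup L" and c: "2 *\<^sub>R c \<in> L"
  shows "lattice_equiv L (c + u) (c - u)"
proof -
  have "lattice_equiv L (c + u) (- (c + u))"
    by (rule lattice_equiv_involution) (auto intro: discrete_subgroup_minus[OF L] linear_uminus)
  moreover have "lattice_equiv L (- (c + u)) (- (c + u) + 2 *\<^sub>R c)"
    by (rule lattice_equiv_translate[OF L c])
  moreover have "- (c + u) + 2 *\<^sub>R c = c - u" by (simp add: scaleR_2)
  ultimately show ?thesis by (metis lattice_equiv_trans)
qed

section \<open>The local estimate at a deep hole\<close>

lemma exp_quadratic_bound:
  fixes y :: real
  assumes "y \<ge> 0"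
  shows "y\<^sup>2 / 2 \<le> exp y - 1 - y"
  using exp_lower_Taylor_quadratic[OF assms] by simp

text \<open>Put s = \<alpha> r^2 and w = \<alpha> \<kappa> r; then s \<le> w and w^2 = \<alpha>
  \<kappa>^2 s. For s \<le> 1 the left side is at most 2 C s \<le> 2 w^2, the quadratic part of the
  right side. For s > 1 the factor exp w exceeds C + 2. The two bounds on \<alpha> in
  \<open>?A\<close> belong to these two regimes.\<close>

lemma exp_gain:
  fixes C \<kappa> :: real
  assumes C: "C \<ge> 0" and \<kappa>: "\<kappa> > 0"
  obtains A where "A > 0" "\<And>\<alpha> r. A \<le> \<alpha> \<Longrightarrow> 0 \<le> r \<Longrightarrow> r \<le> \<kappa> \<Longrightarrow>
     C * (exp (\<alpha> * r\<^sup>2) - 1) \<le> exp (2 * \<alpha> * \<kappa> * r) - 1 - 2 * \<alpha> * \<kappa> * r"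
proof
  let ?A = "max 1 (max (C / \<kappa>\<^sup>2) (((C + 1) / \<kappa>)\<^sup>2))"
  show "?A > 0" by simp
  fix \<alpha> r :: real
  assume \<alpha>: "?A \<le> \<alpha>" and r: "0 \<le> r" "r \<le> \<kappa>"
  have \<alpha>0: "\<alpha> > 0" using \<alpha> by simp
  define w where "w = \<alpha> * \<kappa> * r"
  define s where "s = \<alpha> * r\<^sup>2"
  have w0: "w \<ge> 0" using \<alpha>0 \<kappa> r by (simp add: w_def)
  have s0: "s \<ge> 0" using \<alpha>0 by (simp add: s_def)
  have sw: "s \<le> w" using \<alpha>0 r mult_right_mono[OF r(2) r(1)]
    by (simp add: s_def w_def power2_eq_square mult.assoc)
  have ww: "w\<^sup>2 = \<alpha> * \<kappa>\<^sup>2 * s" by (simp add: w_def s_def power2_eq_square)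
  have "C * (exp s - 1) \<le> exp (2 * w) - 1 - 2 * w"
  proof (cases "s \<le> 1")
    case True
    have "exp s \<le> 1 + s + s\<^sup>2" by (rule exp_bound[OF s0 True])
    also have "s\<^sup>2 \<le> s" using True s0 by (simp add: power2_eq_square mult_left_le)
    finally have "C * (exp s - 1) \<le> C * (2 * s)" by (intro mult_left_mono[OF _ C]) simp
    also have "C \<le> \<alpha> * \<kappa>\<^sup>2" using \<alpha> \<kappa> by (simp add: field_simps)
    then have "C * (2 * s) \<le> (\<alpha> * \<kappa>\<^sup>2) * (2 * s)" using s0 by (intro mult_right_mono) auto
    also have "\<dots> = (2 * w)\<^sup>2 / 2" by (simp add: power_mult_distrib ww)
    also have "\<dots> \<le> exp (2 * w) - 1 - 2 * w" by (rule exp_quadratic_bound) (use w0 in simp)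
    finally show ?thesis .
  next
    case False
    have "((C + 1) / \<kappa>)\<^sup>2 \<le> \<alpha>" using \<alpha> by simp
    then have "(C + 1)\<^sup>2 \<le> \<alpha> * \<kappa>\<^sup>2" using \<kappa> by (simp add: power_divide field_simps)
    also have "\<dots> \<le> \<alpha> * \<kappa>\<^sup>2 * s" using False \<alpha>0 mult_left_mono[of 1 s "\<alpha> * \<kappa>\<^sup>2"] by simp
    finally have "(C + 1)\<^sup>2 \<le> w\<^sup>2" by (simp add: ww)
    then have "C + 1 \<le> w" using w0 by (rule power2_le_imp_le)
    moreover have e: "1 + w \<le> exp w" by (rule exp_ge_add_one_self)
    ultimately have "C + 2 \<le> exp w" by linarith
    then have "(C + 2) * exp w \<le> exp w * exp w" by (intro mult_right_mono) auto
    then have 1: "C * exp w + 2 * exp w \<le> exp (2 * w)" by (simp add: distrib_right flip: exp_add)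
    have "C * (exp s - 1) \<le> C * exp w" using sw C by (intro mult_left_mono) (auto intro: order_trans[of _ "exp s"])
    then show ?thesis using 1 e by linarith
  qed
  then show "C * (exp (\<alpha> * r\<^sup>2) - 1) \<le> exp (2 * \<alpha> * \<kappa> * r) - 1 - 2 * \<alpha> * \<kappa> * r"
    by (simp add: w_def s_def mult.assoc)
qed

text \<open>A point reached from \<open>c\<close> by a short step along \<open>u\<close> still has a
  lattice point within \<open>R\<close>. If the step is smaller than the gap to the next shell
  around \<open>c\<close>, that point is a nearest point of \<open>c\<close>, and expanding the
  squared distance bounds its inner product with \<open>u\<close> from below.\<close>

lemma deep_hole_gain:
  fixes L :: "'a::euclidean_space set"
  assumes L: "discrete_subgroup L" and c: "c \<in> span L"
    and far: "\<And>x. x \<in> L \<Longrightarrow> R \<le> norm (x - c)"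
    and cov: "\<And>z. z \<in> span L \<Longrightarrow> \<exists>x\<in>L. norm (x - z) \<le> R"
  obtains \<kappa> where "\<kappa> > 0"
    "\<And>u. u \<in> span L \<Longrightarrow> \<exists>x\<in>L. norm (x - c) = R \<and> \<kappa> * norm u \<le> (x - c) \<bullet> u"
proof -
  \<comment> \<open>\<open>F\<close> contains the points beyond the nearest shell, out to
    \<open>R + 1\<close>; \<open>t\<close> is half the smallest gap to them, capped at 1 so that the
    step cannot lead past \<open>F\<close>.\<close>
  define F where "F = {x \<in> L \<inter> cball c (R + 1). R < norm (x - c)}"
  define t where "t = Min (insert 1 ((\<lambda>x. (norm (x - c) - R) / 2) ` F))"
  have F: "finite F" unfolding F_def
    by (rule finite_subset[OF _ discrete_subgroup_finite_cball[OF L, of c "R + 1"]]) auto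
  have t0: "t > 0" unfolding t_def using F by (subst Min_gr_iff) (auto simp: F_def)
  have t1: "t \<le> 1" unfolding t_def using F by (intro Min_le) auto
  have tF: "2 * t \<le> norm (x - c) - R" if "x \<in> F" for x
  proof -
    have "t \<le> (norm (x - c) - R) / 2" unfolding t_def using F that by (intro Min_le) auto
    then show ?thesis by simp
  qed
  have "\<exists>x\<in>L. norm (x - c) = R \<and> t / 2 * norm u \<le> (x - c) \<bullet> u" if u: "u \<in> span L" for u
  proof (cases "u = 0")
    case True
    obtain x where "x \<in> L" "norm (x - c) \<le> R" using cov[OF c] by blast
    then show ?thesis using far[of x] True by force
  next
    case False
    define v where "v = (t / norm u) *\<^sub>R u"
    have v: "norm v = t" using False t0 by (simp add: v_def)
    have "c + v \<in> span L" unfolding v_def using c u by (simp add: span_add span_scale)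
    then obtain x where x: "x \<in> L" "norm (x - (c + v)) \<le> R" using cov by blast
    have "norm (x - c) \<le> norm (x - (c + v)) + norm v"
      using norm_triangle_ineq[of "x - (c + v)" v] by simp
    then have le: "norm (x - c) \<le> R + t" using x(2) v by simp
    have eq: "norm (x - c) = R"
    proof (rule ccontr)
      assume "norm (x - c) \<noteq> R"
      then have "x \<in> F" using far[OF x(1)] x(1) le t1
        by (auto simp: F_def dist_norm norm_minus_commute)
      then show False using tF[of x] le t0 by simp
    qed
    have "(norm ((x - c) - v))\<^sup>2 \<le> R\<^sup>2" using x(2) by (intro power_mono) (auto simp: algebra_simps)
    then have "(norm (x - c))\<^sup>2 - 2 * ((x - c) \<bullet> v) + t\<^sup>2 \<le> R\<^sup>2"
      by (simp add: power2_norm_eq_inner inner_diff_left inner_diff_right inner_commute flip: v)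
    then have "t\<^sup>2 \<le> 2 * ((x - c) \<bullet> v)" by (simp add: eq)
    also have "\<dots> = t * (2 * ((x - c) \<bullet> u) / norm u)" by (simp add: v_def)
    finally have "t \<le> 2 * ((x - c) \<bullet> u) / norm u" unfolding power2_eq_square using t0 by (rule mult_left_le_imp_le)
    then have "t / 2 * norm u \<le> (x - c) \<bullet> u" using False by (simp add: field_simps)
    then show ?thesis using x(1) eq by blast
  qed
  then show ?thesis using that[of "t / 2"] t0 by simp
qed

lemma has_sum_sum:
  fixes f :: "'i \<Rightarrow> 'a \<Rightarrow> 'b::topological_comm_monoid_add"
  assumes "\<And>j. j \<in> J \<Longrightarrow> (f j has_sum s j) A"
  shows "((\<lambda>x. \<Sum>j\<in>J. f j x) has_sum (\<Sum>j\<in>J. s j)) A"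
  using assms by (induction J rule: infinite_finite_induct) (auto intro: has_sum_add)

text \<open>Averaging over the symmetries \<open>g j\<close> turns every term of the sum at \<open>c + u\<close> into its value
  at \<open>c\<close> times \<open>exp (- \<alpha> |u|\<^sup>2)\<close> and a mean of exponentials, which is at least 1 since the
  exponents cancel; a nearest lattice point in the direction of \<open>u\<close> makes up for the first factor.\<close>

lemma gaussian_sum_local_bound:
  fixes L :: "'a::euclidean_space set" and g :: "nat \<Rightarrow> 'a \<Rightarrow> 'a"
  assumes L: "discrete_subgroup L" and \<alpha>: "\<alpha> > 0" and k: "k > 0"
    and g0: "g 0 u = u" and gnorm: "\<And>j. j < k \<Longrightarrow> norm (g j u) = norm u"
    and gequiv: "\<And>j. j < k \<Longrightarrow> lattice_equiv L (c + u) (c + g j u)"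
    and gsum: "(\<Sum>j<k. g j u) = 0"
    and p: "p \<in> L" "norm (p - c) = R" "0 \<le> y" "y \<le> 2 * \<alpha> * ((p - c) \<bullet> u)"
  shows "exp (- \<alpha> * (norm u)\<^sup>2) * (gaussian_sum L \<alpha> c + exp (- \<alpha> * R\<^sup>2) * ((exp y - 1 - y) / k))
    \<le> gaussian_sum L \<alpha> (c + u)"
proof -
  define E where "E = exp (- \<alpha> * (norm u)\<^sup>2)"
  define f where "f = (\<lambda>x. exp (- \<alpha> * (norm (x - c))\<^sup>2))"
  define b where "b = (\<lambda>j x. 2 * \<alpha> * ((x - c) \<bullet> g j u))"
  have sumb: "(\<Sum>j<k. b j x) = 0" for x
  proof -
    have "(\<Sum>j<k. b j x) = 2 * \<alpha> * ((x - c) \<bullet> (\<Sum>j<k. g j u))"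
      by (simp add: b_def sum_distrib_left inner_sum_right)
    then show ?thesis by (simp add: gsum)
  qed
  have term_eq: "exp (- \<alpha> * (norm (x - (c + g j u)))\<^sup>2) = E * f x * exp (b j x)" if "j < k" for j x
  proof -
    have "(norm ((x - c) - g j u))\<^sup>2 = (norm (x - c))\<^sup>2 - 2 * ((x - c) \<bullet> g j u) + (norm (g j u))\<^sup>2"
      by (simp add: power2_norm_eq_inner inner_diff_left inner_diff_right inner_commute)
    then have "(norm (x - (c + g j u)))\<^sup>2 = (norm (x - c))\<^sup>2 - 2 * ((x - c) \<bullet> g j u) + (norm u)\<^sup>2"
      by (simp add: gnorm[OF that] diff_diff_eq)
    then have "- \<alpha> * (norm (x - (c + g j u)))\<^sup>2
        = - \<alpha> * (norm u)\<^sup>2 + - \<alpha> * (norm (x - c))\<^sup>2 + b j x"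
      unfolding b_def by (simp only:) (simp add: distrib_left right_diff_distrib)
    then show ?thesis by (simp only: E_def f_def exp_add)
  qed
  have sf: "f summable_on L" unfolding f_def by (rule gaussian_summable[OF L \<alpha>])
  have sj: "(\<lambda>x. E * f x * exp (b j x)) summable_on L" if "j < k" for j
    unfolding term_eq[OF that, symmetric] by (rule gaussian_summable[OF L \<alpha>])
  have gj: "gaussian_sum L \<alpha> (c + u) = infsum (\<lambda>x. E * f x * exp (b j x)) L" if "j < k" for j
    unfolding term_eq[OF that, symmetric]
    using gaussian_sum_equiv[OF gequiv[OF that]] by (simp add: gaussian_sum_def)
  have gain: "real k \<le> (\<Sum>j<k. exp (b j x))" for x
  proof -
    have "(\<Sum>j<k. 1 + b j x) \<le> (\<Sum>j<k. exp (b j x))" by (intro sum_mono) simp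
    then show ?thesis by (simp add: sum.distrib sumb)
  qed
  \<comment> \<open>Since the \<open>b j p\<close> cancel, the excess of the sum of exponentials
    over \<open>k\<close> is the sum of the nonnegative \<open>h (b j p)\<close>, of which only
    \<open>j = 0\<close> is kept.\<close>
  have gain0: "real k + (exp y - 1 - y) \<le> (\<Sum>j<k. exp (b j p))"
  proof -
    define h where "h = (\<lambda>t::real. exp t - 1 - t)"
    have h0: "h t \<ge> 0" for t using exp_ge_add_one_self[of t] unfolding h_def by linarith
    have y: "y \<le> b 0 p" using p(4) by (simp add: b_def g0)
    have "h y \<le> h (b 0 p)"
    proof -
      let ?d = "b 0 p - y"
      have "1 * (1 + ?d) \<le> exp y * exp ?d"
        using p(3) y by (intro mult_mono) auto
      moreover have "exp y * exp ?d = exp (b 0 p)" by (simp flip: exp_add)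
      moreover have "1 * ?d \<le> exp y * ?d" using p(3) y by (intro mult_right_mono) auto
      moreover have "exp y * (1 + ?d) \<le> exp y * exp ?d" by (intro mult_left_mono) auto
      ultimately show ?thesis unfolding h_def by (simp add: distrib_left)
    qed
    also have "h (b 0 p) \<le> (\<Sum>j<k. h (b j p))"
      using k by (intro member_le_sum) (auto simp: h0)
    also have "\<dots> = (\<Sum>j<k. exp (b j p)) - real k" by (simp add: h_def sum_subtractf sumb)
    finally show ?thesis by (simp add: h_def)
  qed
  have E0: "E > 0" by (simp add: E_def)
  have f0: "f x > 0" for x by (simp add: f_def)
  have 1: "((\<lambda>x. \<Sum>j<k. E * f x * exp (b j x)) has_sum (\<Sum>j<k. gaussian_sum L \<alpha> (c + u))) L"
    by (rule has_sum_sum) (use sj gj in \<open>auto simp: summable_iff_has_sum_infsum\<close>)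
  have "((\<lambda>x. E * real k * f x) has_sum (E * real k * gaussian_sum L \<alpha> c)) L"
    using sf unfolding gaussian_sum_def f_def by (intro has_sum_cmult_right) (simp add: summable_iff_has_sum_infsum)
  moreover have "((\<lambda>x. if x = p then E * f p * (exp y - 1 - y) else 0) has_sum
      (\<Sum>x\<in>{p}. E * f p * (exp y - 1 - y))) L"
    by (rule has_sum_cong_neutral[THEN iffD1, OF _ _ _ has_sum_finite]) (use p(1) in auto)
  ultimately have 2: "((\<lambda>x. E * real k * f x + (if x = p then E * f p * (exp y - 1 - y) else 0)) has_sum
      (E * real k * gaussian_sum L \<alpha> c + E * f p * (exp y - 1 - y))) L"
    using has_sum_add by fastforce
  have "E * real k * gaussian_sum L \<alpha> c + E * f p * (exp y - 1 - y)
      \<le> (\<Sum>j<k. gaussian_sum L \<alpha> (c + u))"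
  proof (rule has_sum_mono[OF 2 1])
    fix x assume "x \<in> L"
    have "E * f x * real k \<le> E * f x * (\<Sum>j<k. exp (b j x))"
      using gain[of x] E0 f0[of x] by (intro mult_left_mono) auto
    moreover have "E * f p * (real k + (exp y - 1 - y)) \<le> E * f p * (\<Sum>j<k. exp (b j p))"
      using gain0 E0 f0[of p] by (intro mult_left_mono) auto
    ultimately show "E * real k * f x + (if x = p then E * f p * (exp y - 1 - y) else 0)
        \<le> (\<Sum>j<k. E * f x * exp (b j x))"
      by (auto simp: algebra_simps simp flip: sum_distrib_left)
  qed
  then have "E * real k * gaussian_sum L \<alpha> c + E * f p * (exp y - 1 - y)
    \<le> real k * gaussian_sum L \<alpha> (c + u)" by simp
  then have "E * (gaussian_sum L \<alpha> c + f p * ((exp y - 1 - y) / k)) \<le> gaussian_sum L \<alpha> (c + u)"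
    using k by (simp add: field_simps)
  then show ?thesis by (simp add: E_def f_def p(2))
qed

section \<open>From the local estimate to the global minimum\<close>

text \<open>Raising the parameter from 1 to \<alpha> multiplies each term by at most
  \<open>exp ((1 - \<alpha>) * R\<^sup>2)\<close>, because no lattice point is closer than
  \<open>R\<close>. All shells are thus absorbed in a constant independent of \<alpha>.\<close>

lemma gaussian_sum_upper_bound:
  fixes L :: "'a::euclidean_space set"
  assumes L: "discrete_subgroup L" and \<alpha>: "\<alpha> \<ge> 1" and R: "R \<ge> 0"
    and far: "\<And>x. x \<in> L \<Longrightarrow> R \<le> norm (x - c)"
  shows "gaussian_sum L \<alpha> c \<le> (exp (R\<^sup>2) * gaussian_sum L 1 c) * exp (- \<alpha> * R\<^sup>2)"
proof -
  have "gaussian_sum L \<alpha> c \<le> infsum (\<lambda>x. exp ((1 - \<alpha>) * R\<^sup>2) * exp (- 1 * (norm (x - c))\<^sup>2)) L"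
    unfolding gaussian_sum_def
  proof (rule infsum_mono)
    fix x assume "x \<in> L"
    then have "R\<^sup>2 \<le> (norm (x - c))\<^sup>2" using far R by (intro power_mono) auto
    then have "(\<alpha> - 1) * R\<^sup>2 \<le> (\<alpha> - 1) * (norm (x - c))\<^sup>2" using \<alpha> by (intro mult_left_mono) auto
    then show "exp (- \<alpha> * (norm (x - c))\<^sup>2) \<le> exp ((1 - \<alpha>) * R\<^sup>2) * exp (- 1 * (norm (x - c))\<^sup>2)"
      by (simp add: algebra_simps flip: exp_add)
  next
    show "(\<lambda>x. exp (- \<alpha> * (norm (x - c))\<^sup>2)) summable_on L"
      using \<alpha> by (intro gaussian_summable[OF L]) simp
    show "(\<lambda>x. exp ((1 - \<alpha>) * R\<^sup>2) * exp (- 1 * (norm (x - c))\<^sup>2)) summable_on L"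
      by (intro summable_on_cmult_right gaussian_summable[OF L]) simp
  qed
  also have "\<dots> = exp ((1 - \<alpha>) * R\<^sup>2) * gaussian_sum L 1 c"
    unfolding gaussian_sum_def by (rule infsum_cmult_right')
  also have "exp ((1 - \<alpha>) * R\<^sup>2) = exp (R\<^sup>2) * exp (- \<alpha> * R\<^sup>2)"
    by (simp add: algebra_simps flip: exp_add)
  finally show ?thesis by (simp add: mult_ac)
qed

lemma gaussian_sum_nonneg: "gaussian_sum L \<alpha> z \<ge> 0"
  unfolding gaussian_sum_def by (intro infsum_nonneg) simp

lemma gaussian_sum_lower_bound:
  fixes L :: "'a::euclidean_space set"
  assumes L: "discrete_subgroup L" and \<alpha>: "\<alpha> > 0" and x: "x \<in> L" "norm (x - z) \<le> r"
  shows "exp (- \<alpha> * r\<^sup>2) \<le> gaussian_sum L \<alpha> z"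
proof -
  have "(norm (x - z))\<^sup>2 \<le> r\<^sup>2" using x(2) by (intro power_mono) auto
  then have "exp (- \<alpha> * r\<^sup>2) \<le> (\<Sum>x\<in>{x}. exp (- \<alpha> * (norm (x - z))\<^sup>2))" using \<alpha> by simp
  also have "\<dots> \<le> gaussian_sum L \<alpha> z"
    unfolding gaussian_sum_def
    by (rule finite_sum_le_infsum) (use x gaussian_summable[OF L \<alpha>] in auto)
  finally show ?thesis .
qed

lemma exists_nearest:
  fixes L :: "'a::euclidean_space set"
  assumes "discrete_subgroup L"
  obtains x where "x \<in> L" "infdist z L = norm (x - z)" "\<And>y. y \<in> L \<Longrightarrow> norm (x - z) \<le> norm (y - z)"
proof -
  have "L \<noteq> {}" using discrete_subgroup_zero[OF assms] by auto
  from infdist_attains_inf[OF discrete_subgroup_closed[OF assms] this, of z]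
  obtain x where x: "x \<in> L" "infdist z L = dist z x" by blast
  then have "norm (x - z) \<le> norm (y - z)" if "y \<in> L" for y
    using infdist_le[OF that, of z] by (simp add: dist_norm norm_minus_commute)
  then show ?thesis using that x by (simp add: dist_norm norm_minus_commute)
qed

text \<open>\<open>cov\<close> carries two facts at once: \<open>R\<close> is the covering radius,
  and it is attained only on the orbit of \<open>c\<close>, so any deep hole may be traded for
  \<open>c\<close>. Averaging over \<open>k\<close> symmetries divides the gain by \<open>k\<close>,
  whence the constant \<open>k * C\<close> handed to \<open>exp_gain\<close>.\<close>

theorem deep_holes_stable:
  fixes L :: "'a::euclidean_space set" and g :: "nat \<Rightarrow> 'a \<Rightarrow> 'a"
  assumes L: "discrete_subgroup L" and c: "c \<in> span L"
    and far: "\<And>x. x \<in> L \<Longrightarrow> R \<le> norm (x - c)" and near: "\<exists>x\<in>L. norm (x - c) \<le> R"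
    and cov: "\<And>z. z \<in> span L \<Longrightarrow> (\<exists>x\<in>L. norm (x - z) < R) \<or> lattice_equiv L z c"
    and k: "k > 0" and g0: "\<And>u. g 0 u = u"
    and gnorm: "\<And>j u. j < k \<Longrightarrow> u \<in> span L \<Longrightarrow> norm (g j u) = norm u"
    and gequiv: "\<And>j u. j < k \<Longrightarrow> u \<in> span L \<Longrightarrow> lattice_equiv L (c + u) (c + g j u)"
    and gsum: "\<And>u. u \<in> span L \<Longrightarrow> (\<Sum>j<k. g j u) = 0"
    and hole: "deep_hole L c'"
  shows "stable_cold_spot L c'"
proof -
  let ?f = "gaussian_sum L"
  have R0: "R \<ge> 0" using near norm_ge_zero order_trans by blast
  have L0: "L \<noteq> {}" using discrete_subgroup_zero[OF L] by auto
  have infdist_c: "infdist c L = R"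
  proof (rule antisym)
    obtain x where "x \<in> L" "norm (x - c) \<le> R" using near by blast
    then show "infdist c L \<le> R"
      using infdist_le[of x L c] by (simp add: dist_norm norm_minus_commute)
    show "R \<le> infdist c L" by (rule exists_nearest[OF L, of c]) (use far in auto)
  qed
  have infdist_lt: "infdist z L < R" if "x \<in> L" "norm (x - z) < R" for x z
    using infdist_le[OF that(1), of z] that(2) by (simp add: dist_norm norm_minus_commute)
  have infdist_R: "infdist z L \<le> R" if "z \<in> span L" for z
    using cov[OF that] infdist_lt[of _ z] infdist_equiv[of L z c] infdist_c by fastforce
  have cov': "\<exists>x\<in>L. norm (x - z) \<le> R" if "z \<in> span L" for z
    by (rule exists_nearest[OF L, of z]) (use infdist_R[OF that] in metis)
  have deep_equiv: "lattice_equiv L z c" if "z \<in> span L" "infdist z L = R" for z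
    using cov[OF that(1)] infdist_lt[of _ z] that(2) by auto
  have c': "c' \<in> span L" "infdist c L \<le> infdist c' L"
    using hole c unfolding deep_hole_def is_arg_max_def by (auto simp: not_less)
  then have "infdist c' L = R" using infdist_R[OF c'(1)] infdist_c by simp
  then have eq': "?f \<alpha> c' = ?f \<alpha> c" for \<alpha>
    using gaussian_sum_equiv[OF deep_equiv[OF c'(1)]] by simp

  define C where "C = exp (R\<^sup>2) * ?f 1 c"
  have C0: "C \<ge> 0" unfolding C_def using gaussian_sum_nonneg[of L 1 c] by simp
  have fc: "?f \<alpha> c \<le> C * exp (- \<alpha> * R\<^sup>2)" if "\<alpha> \<ge> 1" for \<alpha>
    unfolding C_def by (rule gaussian_sum_upper_bound[OF L that R0 far])
  obtain \<kappa> where \<kappa>: "\<kappa> > 0"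
    "\<And>u. u \<in> span L \<Longrightarrow> \<exists>x\<in>L. norm (x - c) = R \<and> \<kappa> * norm u \<le> (x - c) \<bullet> u"
    using deep_hole_gain[OF L c far cov'] by metis
  have kC: "real k * C \<ge> 0" using C0 by simp
  obtain A where A: "A > 0" "\<And>\<alpha> r. A \<le> \<alpha> \<Longrightarrow> 0 \<le> r \<Longrightarrow> r \<le> \<kappa> \<Longrightarrow>
     real k * C * (exp (\<alpha> * r\<^sup>2) - 1) \<le> exp (2 * \<alpha> * \<kappa> * r) - 1 - 2 * \<alpha> * \<kappa> * r"
    using exp_gain[OF kC \<kappa>(1)] by metis

  have loc: "?f \<alpha> c \<le> ?f \<alpha> (c + u)"
    if \<alpha>: "\<alpha> \<ge> max 1 A" and u: "u \<in> span L" "norm u \<le> \<kappa>" for \<alpha> u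
  proof -
    obtain x where x: "x \<in> L" "norm (x - c) = R" "\<kappa> * norm u \<le> (x - c) \<bullet> u"
      using \<kappa>(2)[OF u(1)] by blast
    define y where "y = 2 * \<alpha> * \<kappa> * norm u"
    have \<alpha>0: "\<alpha> > 0" using \<alpha> by simp
    have y0: "y \<ge> 0" using \<alpha>0 \<kappa>(1) by (simp add: y_def)
    have y1: "y \<le> 2 * \<alpha> * ((x - c) \<bullet> u)"
      using mult_left_mono[OF x(3), of "2 * \<alpha>"] \<alpha>0 by (simp add: y_def mult.assoc)
    define e where "e = exp (\<alpha> * (norm u)\<^sup>2)"
    have e1: "e \<ge> 1" using \<alpha>0 by (simp add: e_def)
    have "real k * C * (e - 1) \<le> exp y - 1 - y"
      using A(2)[of \<alpha> "norm u"] \<alpha> u(2) by (simp add: y_def e_def mult.assoc)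
    then have gain: "C * (e - 1) \<le> (exp y - 1 - y) / k" using k by (simp add: field_simps)
    have "?f \<alpha> c * (e - 1) \<le> (C * exp (- \<alpha> * R\<^sup>2)) * (e - 1)"
      using fc[of \<alpha>] \<alpha> e1 by (intro mult_right_mono) auto
    also have "\<dots> = exp (- \<alpha> * R\<^sup>2) * (C * (e - 1))" by simp
    also have "\<dots> \<le> exp (- \<alpha> * R\<^sup>2) * ((exp y - 1 - y) / k)"
      using gain by (intro mult_left_mono) auto
    finally have "?f \<alpha> c * e \<le> ?f \<alpha> c + exp (- \<alpha> * R\<^sup>2) * ((exp y - 1 - y) / k)"
      by (simp add: right_diff_distrib)
    then have "?f \<alpha> c \<le> exp (- \<alpha> * (norm u)\<^sup>2) * (?f \<alpha> c + exp (- \<alpha> * R\<^sup>2) * ((exp y - 1 - y) / k))"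
      by (simp add: e_def exp_minus field_simps)
    also have "\<dots> \<le> ?f \<alpha> (c + u)"
      by (rule gaussian_sum_local_bound[where g = g and p = x])
        (use L \<alpha>0 k g0 gnorm gequiv gsum u x y0 y1 in auto)
    finally show ?thesis .
  qed

  \<comment> \<open>Modulo translations every point lies in \<open>cball 0 R\<close>, and what is
    left there outside the \<kappa>-neighbourhoods of the holes is compact. The radius \<kappa> is
    the one allowed by \<open>loc\<close>.\<close>
  define H where "H = {z \<in> span L. infdist z L = R}"
  define K where "K = {z \<in> span L \<inter> cball 0 R. \<kappa> \<le> infdist z H}"
  have cH: "c \<in> H" using c infdist_c by (simp add: H_def)
  have "closed {z. \<kappa> \<le> infdist z H}"
    by (intro closed_Collect_le continuous_intros)
  then have "closed ({z. \<kappa> \<le> infdist z H} \<inter> span L)"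
    using closed_subspace[OF subspace_span, of L] by blast
  then have "compact (({z. \<kappa> \<le> infdist z H} \<inter> span L) \<inter> cball 0 R)"
    by (intro closed_Int_compact) auto
  moreover have "K = ({z. \<kappa> \<le> infdist z H} \<inter> span L) \<inter> cball 0 R"
    by (auto simp: K_def)
  ultimately have "compact K" by simp
  have K_lt: "infdist z L < R" if "z \<in> K" for z
  proof -
    have "z \<in> span L" "\<kappa> \<le> infdist z H" using that by (auto simp: K_def)
    then show ?thesis using infdist_R[of z] \<kappa>(1) infdist_zero[of z H] unfolding H_def
      by (cases "infdist z L = R") auto
  qed
  have "\<exists>r. 0 \<le> r \<and> r < R \<and> (\<forall>z\<in>K. infdist z L \<le> r)" if "K \<noteq> {}"
  proof -
    have "continuous_on K (\<lambda>z. infdist z L)" by (intro continuous_intros)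
    from continuous_attains_sup[OF \<open>compact K\<close> that this]
    obtain w where "w \<in> K" "\<forall>z\<in>K. infdist z L \<le> infdist w L" by blast
    then show ?thesis using K_lt[of w] infdist_nonneg[of w L] by blast
  qed
  then obtain r where r: "K \<noteq> {} \<Longrightarrow> 0 \<le> r \<and> r < R" "\<And>z. z \<in> K \<Longrightarrow> infdist z L \<le> r"
    by (metis empty_iff)
  \<comment> \<open>Above this bound, C \<le> \<alpha> (R^2 - r^2), which is less than the
    exponential of the right side. If \<open>K\<close> is empty, the case needing the bound cannot
    occur.\<close>
  define B where "B = (if K = {} then 1 else max 1 (C / (R\<^sup>2 - r\<^sup>2)))"

  have glob: "?f \<alpha> c \<le> ?f \<alpha> z" if \<alpha>: "\<alpha> \<ge> max (max 1 A) B" and z: "z \<in> span L" for \<alpha> z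
  proof (cases "\<exists>h\<in>H. norm (z - h) \<le> \<kappa>")
    case True
    then obtain h where h: "h \<in> H" "norm (z - h) \<le> \<kappa>" by blast
    then have "lattice_equiv L h c" using deep_equiv by (simp add: H_def)
    then obtain t where t: "\<forall>x y. dist (t x) (t y) = dist x y" "surj t" "t ` L = L"
      "t ` span L = span L" "t h = c"
      unfolding lattice_equiv_def by blast
    have "lattice_equiv L z (t z)" unfolding lattice_equiv_def using t by blast
    then have "?f \<alpha> (t z) = ?f \<alpha> z" "t z \<in> span L"
      using gaussian_sum_equiv lattice_equiv_span z by blast+
    moreover have "norm (t z - c) \<le> \<kappa>" using h(2) t(1,5) by (metis dist_norm)
    moreover have "t z - c \<in> span L" using \<open>t z \<in> span L\<close> c by (rule span_diff)
    ultimately show ?thesis using loc[of \<alpha> "t z - c"] \<alpha> by simp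
  next
    case False
    obtain x where x: "x \<in> L" "norm (x - z) \<le> R" using cov'[OF z] by blast
    \<comment> \<open>\<open>H\<close> is invariant under lattice translations, so subtracting
      \<open>x\<close> keeps the distance to \<open>H\<close> and lands in \<open>K\<close>.\<close>
    define w where "w = z - x"
    have wV: "w \<in> span L" unfolding w_def by (rule span_diff[OF z span_base[OF x(1)]])
    have "\<kappa> \<le> norm (w - h)" if "h \<in> H" for h
    proof -
      have "lattice_equiv L h (h + x)" by (rule lattice_equiv_translate[OF L x(1)])
      then have "h + x \<in> H" using that unfolding H_def
        using infdist_equiv lattice_equiv_span by fastforce
      then show ?thesis using False unfolding w_def
        by (metis diff_diff_add add.commute not_le order.strict_implies_order)
    qed
    then have "\<kappa> \<le> infdist w H"
      using cH by (auto simp: infdist_def dist_norm intro!: cINF_greatest)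
    then have wK: "w \<in> K"
      unfolding K_def using wV x(2) by (simp add: w_def norm_minus_commute)
    then have rR: "0 \<le> r" "r < R" and Kne: "K \<noteq> {}" using r(1) by auto
    have r2: "r\<^sup>2 < R\<^sup>2" using rR by (intro power_strict_mono) auto
    obtain v where v: "v \<in> L" "infdist w L = norm (v - w)" by (rule exists_nearest[OF L, of w])
    have "norm ((v + x) - z) \<le> r" using r(2)[OF wK] v(2) by (simp add: w_def algebra_simps)
    moreover have "v + x \<in> L" using v(1) x(1) by (rule discrete_subgroup_add[OF L])
    ultimately have "exp (- \<alpha> * r\<^sup>2) \<le> ?f \<alpha> z"
      using \<alpha> by (intro gaussian_sum_lower_bound[OF L, of _ "v + x"]) auto
    moreover have "?f \<alpha> c \<le> C * exp (- \<alpha> * R\<^sup>2)" using fc \<alpha> by simp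
    moreover have "C * exp (- \<alpha> * R\<^sup>2) \<le> exp (- \<alpha> * r\<^sup>2)"
    proof -
      have "C / (R\<^sup>2 - r\<^sup>2) \<le> \<alpha>" using \<alpha> Kne by (simp add: B_def)
      then have "C \<le> \<alpha> * (R\<^sup>2 - r\<^sup>2)" using r2 by (simp add: field_simps)
      also have "\<dots> \<le> exp (\<alpha> * (R\<^sup>2 - r\<^sup>2))"
        using exp_ge_add_one_self[of "\<alpha> * (R\<^sup>2 - r\<^sup>2)"] by linarith
      finally have "C * exp (- \<alpha> * R\<^sup>2) \<le> exp (\<alpha> * (R\<^sup>2 - r\<^sup>2)) * exp (- \<alpha> * R\<^sup>2)"
        by (intro mult_right_mono) auto
      then show ?thesis by (simp add: algebra_simps flip: exp_add)
    qed
    ultimately show ?thesis by linarith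
  qed
  show ?thesis
    unfolding stable_cold_spot_def is_arg_min_def
    by (intro exI[of _ "max (max 1 A) B"]) (use glob c'(1) eq' in \<open>auto simp: not_less\<close>)
qed

corollary deep_holes_stable_central:
  fixes L :: "'a::euclidean_space set"
  assumes L: "discrete_subgroup L" and c: "2 *\<^sub>R c \<in> L"
    and far: "\<And>x. x \<in> L \<Longrightarrow> R \<le> norm (x - c)" and near: "\<exists>x\<in>L. norm (x - c) \<le> R"
    and cov: "\<And>z. z \<in> span L \<Longrightarrow> (\<exists>x\<in>L. norm (x - z) < R) \<or> lattice_equiv L z c"
    and hole: "deep_hole L c'"
  shows "stable_cold_spot L c'"
proof (rule deep_holes_stable[OF L _ far near cov _ _ _ _ _ hole])
  have "(1 / 2) *\<^sub>R 2 *\<^sub>R c \<in> span L" by (rule span_scale[OF span_base[OF c]])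
  then show "c \<in> span L" by simp
  show "lattice_equiv L (c + u) (c + (if j = 0 then u else - u))" for j :: nat and u
    using lattice_equiv_reflect_point[OF L c, of u] by (auto simp: lattice_equiv_refl)
  show "(\<Sum>j<2::nat. if j = 0 then u else - u) = 0" for u :: 'a
    by (simp add: numeral_2_eq_2)
qed auto

lemma near_equiv:
  assumes "lattice_equiv L z w" "\<exists>x\<in>L. norm (x - w) < R"
  shows "\<exists>x\<in>L. norm (x - z) < R"
proof -
  obtain g where g: "\<And>x y. dist (g x) (g y) = dist x y" "g ` L = L" "g z = w"
    using assms(1) unfolding lattice_equiv_def by blast
  obtain x where "x \<in> L" "norm (x - w) < R" using assms(2) by blast
  then obtain y where "y \<in> L" "x = g y" using g(2) by blast
  then show ?thesis using g(1)[of y z] g(3) \<open>norm (x - w) < R\<close> by (auto simp: dist_norm)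
qed

lemma norm_vec_power2: "(norm x)\<^sup>2 = (\<Sum>i\<in>UNIV. (norm (x $ i))\<^sup>2)" for x :: "'a::real_normed_vector ^ 'n"
  by (simp add: norm_vec_def L2_set_def sum_nonneg)

lemma discrete_subgroup_scale:
  assumes L: "discrete_subgroup L" and s: "s \<noteq> 0"
  shows "discrete_subgroup ((*\<^sub>R) s ` L)"
proof -
  obtain d where d: "d > 0" "\<And>x. x \<in> L \<Longrightarrow> x \<noteq> 0 \<Longrightarrow> d \<le> norm x"
    using L unfolding discrete_subgroup_def by blast
  have "\<forall>x\<in>L. s *\<^sub>R x \<noteq> 0 \<longrightarrow> \<bar>s\<bar> * d \<le> norm (s *\<^sub>R x)"
    using d s by (auto intro: mult_left_mono)
  then have "\<exists>d>0. \<forall>x\<in>(*\<^sub>R) s ` L. x \<noteq> 0 \<longrightarrow> d \<le> norm x"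
    using d(1) s by (intro exI[of _ "\<bar>s\<bar> * d"]) auto
  moreover have "\<forall>x\<in>(*\<^sub>R) s ` L. \<forall>y\<in>(*\<^sub>R) s ` L. x - y \<in> (*\<^sub>R) s ` L"
    using L by (auto simp: discrete_subgroup_diff simp flip: scaleR_diff_right)
  moreover have "0 \<in> (*\<^sub>R) s ` L"
    using discrete_subgroup_zero[OF L] by (auto intro: image_eqI[where x = 0])
  ultimately show ?thesis unfolding discrete_subgroup_def by blast
qed

lemma lattice_equiv_scale:
  assumes "lattice_equiv L z w" and s: "s \<noteq> 0"
  shows "lattice_equiv ((*\<^sub>R) s ` L) (s *\<^sub>R z) (s *\<^sub>R w)"
proof -
  obtain g where g: "\<And>x y. dist (g x) (g y) = dist x y" "surj g" "g ` L = L"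
    "g ` span L = span L" "g z = w"
    using assms unfolding lattice_equiv_def by blast
  define h where "h = (\<lambda>x. s *\<^sub>R g (x /\<^sub>R s))"
  have d: "dist (t *\<^sub>R x) (t *\<^sub>R y) = \<bar>t\<bar> * dist x y" for t and x y :: 'a
    by (simp add: dist_norm flip: scaleR_diff_right)
  have im: "h ` ((*\<^sub>R) s ` S) = (*\<^sub>R) s ` (g ` S)" for S
    using s by (simp add: h_def image_image)
  have sp: "span ((*\<^sub>R) s ` L) = (*\<^sub>R) s ` span L"
    by (simp add: linear_span_image)
  have UN: "(*\<^sub>R) s ` UNIV = (UNIV :: 'a set)" using s by (auto intro!: surjI[of _ "\<lambda>x. x /\<^sub>R s"])
  have "dist (h x) (h y) = dist x y" for x y
    using s by (simp add: h_def d g(1) field_simps)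
  moreover have "h ` UNIV = UNIV" using im[of UNIV] g(2) by (simp add: UN)
  moreover have "h (s *\<^sub>R z) = s *\<^sub>R w" using s g(5) by (simp add: h_def)
  ultimately show ?thesis
    unfolding lattice_equiv_def sp by (intro exI[of _ h]) (simp add: im g)
qed

subsection \<open>The Barnes-Wall lattice\<close>

text \<open>The nontrivial character of the field with two elements. Parities are kept as signs,
  which turns affine functions into products and weights into character sums.\<close>

definition ch :: "2 \<Rightarrow> real" where
  "ch t = (if t = 0 then 1 else - 1)"

lemma two_cases: "t = 0 \<or> t = (1::2)"
  using exhaust_2[of t] by auto

lemma ch_add: "ch (s + t) = ch s * ch t"
  using two_cases[of s] two_cases[of t] by (auto simp: ch_def)

lemma add_self_2 [simp]: "t + t = (0::2)"
  using two_cases[of t] by auto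

lemma add_self_vec_2 [simp]: "p + p = (0::2 ^ 'n)"
  unfolding vec_eq_iff vector_add_component add_self_2 zero_index by simp

text \<open>The Walsh functions, rows of the Sylvester Hadamard matrix of order 16; up to sign they
  are the words of \<open>RM_1_4\<close>.\<close>

definition hd4 :: "2 ^ 4 \<Rightarrow> 2 ^ 4 \<Rightarrow> real" where
  "hd4 a p = ch (\<Sum>k\<in>UNIV. a $ k * p $ k)"

lemma hd4_cases: "hd4 a p = 1 \<or> hd4 a p = - 1"
  by (simp add: hd4_def ch_def)

lemma hd4_sq [simp]: "hd4 a p * hd4 a p = 1"
  using hd4_cases[of a p] by auto

lemma hd4_commute: "hd4 a p = hd4 p a"
  by (simp add: hd4_def mult.commute)

lemma hd4_add: "hd4 a (p + q) = hd4 a p * hd4 a q"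
  by (simp add: hd4_def distrib_left sum.distrib ch_add)

lemma hd4_add_left: "hd4 (a + b) p = hd4 a p * hd4 b p"
  by (metis hd4_add hd4_commute)

lemma hd4_zero [simp]: "hd4 0 p = 1" "hd4 p 0 = 1"
  by (simp_all add: hd4_def ch_def)

text \<open>If \<open>a $ k = 1\<close>, translation by \<open>axis k 1\<close> reverses the sign of
  every term.\<close>

lemma sum_hd4: "(\<Sum>p\<in>UNIV. hd4 a p) = (if a = 0 then 16 else 0)"
proof (cases "a = 0")
  case False
  then obtain k where "a $ k \<noteq> 0" by (auto simp: vec_eq_iff)
  then have k: "a $ k = 1" using two_cases by metis
  have "(\<Sum>j\<in>UNIV. a $ j * axis k 1 $ j) = (\<Sum>j\<in>UNIV. if j = k then 1 else 0)"
    by (intro sum.cong) (auto simp: axis_def k)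
  then have m: "hd4 a (axis k 1) = - 1"
    by (simp add: hd4_def ch_def)
  have "(\<Sum>p\<in>UNIV. hd4 a p) = (\<Sum>p\<in>UNIV. hd4 a (p + axis k 1))"
    by (rule sum.reindex_bij_witness[of _ "\<lambda>p. p + axis k 1" "\<lambda>p. p + axis k 1"])
      (auto simp: add.assoc)
  also have "\<dots> = - (\<Sum>p\<in>UNIV. hd4 a p)"
    by (simp add: hd4_add m sum_negf)
  finally show ?thesis using False by simp
qed (simp add: CARD_vec)

lemma sum_hd4_mult: "(\<Sum>p\<in>UNIV. hd4 a p * hd4 b p) = (if a = b then 16 else 0)"
proof -
  have "a + b = 0 \<longleftrightarrow> a = b"
    by (metis add_self_vec_2 add_right_cancel)
  then show ?thesis by (simp add: sum_hd4 flip: hd4_add_left)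
qed

text \<open>Serves twice: it yields a Walsh coefficient whose square is at least the mean, and it
  makes \<open>hadamard\<close> an isometry.\<close>

lemma hd4_parseval: "(\<Sum>a\<in>UNIV. (\<Sum>p\<in>UNIV. hd4 a p * s p)\<^sup>2) = 16 * (\<Sum>p\<in>UNIV. (s p)\<^sup>2)"
proof -
  have "(\<Sum>a\<in>UNIV. (\<Sum>p\<in>UNIV. hd4 a p * s p)\<^sup>2)
      = (\<Sum>a\<in>UNIV. \<Sum>p\<in>UNIV. \<Sum>q\<in>UNIV. s p * s q * (hd4 p a * hd4 q a))"
    by (simp add: power2_eq_square sum_product hd4_commute[of _ "_ :: 2 ^ 4"] mult_ac)
  also have "\<dots> = (\<Sum>p\<in>UNIV. \<Sum>a\<in>UNIV. \<Sum>q\<in>UNIV. s p * s q * (hd4 p a * hd4 q a))"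
    by (rule sum.swap)
  also have "\<dots> = (\<Sum>p\<in>UNIV. \<Sum>q\<in>UNIV. \<Sum>a\<in>UNIV. s p * s q * (hd4 p a * hd4 q a))"
    by (intro sum.cong refl sum.swap)
  also have "\<dots> = (\<Sum>p\<in>UNIV. \<Sum>q\<in>UNIV. s p * s q * (\<Sum>a\<in>UNIV. hd4 p a * hd4 q a))"
    by (simp add: sum_distrib_left)
  also have "\<dots> = (\<Sum>p\<in>UNIV. \<Sum>q\<in>UNIV. if p = q then 16 * (s p * s q) else 0)"
    by (intro sum.cong refl) (simp add: sum_hd4_mult)
  also have "\<dots> = 16 * (\<Sum>p\<in>UNIV. (s p)\<^sup>2)"
    by (simp add: power2_eq_square sum_distrib_left)
  finally show ?thesis .
qed

text \<open>A multiplicative form of "a function whose derivatives of order two vanish is affine".\<close>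

lemma flat_sums_imp_affine:
  fixes f :: "2 ^ 4 \<Rightarrow> real"
  assumes f: "\<And>p. f p = 1 \<or> f p = - 1"
    and flat: "\<And>p q r. f p * f (p + q) * f (p + r) * f (p + q + r) = 1"
  obtains a \<epsilon> where "\<epsilon> = 1 \<or> \<epsilon> = - 1" "\<And>p. f p = \<epsilon> * hd4 a p"
proof -
  have sq: "f p * f p = 1" for p using f[of p] by auto
  \<comment> \<open>Dividing by the value at 0 leaves a multiplicative function, which is determined
    by its values on unit vectors.\<close>
  define g where "g = (\<lambda>p. f 0 * f p)"
  have g: "g p = 1 \<or> g p = - 1" for p using f[of p] f[of 0] by (auto simp: g_def)
  have g_add: "g (q + r) = g q * g r" for q r
    using flat[of 0 q r] f[of 0] f[of q] f[of r] f[of "q + r"] by (auto simp: g_def)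
  define a :: "2 ^ 4" where "a = (\<chi> k. if g (axis k 1) = 1 then 0 else 1)"
  have ax: "g (axis k t) = ch (a $ k * t)" for k t
  proof -
    have "g 0 = 1" using sq by (simp add: g_def)
    moreover have "axis k 0 = (0 :: 2 ^ 4)" by (simp add: axis_def vec_eq_iff)
    ultimately have "g (axis k 0) = 1" by metis
    then show ?thesis using two_cases[of t] g[of "axis k 1"] by (auto simp: ch_def a_def)
  qed
  have gh: "g p = hd4 a p" for p
  proof -
    have "p = axis 1 (p $ 1) + axis 2 (p $ 2) + axis 3 (p $ 3) + axis 4 (p $ 4)"
      by (simp add: vec_eq_iff forall_4 axis_def)
    then have "g p = g (axis 1 (p $ 1)) * g (axis 2 (p $ 2)) * g (axis 3 (p $ 3)) * g (axis 4 (p $ 4))"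
      by (metis g_add)
    then show ?thesis by (simp add: hd4_def sum_4 ch_add ax)
  qed
  have "f p = f 0 * hd4 a p" for p
    using f[of 0] by (auto simp: g_def simp flip: gh)
  then show ?thesis using that f[of 0] by blast
qed

definition par :: "int \<Rightarrow> real" where
  "par n = (if even n then 1 else - 1)"

lemma par_cases: "par n = 1 \<or> par n = - 1"
  by (simp add: par_def)

lemma par_add: "par (m + n) = par m * par n"
  by (simp add: par_def)

lemma par_diff: "par (m - n) = par m * par n"
  by (simp add: par_def)

lemma of_int_2: "(of_int n :: 2) = (if even n then 0 else 1)"
proof -
  have "(of_int (2 * k) :: 2) = 0" for k by (simp only: of_int_add mult_2 add_self_2)
  then show ?thesis by (cases "even n") (auto elim!: evenE oddE)
qed

lemma ch_of_int: "ch (of_int n) = par n"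
  by (simp add: of_int_2 ch_def par_def)

lemma ch_inj: "ch s = ch t \<longleftrightarrow> s = t"
  using two_cases[of s] two_cases[of t] by (auto simp: ch_def)

text \<open>The lattice before scaling by \<open>1 / sqrt 2\<close>, with the codeword written as a
  sign times a Walsh function. At this scale the squared covering radius is 6.\<close>

definition bw :: "(real ^ (2 ^ 4)) set" where
  "bw = {x. \<exists>u a \<epsilon>. (\<epsilon> = 1 \<or> \<epsilon> = - 1) \<and> (\<forall>p. x $ p = of_int (u p)) \<and>
     (\<forall>p. par (u p) = \<epsilon> * hd4 a p) \<and> 4 dvd (\<Sum>p\<in>UNIV. u p)}"

lemma bwI:
  assumes "\<epsilon> = 1 \<or> \<epsilon> = - 1" "\<And>p. x $ p = of_int (u p)" "\<And>p. par (u p) = \<epsilon> * hd4 a p"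
    "4 dvd (\<Sum>p\<in>UNIV. u p)"
  shows "x \<in> bw"
  using assms unfolding bw_def by blast

lemma bwE:
  assumes "x \<in> bw"
  obtains u a \<epsilon> where "\<epsilon> = 1 \<or> \<epsilon> = - 1" "\<And>p. x $ p = of_int (u p)"
    "\<And>p. par (u p) = \<epsilon> * hd4 a p" "4 dvd (\<Sum>p\<in>UNIV. u p)"
  using assms unfolding bw_def by blast

lemma BW16_eq: "BW16 = (*\<^sub>R) (1 / sqrt 2) ` bw"
proof -
  have cw: "(\<chi> p. of_int (u $ p)) \<in> RM_1_4 \<longleftrightarrow>
      (\<exists>a \<epsilon>. (\<epsilon> = 1 \<or> \<epsilon> = - 1) \<and> (\<forall>p. par (u $ p) = \<epsilon> * hd4 a p))" for u :: "int ^ (2 ^ 4)"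
  proof -
    have "(\<chi> p. of_int (u $ p)) \<in> RM_1_4 \<longleftrightarrow>
        (\<exists>a b. \<forall>p. of_int (u $ p) = (\<Sum>k\<in>UNIV. a $ k * p $ k) + b)"
      by (auto simp: RM_1_4_def vec_eq_iff)
    also have "\<dots> \<longleftrightarrow> (\<exists>a b. \<forall>p. par (u $ p) = ch b * hd4 a p)"
      by (subst ch_inj[symmetric]) (simp add: ch_of_int ch_add hd4_def mult.commute)
    also have "\<dots> \<longleftrightarrow> (\<exists>a \<epsilon>. (\<epsilon> = 1 \<or> \<epsilon> = - 1) \<and> (\<forall>p. par (u $ p) = \<epsilon> * hd4 a p))"
    proof -
      have "ch 0 = 1" "ch 1 = - 1" by (simp_all add: ch_def)
      then have "(\<exists>b. P (ch b)) \<longleftrightarrow> (\<exists>\<epsilon>. (\<epsilon> = 1 \<or> \<epsilon> = - 1) \<and> P \<epsilon>)" for P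
        using two_cases by metis
      from this[of "\<lambda>\<epsilon>. \<forall>p. par (u $ p) = \<epsilon> * hd4 _ p"] show ?thesis by simp
    qed
    finally show ?thesis .
  qed
  have "bw = (\<lambda>u. (\<chi> p. real_of_int (u $ p))) `
      {u :: int ^ (2 ^ 4). (\<chi> p. of_int (u $ p)) \<in> RM_1_4 \<and> 4 dvd (\<Sum>p\<in>UNIV. u $ p)}"
  proof (intro equalityI subsetI)
    fix x assume "x \<in> bw"
    then obtain u a \<epsilon> where u: "\<epsilon> = 1 \<or> \<epsilon> = - 1" "\<And>p. x $ p = of_int (u p)"
      "\<And>p. par (u p) = \<epsilon> * hd4 a p" "4 dvd (\<Sum>p\<in>UNIV. u p)" by (rule bwE) blast
    have "x = (\<chi> p. real_of_int ((\<chi> p. u p) $ p))" by (simp add: vec_eq_iff u(2))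
    moreover have "(\<chi> p. u p) \<in> {u :: int ^ (2 ^ 4). (\<chi> p. of_int (u $ p)) \<in> RM_1_4 \<and> 4 dvd (\<Sum>p\<in>UNIV. u $ p)}"
      unfolding mem_Collect_eq cw using u by auto
    ultimately show "x \<in> (\<lambda>u. (\<chi> p. real_of_int (u $ p))) `
      {u :: int ^ (2 ^ 4). (\<chi> p. of_int (u $ p)) \<in> RM_1_4 \<and> 4 dvd (\<Sum>p\<in>UNIV. u $ p)}"
      by (rule image_eqI)
  next
    fix x assume "x \<in> (\<lambda>u. (\<chi> p. real_of_int (u $ p))) `
      {u :: int ^ (2 ^ 4). (\<chi> p. of_int (u $ p)) \<in> RM_1_4 \<and> 4 dvd (\<Sum>p\<in>UNIV. u $ p)}"
    then show "x \<in> bw" by (force simp: cw bw_def)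
  qed
  then have "(*\<^sub>R) (1 / sqrt 2) ` bw = (*\<^sub>R) (1 / sqrt 2) ` (\<lambda>u. (\<chi> p. real_of_int (u $ p))) `
      {u :: int ^ (2 ^ 4). (\<chi> p. of_int (u $ p)) \<in> RM_1_4 \<and> 4 dvd (\<Sum>p\<in>UNIV. u $ p)}"
    by (rule arg_cong)
  then show ?thesis unfolding BW16_def image_image by (rule sym)
qed

lemma discrete_subgroup_bw: "discrete_subgroup bw"
  unfolding discrete_subgroup_def
proof (intro conjI ballI exI[of _ "1::real"] impI)
  show "0 \<in> bw" by (rule bwI[where \<epsilon> = 1 and u = "\<lambda>_. 0" and a = 0]) (auto simp: par_def)
  fix x y assume "x \<in> bw"
  then obtain u a \<epsilon> where u: "\<epsilon> = 1 \<or> \<epsilon> = - 1" "\<And>p. x $ p = of_int (u p)"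
    "\<And>p. par (u p) = \<epsilon> * hd4 a p" "4 dvd (\<Sum>p\<in>UNIV. u p)" by (rule bwE) blast
  show "x - y \<in> bw" if y: "y \<in> bw"
  proof -
    obtain v b \<delta> where v: "\<delta> = 1 \<or> \<delta> = - 1" "\<And>p. y $ p = of_int (v p)"
      "\<And>p. par (v p) = \<delta> * hd4 b p" "4 dvd (\<Sum>p\<in>UNIV. v p)" using y by (rule bwE) blast
    show ?thesis
      by (rule bwI[where \<epsilon> = "\<epsilon> * \<delta>" and u = "\<lambda>p. u p - v p" and a = "a + b"])
        (use u v in \<open>auto simp: par_diff hd4_add_left sum_subtractf\<close>)
  qed
  assume "x \<noteq> 0"
  then obtain p where "x $ p \<noteq> 0" by (auto simp: vec_eq_iff)
  then have "1 \<le> \<bar>x $ p\<bar>" using u(2)[of p] by simp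
  also have "\<dots> \<le> norm x" by (rule component_le_norm_cart)
  finally show "1 \<le> norm x" .
qed simp

section \<open>Covering bound for the Barnes-Wall lattice\<close>

text \<open>The character sum leaves only the weights 0, 8 and 16.\<close>

lemma card_odd_codeword:
  assumes "\<epsilon> = 1 \<or> \<epsilon> = - 1"
  shows "4 dvd card {p. \<epsilon> * hd4 a p = - 1}"
proof -
  have "real (card {p. \<epsilon> * hd4 a p = - 1}) = (\<Sum>p\<in>UNIV. if \<epsilon> * hd4 a p = - 1 then 1 else 0)"
    by (simp add: sum.If_cases)
  also have "\<dots> = (\<Sum>p\<in>UNIV. (1 - \<epsilon> * hd4 a p) / 2)"
    by (intro sum.cong refl) (use assms hd4_cases[of a] in \<open>auto simp: field_simps\<close>; smt (verit) hd4_cases)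
  also have "\<dots> = (16 - \<epsilon> * (if a = 0 then 16 else 0)) / 2"
    by (simp add: sum_subtractf CARD_vec sum_hd4 flip: sum_divide_distrib sum_distrib_left)
  finally have "card {p. \<epsilon> * hd4 a p = - 1} \<in> {0, 8, 16}"
    using assms by (auto split: if_splits)
  then show ?thesis by auto
qed

lemma odd_iff_par: "odd n \<longleftrightarrow> par n = - 1"
  by (simp add: par_def)

text \<open>Once the parities form a codeword, the condition modulo 4 can fail only by 2, and moving
  a single coordinate by 2 repairs it.\<close>

lemma codeword_sum_even:
  assumes "\<epsilon> = 1 \<or> \<epsilon> = - 1" "\<And>p. par (u p) = \<epsilon> * hd4 a p"
  shows "even (\<Sum>p\<in>UNIV. u p)"
proof -
  have "4 dvd card {p. odd (u p)}"
    using card_odd_codeword[OF assms(1), of a] by (simp add: odd_iff_par assms(2))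
  then have "even (card {p. odd (u p)})" by (rule dvd_trans[rotated]) simp
  then show ?thesis by (simp add: even_sum_iff)
qed

text \<open>Coordinate \<open>z\<close> lies in the interval between an even \<open>e\<close> and an odd \<open>d\<close>;
  \<open>s\<close> is 1 at the even end and \<open>- 1\<close> at the odd end.\<close>

lemma even_odd_interval:
  obtains e d :: int and s :: real where "even e" "odd d" "\<bar>d - e\<bar> = 1" "- 1 \<le> s" "s \<le> 1"
    "z = (real_of_int e + real_of_int d) / 2 + s * (real_of_int e - real_of_int d) / 2"
proof (cases "even \<lfloor>z\<rfloor>")
  case True
  show ?thesis
  proof (rule that[of "\<lfloor>z\<rfloor>" "\<lfloor>z\<rfloor> + 1" "1 - 2 * (z - \<lfloor>z\<rfloor>)"])
    show "z = (real_of_int \<lfloor>z\<rfloor> + real_of_int (\<lfloor>z\<rfloor> + 1)) / 2 +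
        (1 - 2 * (z - \<lfloor>z\<rfloor>)) * (real_of_int \<lfloor>z\<rfloor> - real_of_int (\<lfloor>z\<rfloor> + 1)) / 2"
      by (simp add: field_simps)
  qed ((use True in \<open>simp; fail\<close>) | (use of_int_floor_le[of z] real_of_int_floor_add_one_gt[of z] in \<open>unfold right_diff_distrib, linarith\<close>))+
next
  case False
  show ?thesis
  proof (rule that[of "\<lfloor>z\<rfloor> + 1" "\<lfloor>z\<rfloor>" "2 * (z - \<lfloor>z\<rfloor>) - 1"])
    show "z = (real_of_int (\<lfloor>z\<rfloor> + 1) + real_of_int \<lfloor>z\<rfloor>) / 2 +
        (2 * (z - \<lfloor>z\<rfloor>) - 1) * (real_of_int (\<lfloor>z\<rfloor> + 1) - real_of_int \<lfloor>z\<rfloor>) / 2"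
      by (simp add: field_simps)
  qed ((use False in \<open>simp; fail\<close>) | (use of_int_floor_le[of z] real_of_int_floor_add_one_gt[of z] in \<open>unfold right_diff_distrib, linarith\<close>))+
qed

text \<open>Each coordinate is rounded to the end of its interval whose parity the codeword
  prescribes. If the sum is then 2 modulo 4, coordinate \<open>i\<close> jumps across
  \<open>z $ i\<close> to the next integer of the same parity: (1 - t)^2 / 4 becomes (3 + t)^2 / 4,
  an increase of 2 (1 + t).\<close>

lemma bw_option:
  fixes z :: "real ^ (2 ^ 4)"
  assumes e: "\<And>p. even (e p)" and d: "\<And>p. odd (d p)" and ed: "\<And>p. \<bar>d p - e p\<bar> = 1"
    and z: "\<And>p. z $ p = (real_of_int (e p) + real_of_int (d p)) / 2 + s p * (real_of_int (e p) - real_of_int (d p)) / 2"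
    and s: "- 1 \<le> s i" "s i \<le> 1"
    and \<epsilon>: "\<epsilon> = 1 \<or> \<epsilon> = - 1"
  shows "\<exists>x\<in>bw. (norm (x - z))\<^sup>2 \<le> (\<Sum>p\<in>UNIV. (1 - \<epsilon> * hd4 a p * s p)\<^sup>2 / 4) + 2 * (1 + \<epsilon> * hd4 a i * s i)"
proof -
  define t where "t = (\<lambda>p. \<epsilon> * hd4 a p * s p)"
  have \<epsilon>h: "\<epsilon> * hd4 a p = 1 \<or> \<epsilon> * hd4 a p = - 1" for p
    using \<epsilon> hd4_cases[of a p] by auto
  define u where "u = (\<lambda>p. if \<epsilon> * hd4 a p = 1 then e p else d p)"
  have par: "par (u p) = \<epsilon> * hd4 a p" for p
    using \<epsilon>h[of p] e[of p] d[of p] by (auto simp: u_def par_def)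
  \<comment> \<open>\<open>\<delta> p\<close> points from the chosen end of the interval to the
    other one.\<close>
  define \<delta> :: "2 ^ 4 \<Rightarrow> int" where "\<delta> = (\<lambda>p. if \<epsilon> * hd4 a p = 1 then d p - e p else e p - d p)"
  have \<delta>: "\<delta> p = 1 \<or> \<delta> p = - 1" for p using ed[of p] by (auto simp: \<delta>_def)
  have zu: "z $ p - u p = \<delta> p * (1 - t p) / 2" for p
    using \<epsilon>h[of p]
  proof
    assume *: "\<epsilon> * hd4 a p = 1"
    then have "t p = s p" by (simp add: t_def)
    then show ?thesis using * by (simp add: z u_def \<delta>_def field_simps)
  next
    assume *: "\<epsilon> * hd4 a p = - 1"
    then have "t p = - s p" by (simp add: t_def)
    then show ?thesis using * by (simp add: z u_def \<delta>_def field_simps)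
  qed
  have "even (\<Sum>p\<in>UNIV. u p)" by (rule codeword_sum_even[OF \<epsilon> par])
  define v where "v = (\<lambda>p. if 4 dvd (\<Sum>p\<in>UNIV. u p) then u p else u p + (if p = i then 2 * \<delta> i else 0))"
  have sv: "4 dvd (\<Sum>p\<in>UNIV. v p)"
  proof (cases "4 dvd (\<Sum>p\<in>UNIV. u p)")
    case False
    then have "(\<Sum>p\<in>UNIV. v p) = (\<Sum>p\<in>UNIV. u p) + 2 * \<delta> i"
      by (simp add: v_def sum.distrib)
    moreover have "4 dvd A + 2 * D" if "even A" "\<not> 4 dvd A" "D = 1 \<or> D = - 1" for A D :: int
      using that by presburger
    ultimately show ?thesis using \<open>even (\<Sum>p\<in>UNIV. u p)\<close> False \<delta>[of i] by metis
  qed (simp add: v_def)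
  have pv: "par (v p) = \<epsilon> * hd4 a p" for p
    by (simp add: v_def par par_add) (simp add: par_def)
  define x :: "real ^ (2 ^ 4)" where "x = (\<chi> p. v p)"
  have "x \<in> bw" by (rule bwI[OF \<epsilon> _ pv sv]) (simp add: x_def)
  have ti: "- 1 \<le> t i" "t i \<le> 1" using \<epsilon>h[of i] s by (auto simp: t_def)
  have le: "(norm ((x - z) $ p))\<^sup>2 \<le> (1 - t p)\<^sup>2 / 4 + (if p = i then 2 * (1 + t i) else 0)" for p
  proof -
    have sq: "(real_of_int (\<delta> p))\<^sup>2 = 1" using \<delta>[of p] by auto
    have 1: "(z $ p - u p)\<^sup>2 = (1 - t p)\<^sup>2 / 4"
      by (simp add: zu power_mult_distrib power_divide sq)
    have "z $ p - (u p + 2 * \<delta> p) = \<delta> p * (- 3 - t p) / 2"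
      using zu[of p] by (simp add: field_simps)
    then have "(z $ p - (u p + 2 * \<delta> p))\<^sup>2 = (- 3 - t p)\<^sup>2 / 4"
      by (simp only: power_mult_distrib power_divide sq) simp
    also have "\<dots> = (1 - t p)\<^sup>2 / 4 + 2 * (1 + t p)"
      by (simp add: power2_eq_square field_simps)
    finally have 2: "(z $ p - (u p + 2 * \<delta> p))\<^sup>2 = (1 - t p)\<^sup>2 / 4 + 2 * (1 + t p)" .
    have "(norm ((x - z) $ p))\<^sup>2 = (z $ p - v p)\<^sup>2" by (simp add: x_def power2_commute)
    then show ?thesis using 1 2 ti by (auto simp: v_def)
  qed
  have "(norm (x - z))\<^sup>2 \<le> (\<Sum>p\<in>UNIV. (1 - t p)\<^sup>2 / 4 + (if p = i then 2 * (1 + t i) else 0))"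
    unfolding norm_vec_power2 by (intro sum_mono le)
  also have "\<dots> = (\<Sum>p\<in>UNIV. (1 - t p)\<^sup>2 / 4) + 2 * (1 + t i)"
    by (simp add: sum.distrib)
  finally show ?thesis using \<open>x \<in> bw\<close> by (auto simp: t_def)
qed

text \<open>\<open>H\<close>, \<open>P\<close>, \<open>m\<close> stand for half a Walsh coefficient,
  a quarter of the sum of squares, and the least signed coordinate; \<open>H - P - 2 * m\<close> is
  what the rounding saves against 6. Of the two upper bounds on \<open>P\<close>, the quadratic one
  is strong for small \<open>H\<close>, the linear one for large \<open>H\<close>.\<close>

lemma bw_scalar:
  fixes H P m :: real
  assumes H: "0 \<le> H" "P \<le> H\<^sup>2" and m: "- 1 \<le> m" "m \<le> 1" and P: "0 \<le> P" "2 * P \<le> (1 + m) * H - 8 * m"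
  shows "0 < H - P - 2 * m \<or> (H - P - 2 * m = 0 \<and> (P = 0 \<or> P = 4))"
proof (cases "m \<ge> 0")
  case True
  have U0: "0 \<le> (1 - m) * H" using m H by simp
  have "(1 - m) * H + 4 * m \<le> 2 * (H - P - 2 * m)"
    using P(2) by (simp add: distrib_right left_diff_distrib)
  moreover have "0 < (1 - m) * H + 4 * m \<or> m = 0 \<and> H = 0"
  proof (cases "m = 0")
    case False
    then show ?thesis using U0 True by linarith
  qed (use H in auto)
  ultimately show ?thesis using H(2) P(1) by auto
next
  case False
  define \<mu> where "\<mu> = - m"
  have \<mu>: "0 < \<mu>" "\<mu> \<le> 1" using False m by (auto simp: \<mu>_def)
  have P2: "2 * P \<le> H - \<mu> * H + 8 * \<mu>" using P(2) by (simp add: \<mu>_def distrib_right)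
  have key: "2 * \<mu> * ((1 - \<mu>) * (3 - \<mu>)) = 4 * \<mu> * (1 - 3 * \<mu>) + 2 * \<mu> * (1 + \<mu>)\<^sup>2"
    by algebra
  have goal: "H - P - 2 * m = H - P + 2 * \<mu>" by (simp add: \<mu>_def)
  \<comment> \<open>At \<open>H * (1 + \<mu>) = 4 * \<mu>\<close> the linear bound on
    \<open>P\<close> guarantees exactly a saving of 0; below this threshold the quadratic bound
    takes over.\<close>
  consider "H + \<mu> * H > 4 * \<mu>" | "H * (1 + \<mu>) = 4 * \<mu>" | "H * (1 + \<mu>) < 4 * \<mu>"
    using linorder_less_linear[of "H * (1 + \<mu>)" "4 * \<mu>"] by (simp add: distrib_left mult.commute) blast
  then show ?thesis
  proof cases
    case 1
    then show ?thesis using P2 unfolding goal by linarith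
  next
    case 2
    show ?thesis
    proof (cases "\<mu> = 1")
      case True
      then have "H = 2" using 2 by simp
      then show ?thesis using True H P2 unfolding goal by auto
    next
      case False
      have "(1 + \<mu>)\<^sup>2 * (H - H\<^sup>2 + 2 * \<mu>) = 2 * \<mu> * ((1 - \<mu>) * (3 - \<mu>))"
        using 2 by algebra
      also have "\<dots> > 0" using \<mu> False by simp
      finally have "H - H\<^sup>2 + 2 * \<mu> > 0" by (rule zero_less_mult_pos) (use \<mu> in simp)
      then show ?thesis using H(2) unfolding goal by linarith
    qed
  next
    case 3
    have "H * (H * (1 + \<mu>)) \<le> H * (4 * \<mu>)" using 3 H by (intro mult_left_mono) auto
    moreover have "(1 + \<mu>) * (H - H\<^sup>2 + 2 * \<mu>) = H * (1 + \<mu>) - H * (H * (1 + \<mu>)) + 2 * \<mu> * (1 + \<mu>)"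
      by algebra
    moreover have "H * (1 + \<mu>) - H * (4 * \<mu>) = H * (1 - 3 * \<mu>)" by algebra
    ultimately have 4: "(1 + \<mu>) * (H - H\<^sup>2 + 2 * \<mu>) \<ge> H * (1 - 3 * \<mu>) + 2 * \<mu> * (1 + \<mu>)" by linarith
    have "H * (1 - 3 * \<mu>) + 2 * \<mu> * (1 + \<mu>) > 0"
    proof (cases "1 - 3 * \<mu> \<ge> 0")
      case True
      then show ?thesis using H \<mu> by (intro add_nonneg_pos) auto
    next
      case False
      have "(H * (1 + \<mu>)) * (3 * \<mu> - 1) < (4 * \<mu>) * (3 * \<mu> - 1)"
        using 3 False by (intro mult_strict_right_mono) auto
      moreover have "0 \<le> 2 * \<mu> * ((1 - \<mu>) * (3 - \<mu>))" using \<mu> by simp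
      moreover have "(1 + \<mu>) * (H * (1 - 3 * \<mu>) + 2 * \<mu> * (1 + \<mu>))
          = (4 * \<mu>) * (3 * \<mu> - 1) - (H * (1 + \<mu>)) * (3 * \<mu> - 1) + 2 * \<mu> * ((1 - \<mu>) * (3 - \<mu>))"
        by algebra
      ultimately have "0 < (1 + \<mu>) * (H * (1 - 3 * \<mu>) + 2 * \<mu> * (1 + \<mu>))" by linarith
      then show ?thesis by (rule zero_less_mult_pos) (use \<mu> in simp)
    qed
    then have "(1 + \<mu>) * (H - H\<^sup>2 + 2 * \<mu>) > 0" using 4 by linarith
    then have "H - H\<^sup>2 + 2 * \<mu> > 0" by (rule zero_less_mult_pos) (use \<mu> in simp)
    then show ?thesis using H(2) unfolding goal by linarith
  qed
qed

text \<open>The codeword is chosen so that its correlation with the position \<open>s\<close> of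
  \<open>z\<close> in its intervals is at least the square root of \<open>Q\<close>, and the
  coordinate to repair is the one where this choice fits worst. Equality in \<open>bw_scalar\<close>
  puts all coordinates at midpoints (\<open>Q = 0\<close>) or all at integers
  (\<open>Q = 16\<close>).\<close>

lemma bw_cover:
  fixes z :: "real ^ (2 ^ 4)"
  shows "(\<exists>x\<in>bw. (norm (x - z))\<^sup>2 < 6) \<or>
    (\<exists>x\<in>bw. (norm (x - z))\<^sup>2 \<le> 6) \<and> ((\<forall>p. z $ p \<in> \<int>) \<or> (\<forall>p. z $ p - 1 / 2 \<in> \<int>))"
proof -
  have "\<exists>e d s. even e \<and> odd d \<and> \<bar>d - e\<bar> = 1 \<and> - 1 \<le> s \<and> s \<le> 1 \<and>
      z $ p = (real_of_int e + real_of_int d) / 2 + s * (real_of_int e - real_of_int d) / 2" for p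
    using even_odd_interval[of "z $ p"] by metis
  then obtain e d :: "2 ^ 4 \<Rightarrow> int" and s :: "2 ^ 4 \<Rightarrow> real" where
    ed: "\<And>p. even (e p)" "\<And>p. odd (d p)" "\<And>p. \<bar>d p - e p\<bar> = 1" and s: "\<And>p. - 1 \<le> s p" "\<And>p. s p \<le> 1"
    and z: "\<And>p. z $ p = (real_of_int (e p) + real_of_int (d p)) / 2 + s p * (real_of_int (e p) - real_of_int (d p)) / 2"
    by metis
  define Q where "Q = (\<Sum>p\<in>UNIV. (s p)\<^sup>2)"
  have Q0: "Q \<ge> 0" by (simp add: Q_def sum_nonneg)
  \<comment> \<open>By Parseval the squares of the 16 Walsh coefficients have mean
    \<open>Q\<close>.\<close>
  have "\<exists>a. Q \<le> (\<Sum>p\<in>UNIV. hd4 a p * s p)\<^sup>2"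
  proof (rule ccontr)
    assume "\<not> ?thesis"
    then have "(\<Sum>a\<in>UNIV. (\<Sum>p\<in>UNIV. hd4 a p * s p)\<^sup>2) < (\<Sum>a\<in>(UNIV :: (2 ^ 4) set). Q)"
      by (intro sum_strict_mono) (auto simp: not_le)
    then show False by (simp add: hd4_parseval Q_def CARD_vec)
  qed
  then obtain a where a: "Q \<le> (\<Sum>p\<in>UNIV. hd4 a p * s p)\<^sup>2" by blast
  define \<epsilon> :: real where "\<epsilon> = (if (\<Sum>p\<in>UNIV. hd4 a p * s p) \<ge> 0 then 1 else - 1)"
  have \<epsilon>: "\<epsilon> = 1 \<or> \<epsilon> = - 1" by (simp add: \<epsilon>_def)
  define t where "t = (\<lambda>p. \<epsilon> * hd4 a p * s p)"
  define T where "T = (\<Sum>p\<in>UNIV. t p)"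
  have T': "T = \<epsilon> * (\<Sum>p\<in>UNIV. hd4 a p * s p)" by (simp add: T_def t_def sum_distrib_left mult.assoc)
  have T: "0 \<le> T" "Q \<le> T\<^sup>2" using a by (auto simp: T' \<epsilon>_def power_mult_distrib)
  have \<epsilon>h: "\<epsilon> * hd4 a p = 1 \<or> \<epsilon> * hd4 a p = - 1" for p
    using \<epsilon> hd4_cases[of a p] by auto
  have tsq: "(t p)\<^sup>2 = (s p)\<^sup>2" for p
  proof -
    have "(\<epsilon> * hd4 a p)\<^sup>2 = 1" using \<epsilon>h[of p] by (metis power2_eq_1_iff)
    then show ?thesis unfolding t_def power_mult_distrib[of "\<epsilon> * hd4 a p"] by simp
  qed
  have t1: "- 1 \<le> t p" "t p \<le> 1" for p
    using \<epsilon>h[of p] s[of p] by (auto simp: t_def)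
  obtain i where i: "\<And>p. t i \<le> t p"
    using ex_is_arg_min_if_finite[of UNIV t] by (auto simp: is_arg_min_def not_less)
  have Q2: "Q \<le> (1 + t i) * T - 16 * t i"
  proof -
    have "Q = (\<Sum>p\<in>UNIV. (t p)\<^sup>2)" by (simp add: Q_def tsq)
    also have "\<dots> \<le> (\<Sum>p\<in>UNIV. (1 + t i) * t p - t i)"
    proof (intro sum_mono)
      fix p
      \<comment> \<open>The square function lies below its chord over the interval from
        \<open>t i\<close> to 1.\<close>
      have "0 \<le> (t p - t i) * (1 - t p)" using i[of p] t1[of p] by simp
      then show "(t p)\<^sup>2 \<le> (1 + t i) * t p - t i" by (simp add: power2_eq_square algebra_simps)
    qed
    also have "\<dots> = (1 + t i) * T - 16 * t i"
      by (simp add: sum_subtractf T_def CARD_vec flip: sum_distrib_left)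
    finally show ?thesis .
  qed
  have "\<exists>x\<in>bw. (norm (x - z))\<^sup>2 \<le> (\<Sum>p\<in>UNIV. (1 - t p)\<^sup>2 / 4) + 2 * (1 + t i)"
    using bw_option[where z = z, OF ed z s \<epsilon>, of a i] by (simp add: t_def)
  then obtain x where x: "x \<in> bw" "(norm (x - z))\<^sup>2 \<le> (\<Sum>p\<in>UNIV. (1 - t p)\<^sup>2 / 4) + 2 * (1 + t i)"
    by blast
  have "(\<Sum>p\<in>UNIV. (1 - t p)\<^sup>2 / 4) = (\<Sum>p\<in>UNIV. 1 / 4 - t p / 2 + (t p)\<^sup>2 / 4)"
    by (intro sum.cong refl) (simp add: power2_eq_square field_simps)
  also have "\<dots> = 4 - T / 2 + Q / 4"
    by (simp add: sum.distrib sum_subtractf T_def Q_def tsq CARD_vec flip: sum_divide_distrib)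
  finally have xD: "(norm (x - z))\<^sup>2 \<le> 6 - (T / 2 - Q / 4 - 2 * t i)" using x(2) by simp
  have "0 < T / 2 - Q / 4 - 2 * t i \<or> (T / 2 - Q / 4 - 2 * t i = 0 \<and> (Q / 4 = 0 \<or> Q / 4 = 4))"
    by (rule bw_scalar) (use T t1[of i] Q0 Q2 in \<open>auto simp: power_divide\<close>)
  then have "0 < T / 2 - Q / 4 - 2 * t i \<or> (T / 2 - Q / 4 - 2 * t i = 0 \<and> (Q = 0 \<or> Q = 16))"
    by simp
  then show ?thesis
  proof
    assume "0 < T / 2 - Q / 4 - 2 * t i"
    then show ?thesis using x(1) xD by (intro disjI1 bexI[of _ x]) linarith+
  next
    assume *: "T / 2 - Q / 4 - 2 * t i = 0 \<and> (Q = 0 \<or> Q = 16)"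
    then have near: "\<exists>x\<in>bw. (norm (x - z))\<^sup>2 \<le> 6" using x(1) xD by (intro bexI[of _ x]) auto
    from * consider "Q = 0" | "Q = 16" by blast
    then show ?thesis
    proof cases
      case 1
      then have s0: "s p = 0" for p by (simp add: Q_def sum_nonneg_eq_0_iff)
      have "z $ p - 1 / 2 \<in> \<int>" for p
      proof -
        obtain k where k: "e p + d p = 2 * k + 1" using ed(1,2) by (metis odd_add oddE)
        have "real_of_int (e p) + real_of_int (d p) = 2 * real_of_int k + 1"
          using arg_cong[OF k, of real_of_int] by simp
        then have "z $ p - 1 / 2 = of_int k" by (simp add: z s0 add_divide_distrib)
        then show ?thesis by simp
      qed
      then show ?thesis using near by blast
    next
      case 2
      have "(\<Sum>p\<in>UNIV. 1 - (s p)\<^sup>2) = 0" using 2 by (simp add: sum_subtractf Q_def CARD_vec)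
      moreover have "1 - (s p)\<^sup>2 \<ge> 0" for p
        using s[of p] by (simp add: abs_square_le_1 abs_le_iff)
      ultimately have "(s p)\<^sup>2 = 1" for p by (simp add: sum_nonneg_eq_0_iff)
      then have s1: "s p = 1 \<or> s p = - 1" for p using power2_eq_1_iff by blast
      have "z $ p \<in> \<int>" for p using s1[of p] by (auto simp: z field_simps)
      then show ?thesis using near by blast
    qed
  qed
qed

section \<open>Holes of the Barnes-Wall lattice up to symmetry\<close>

lemma norm_lt_sqrt: "norm v < sqrt r \<longleftrightarrow> (norm v)\<^sup>2 < r"
  by (metis norm_ge_zero real_less_rsqrt real_sqrt_abs2 abs_norm_cancel power2_eq_square
      real_sqrt_less_iff)

lemma norm_le_sqrt: "norm v \<le> sqrt r \<longleftrightarrow> (norm v)\<^sup>2 \<le> r"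
  by (metis abs_norm_cancel power2_eq_square real_sqrt_abs2 real_sqrt_le_iff)

lemma sqrt_le_norm: "sqrt r \<le> norm v \<longleftrightarrow> r \<le> (norm v)\<^sup>2"
  by (metis norm_lt_sqrt not_le)

lemma par_minus: "par (- n) = par n"
  by (simp add: par_def)

text \<open>Around the point with all coordinates 1/2 every codeword with entries 0 and 1 is a
  lattice point at squared distance 4. Moving one coordinate by 2 spoils the condition modulo 4 for
  all these roundings at once.\<close>

definition bw_hole :: "real ^ (2 ^ 4)" where
  "bw_hole = (\<chi> p. 1 / 2 + (if p = 0 then 2 else 0))"

definition flip_signs :: "(2 ^ 4) set \<Rightarrow> real ^ (2 ^ 4) \<Rightarrow> real ^ (2 ^ 4)" where
  "flip_signs F x = (\<chi> p. if p \<in> F then - x $ p else x $ p)"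

text \<open>The sign change alters the coordinate sum by twice the sum over \<open>F\<close>, so
  \<open>F\<close> has to meet every codeword evenly: it is a word of the dual code RM(2,4).\<close>

lemma lattice_equiv_flip_signs:
  assumes F: "\<And>a \<epsilon>. \<epsilon> = 1 \<or> \<epsilon> = - 1 \<Longrightarrow> even (card {p \<in> F. \<epsilon> * hd4 a p = - 1})"
  shows "lattice_equiv bw z (flip_signs F z)"
proof (rule lattice_equiv_involution)
  show "linear (flip_signs F)"
    by (rule linearI) (auto simp: flip_signs_def vec_eq_iff)
  show "norm (flip_signs F x) = norm x" for x
    by (auto simp: flip_signs_def norm_vec_def intro!: arg_cong[where f = "\<lambda>f. L2_set f UNIV"])
  show "flip_signs F (flip_signs F x) = x" for x
    by (auto simp: flip_signs_def vec_eq_iff)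
  fix x assume "x \<in> bw"
  then obtain u a \<epsilon> where u: "\<epsilon> = 1 \<or> \<epsilon> = - 1" "\<And>p. x $ p = of_int (u p)"
    "\<And>p. par (u p) = \<epsilon> * hd4 a p" "4 dvd (\<Sum>p\<in>UNIV. u p)" by (rule bwE) blast
  have "even (\<Sum>p\<in>F. u p)"
    using F[OF u(1), of a] by (simp add: even_sum_iff odd_iff_par u(3))
  moreover have "(\<Sum>p\<in>UNIV. if p \<in> F then - u p else u p) = (\<Sum>p\<in>UNIV. u p - 2 * (if p \<in> F then u p else 0))"
    by (intro sum.cong) auto
  then have "(\<Sum>p\<in>UNIV. if p \<in> F then - u p else u p) = (\<Sum>p\<in>UNIV. u p) - 2 * (\<Sum>p\<in>F. u p)"
    by (simp add: sum_subtractf sum.If_cases flip: sum_distrib_left)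
  ultimately have "4 dvd (\<Sum>p\<in>UNIV. if p \<in> F then - u p else u p)"
    using u(4) by (auto elim!: evenE)
  then show "flip_signs F x \<in> bw"
    using u by (intro bwI[of \<epsilon> _ "\<lambda>p. if p \<in> F then - u p else u p" a])
      (auto simp: flip_signs_def par_minus)
qed

definition hadamard :: "real ^ (2 ^ 4) \<Rightarrow> real ^ (2 ^ 4)" where
  "hadamard x = (\<chi> j. (\<Sum>p\<in>UNIV. hd4 j p * x $ p) / 4)"

lemma hadamard_involution: "hadamard (hadamard x) = x"
proof -
  have "(\<Sum>j\<in>UNIV. hd4 q j * ((\<Sum>p\<in>UNIV. hd4 j p * x $ p) / 4)) / 4 = x $ q" for q
  proof -
    have "(\<Sum>j\<in>UNIV. hd4 q j * ((\<Sum>p\<in>UNIV. hd4 j p * x $ p) / 4)) / 4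
        = (\<Sum>j\<in>UNIV. \<Sum>p\<in>UNIV. x $ p * (hd4 q j * hd4 p j)) / 16"
      by (simp add: sum_distrib_left sum_divide_distrib hd4_commute[of _ "_ :: 2 ^ 4"] mult_ac)
    also have "(\<Sum>j\<in>UNIV. \<Sum>p\<in>UNIV. x $ p * (hd4 q j * hd4 p j)) = (\<Sum>p\<in>UNIV. x $ p * (\<Sum>j\<in>UNIV. hd4 q j * hd4 p j))"
      by (subst sum.swap) (simp add: sum_distrib_left)
    also have "\<dots> = 16 * x $ q" by (simp add: sum_hd4_mult if_distrib cong: if_cong)
    finally show ?thesis by simp
  qed
  then show ?thesis by (simp add: hadamard_def vec_eq_iff)
qed

lemma norm_hadamard: "norm (hadamard x) = norm x"
proof -
  have "(norm (hadamard x))\<^sup>2 = (norm x)\<^sup>2"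
    by (simp add: norm_vec_power2 hadamard_def power_divide hd4_parseval flip: sum_divide_distrib)
  then show ?thesis by (simp add: power2_eq_iff_nonneg)
qed

text \<open>The annihilator of \<open>q\<close> and \<open>r\<close> has dimension at least 2, and a
  codeword is constant or balanced on it. The count expands the indicator function into characters,
  each with sum 0 or 16.\<close>

lemma card_codeword_annihilator:
  assumes "\<epsilon> = 1 \<or> \<epsilon> = - 1"
  shows "even (card {p \<in> {p. hd4 q p = 1 \<and> hd4 r p = 1}. \<epsilon> * hd4 a p = - 1})"
proof -
  obtain e :: int where e: "\<epsilon> = of_int e" using assms by (metis of_int_1 of_int_minus)
  define b :: "2 ^ 4 \<Rightarrow> int" where "b = (\<lambda>c. if c = 0 then 1 else 0)"
  have b0: "b 0 = 1" by (simp add: b_def)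
  have S: "(\<Sum>p\<in>UNIV. hd4 c p) = 16 * of_int (b c)" for c by (simp add: sum_hd4 b_def)
  have "real (card {p \<in> {p. hd4 q p = 1 \<and> hd4 r p = 1}. \<epsilon> * hd4 a p = - 1})
      = (\<Sum>p\<in>UNIV. if hd4 q p = 1 \<and> hd4 r p = 1 \<and> \<epsilon> * hd4 a p = - 1 then 1 else 0)"
    by (simp add: sum.If_cases conj_assoc)
  also have "\<dots> = (\<Sum>p\<in>UNIV. (1 + hd4 q p) * (1 + hd4 r p) * (1 - \<epsilon> * hd4 a p) / 8)"
  proof (intro sum.cong refl)
    show "(if hd4 q p = 1 \<and> hd4 r p = 1 \<and> \<epsilon> * hd4 a p = - 1 then 1 else 0)
        = (1 + hd4 q p) * (1 + hd4 r p) * (1 - \<epsilon> * hd4 a p) / 8" for p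
      using assms hd4_cases[of a p] hd4_cases[of q p] hd4_cases[of r p] by auto
  qed
  also have "\<dots> = (\<Sum>p\<in>UNIV. (hd4 0 p + hd4 q p + hd4 r p + hd4 (q + r) p)
      - \<epsilon> * (hd4 a p + hd4 (a + q) p + hd4 (a + r) p + hd4 (a + q + r) p)) / 8"
    unfolding sum_divide_distrib
    by (intro sum.cong refl) (simp add: hd4_add_left algebra_simps)
  also have "\<dots> = of_int (2 * ((b 0 + b q + b r + b (q + r)) - e * (b a + b (a + q) + b (a + r) + b (a + q + r))))"
    by (simp add: sum_subtractf sum.distrib S e b0 distrib_left flip: sum_distrib_left)
  finally have "real_of_int (int (card {p \<in> {p. hd4 q p = 1 \<and> hd4 r p = 1}. \<epsilon> * hd4 a p = - 1}))
    = of_int (2 * ((b 0 + b q + b r + b (q + r)) - e * (b a + b (a + q) + b (a + r) + b (a + q + r))))"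
    by simp
  then have "int (card {p \<in> {p. hd4 q p = 1 \<and> hd4 r p = 1}. \<epsilon> * hd4 a p = - 1})
    = 2 * ((b 0 + b q + b r + b (q + r)) - e * (b a + b (a + q) + b (a + r) + b (a + q + r)))"
    by (simp only: of_int_eq_iff)
  then have "even (int (card {p \<in> {p. hd4 q p = 1 \<and> hd4 r p = 1}. \<epsilon> * hd4 a p = - 1}))"
    by (metis dvd_triv_left)
  then show ?thesis by simp
qed

text \<open>Integrality of the image and its parity pattern both follow from the evenness of
  coordinate sums over annihilators. The sum of the image is 4 times the coordinate at 0, hence
  divisible by 4.\<close>

lemma hadamard_bw:
  assumes "x \<in> bw"
  shows "hadamard x \<in> bw"
proof -
  obtain u a \<epsilon> where u: "\<epsilon> = 1 \<or> \<epsilon> = - 1" "\<And>p. x $ p = of_int (u p)"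
    "\<And>p. par (u p) = \<epsilon> * hd4 a p" "4 dvd (\<Sum>p\<in>UNIV. u p)" using assms by (rule bwE) blast
  have even_ann: "even (\<Sum>p\<in>{p. hd4 q p = 1 \<and> hd4 r p = 1}. u p)" for q r
    using card_codeword_annihilator[OF u(1), of q r a]
    by (simp add: even_sum_iff odd_iff_par u(3))
  define w where "w = (\<lambda>j. (\<Sum>p\<in>UNIV. (if hd4 j p = 1 then u p else - u p)) div 4)"
  have w4: "(\<Sum>p\<in>UNIV. (if hd4 j p = 1 then u p else - u p)) = 4 * w j" for j
  proof -
    have "(\<Sum>p\<in>UNIV. (if hd4 j p = 1 then u p else - u p))
        = (\<Sum>p\<in>UNIV. 2 * (if hd4 j p = 1 then u p else 0) - u p)"
      by (intro sum.cong) auto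
    also have "\<dots> = 2 * (\<Sum>p\<in>{p. hd4 j p = 1}. u p) - (\<Sum>p\<in>UNIV. u p)"
      by (simp add: sum_subtractf sum.If_cases flip: sum_distrib_left)
    finally have "4 dvd (\<Sum>p\<in>UNIV. (if hd4 j p = 1 then u p else - u p))"
      using even_ann[of j 0] u(4) by (auto elim!: evenE)
    then show ?thesis by (simp add: w_def)
  qed
  have rw: "(\<Sum>p\<in>UNIV. hd4 j p * u p) = 4 * real_of_int (w j)" for j
  proof -
    have "(\<Sum>p\<in>UNIV. hd4 j p * u p) = real_of_int (\<Sum>p\<in>UNIV. (if hd4 j p = 1 then u p else - u p))"
      unfolding of_int_sum by (intro sum.cong refl) (use hd4_cases[of j] in force)
    then show ?thesis by (simp add: w4)
  qed
  have sw: "(\<Sum>j\<in>UNIV. w j) = 4 * u 0"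
  proof -
    have "4 * real_of_int (\<Sum>j\<in>UNIV. w j) = (\<Sum>j\<in>UNIV. \<Sum>p\<in>UNIV. hd4 j p * u p)"
      unfolding rw by (simp add: sum_distrib_left)
    also have "\<dots> = (\<Sum>p\<in>UNIV. \<Sum>j\<in>UNIV. u p * hd4 p j)"
      by (subst sum.swap, intro sum.cong refl) (metis hd4_commute mult.commute)
    also have "\<dots> = (\<Sum>p\<in>UNIV. u p * (\<Sum>j\<in>UNIV. hd4 p j))"
      by (simp add: sum_distrib_left)
    also have "\<dots> = 16 * u 0" by (simp add: sum_hd4 if_distrib cong: if_cong)
    finally have "real_of_int (4 * (\<Sum>j\<in>UNIV. w j)) = real_of_int (16 * u 0)" by simp
    then show ?thesis by (simp only: of_int_eq_iff)
  qed
  have flat: "par (w j) * par (w (j + q)) * par (w (j + r)) * par (w (j + q + r)) = 1" for j q r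
  proof -
    have "4 * real_of_int (w j + w (j + q) + w (j + r) + w (j + q + r))
        = (\<Sum>p\<in>UNIV. hd4 j p * u p) + (\<Sum>p\<in>UNIV. hd4 (j + q) p * u p)
        + (\<Sum>p\<in>UNIV. hd4 (j + r) p * u p) + (\<Sum>p\<in>UNIV. hd4 (j + q + r) p * u p)"
      by (simp add: rw)
    \<comment> \<open>Summing the characters over the coset of \<open>j\<close> modulo the span of
      \<open>q\<close> and \<open>r\<close> produces 4 times the indicator of their
      annihilator.\<close>
    also have "\<dots> = (\<Sum>p\<in>UNIV. hd4 j p * (1 + hd4 q p) * (1 + hd4 r p) * u p)"
      unfolding sum.distrib[symmetric]
      by (intro sum.cong refl) (simp add: hd4_add_left algebra_simps)
    also have "\<dots> = (\<Sum>p\<in>UNIV. 4 * (if hd4 q p = 1 \<and> hd4 r p = 1 then hd4 j p * u p else 0))"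
      by (intro sum.cong refl) (use hd4_cases[of q] hd4_cases[of r] in force)
    also have "\<dots> = 4 * (\<Sum>p\<in>{p. hd4 q p = 1 \<and> hd4 r p = 1}. hd4 j p * u p)"
      by (simp add: sum.If_cases flip: sum_distrib_left)
    also have "(\<Sum>p\<in>{p. hd4 q p = 1 \<and> hd4 r p = 1}. hd4 j p * u p)
        = real_of_int (\<Sum>p\<in>{p. hd4 q p = 1 \<and> hd4 r p = 1}. if hd4 j p = 1 then u p else - u p)"
      unfolding of_int_sum by (intro sum.cong refl) (use hd4_cases[of j] in force)
    finally have "w j + w (j + q) + w (j + r) + w (j + q + r)
        = (\<Sum>p\<in>{p. hd4 q p = 1 \<and> hd4 r p = 1}. if hd4 j p = 1 then u p else - u p)"
      by (simp only: mult_cancel_left of_int_eq_iff) simp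
    moreover have "even (\<Sum>p\<in>{p. hd4 q p = 1 \<and> hd4 r p = 1}. if hd4 j p = 1 then u p else - u p)"
    proof -
      have "{p \<in> A. odd (if P p then u p else - u p)} = {p \<in> A. odd (u p)}" for A P by auto
      then show ?thesis using even_ann[of q r] by (simp add: even_sum_iff)
    qed
    ultimately have "par (w j + w (j + q) + w (j + r) + w (j + q + r)) = 1"
      by (simp add: par_def)
    then show ?thesis by (simp only: par_add)
  qed
  obtain b \<delta> where "\<delta> = 1 \<or> \<delta> = - 1" "\<And>p. par (w p) = \<delta> * hd4 b p"
    using flat_sums_imp_affine[of "\<lambda>p. par (w p)", OF par_cases flat] by metis
  then show ?thesis
    by (intro bwI[of \<delta> _ w b]) (auto simp: hadamard_def u(2) rw sw)
qed

lemma lattice_equiv_hadamard: "lattice_equiv bw z (hadamard z)"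
proof (rule lattice_equiv_involution)
  show "linear hadamard"
    by (rule linearI)
      (simp_all add: hadamard_def vec_eq_iff distrib_left sum.distrib add_divide_distrib sum_distrib_left mult_ac)
qed (simp_all add: norm_hadamard hadamard_bw hadamard_involution)

text \<open>The four signs of a codeword on a two-dimensional flat multiply to 1, so an even number
  of them is negative.\<close>

lemma card_flat:
  assumes "q \<noteq> 0" "r \<noteq> 0" "q \<noteq> (r :: 2 ^ 4)" and \<epsilon>: "\<epsilon> = 1 \<or> \<epsilon> = - 1"
  shows "even (card {x \<in> {p, p + q, p + r, p + q + r}. \<epsilon> * hd4 a x = - 1})"
proof -
  have "q + r \<noteq> 0" by (metis add_self_vec_2 add_right_cancel assms(3))
  then have d: "p \<noteq> p + q" "p \<noteq> p + r" "p \<noteq> p + q + r" "p + q \<noteq> p + r" "p + q \<noteq> p + q + r" "p + r \<noteq> p + q + r"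
    using assms by (auto simp: add.assoc add.commute[of q r])
  have "real (card {x \<in> {p, p + q, p + r, p + q + r}. \<epsilon> * hd4 a x = - 1})
      = (\<Sum>x\<in>{p, p + q, p + r, p + q + r}. if \<epsilon> * hd4 a x = - 1 then 1 else 0)"
    by (simp add: sum.If_cases Int_def)
  also have "\<dots> \<in> {0, 2, 4}"
    using d \<epsilon> hd4_cases[of a p] hd4_cases[of a q] hd4_cases[of a r] by (auto simp: hd4_add)
  finally have "card {x \<in> {p, p + q, p + r, p + q + r}. \<epsilon> * hd4 a x = - 1} \<in> {0, 2, 4}" by auto
  moreover have "even n" if "n \<in> {0, 2, 4}" for n :: nat using that by auto
  ultimately show ?thesis by blast
qed

text \<open>If the coordinate sum is not divisible by 4, \<open>hadamard\<close> makes coordinate 0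
  a proper fraction. Otherwise the parities cannot form a codeword, as \<open>z\<close> is no
  lattice point, so some two-dimensional flat has odd coordinate sum; flipping signs on it changes
  the total by 2 modulo 4 and leads back to the first case.\<close>

lemma bw_hole_integral_step:
  fixes z :: "real ^ (2 ^ 4)"
  assumes hole: "\<not> (\<exists>x\<in>bw. norm (x - z) < sqrt 6)" and z: "\<forall>p. z $ p \<in> \<int>"
  obtains w where "lattice_equiv bw z w" "\<not> (\<forall>p. w $ p \<in> \<int>)"
proof -
  note outer = that
  have "\<forall>p. \<exists>k. z $ p = of_int k" using z by (auto elim: Ints_cases)
  then obtain n where n: "\<And>p. z $ p = of_int (n p)" by metis
  have fin: thesis if "lattice_equiv bw z y" "\<And>p. y $ p = of_int (m p)" "\<not> 4 dvd (\<Sum>p\<in>UNIV. m p)" for y m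
  proof (rule outer)
    show "lattice_equiv bw z (hadamard y)"
      by (rule lattice_equiv_trans[OF that(1) lattice_equiv_hadamard])
    have h0: "hadamard y $ 0 = of_int (\<Sum>p\<in>UNIV. m p) / 4"
      by (simp add: hadamard_def that(2))
    show "\<not> (\<forall>p. hadamard y $ p \<in> \<int>)"
    proof
      assume "\<forall>p. hadamard y $ p \<in> \<int>"
      then obtain k where "hadamard y $ 0 = of_int k" by (metis Ints_cases)
      then have "real_of_int (\<Sum>p\<in>UNIV. m p) = of_int (4 * k)" using h0 by simp
      then have "(\<Sum>p\<in>UNIV. m p) = 4 * k" by (simp only: of_int_eq_iff)
      then show False using that(3) by simp
    qed
  qed
  show thesis
  proof (cases "4 dvd (\<Sum>p\<in>UNIV. n p)")
    case False
    then show ?thesis using fin[OF lattice_equiv_refl n] by blast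
  next
    case True
    have "\<exists>p q r. par (n p) * par (n (p + q)) * par (n (p + r)) * par (n (p + q + r)) \<noteq> 1"
    proof (rule ccontr)
      assume "\<not> ?thesis"
      then obtain a \<epsilon> where "\<epsilon> = 1 \<or> \<epsilon> = - 1" "\<And>p. par (n p) = \<epsilon> * hd4 a p"
        using flat_sums_imp_affine[of "\<lambda>p. par (n p)", OF par_cases] by metis
      then have "z \<in> bw" using n True by (intro bwI) auto
      then show False using hole by force
    qed
    then obtain p q r where pqr: "par (n p) * par (n (p + q)) * par (n (p + r)) * par (n (p + q + r)) \<noteq> 1"
      by blast
    have 1: "q \<noteq> 0"
      using pqr par_cases[of "n p"] par_cases[of "n (p + r)"] by auto
    have 2: "r \<noteq> 0"
      using pqr par_cases[of "n p"] par_cases[of "n (p + q)"] by auto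
    have 3: "q \<noteq> r"
    proof
      assume qr: "q = r"
      then have "p + q + r = p" by (simp only: add.assoc add_self_vec_2 add_0_right)
      then show False using pqr qr par_cases[of "n p"] par_cases[of "n (p + r)"] by auto
    qed
    define F where "F = {p, p + q, p + r, p + q + r}"
    have "q + r \<noteq> 0" by (metis add_self_vec_2 add_right_cancel 3)
    then have d: "p \<noteq> p + q" "p \<noteq> p + r" "p \<noteq> p + q + r" "p + q \<noteq> p + r" "p + q \<noteq> p + q + r" "p + r \<noteq> p + q + r"
      using 1 2 3 by (auto simp: add.assoc add.commute[of q r])
    have "par (\<Sum>x\<in>F. n x) \<noteq> 1"
    proof -
      have "(\<Sum>x\<in>F. n x) = n p + n (p + q) + n (p + r) + n (p + q + r)"
        using d by (simp add: F_def)
      then show ?thesis using pqr by (simp only: par_add not_False_eq_True)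
    qed
    then have odd: "odd (\<Sum>x\<in>F. n x)" by (auto simp: par_def)
    let ?m = "\<lambda>x. if x \<in> F then - n x else n x"
    have "(\<Sum>x\<in>UNIV. ?m x) = (\<Sum>x\<in>UNIV. n x - 2 * (if x \<in> F then n x else 0))"
      by (intro sum.cong) auto
    then have "(\<Sum>x\<in>UNIV. ?m x) = (\<Sum>x\<in>UNIV. n x) - 2 * (\<Sum>x\<in>F. n x)"
      by (simp add: sum_subtractf sum.If_cases flip: sum_distrib_left)
    moreover have "\<not> 4 dvd A - 2 * B" if "4 dvd A" "odd B" for A B :: int
      using that by presburger
    ultimately have nd: "\<not> 4 dvd (\<Sum>x\<in>UNIV. ?m x)" using True odd by simp
    have eqv: "lattice_equiv bw z (flip_signs F z)"
      unfolding F_def by (rule lattice_equiv_flip_signs, rule card_flat[OF 1 2 3])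
    show ?thesis by (rule fin[OF eqv _ nd]) (simp add: flip_signs_def n)
  qed
qed

text \<open>Every rounding to a codeword has squared distance 4, so in a hole all of them must
  violate the condition modulo 4. Comparing the even rounding with any other shows that the set
  \<open>F\<close> of odd floors meets each codeword evenly; flipping signs on \<open>F\<close>
  makes all coordinates 1/2 modulo 2, and then only a lattice translation separates the point from
  \<open>bw_hole\<close>.\<close>

lemma bw_hole_half_integral:
  fixes z :: "real ^ (2 ^ 4)"
  assumes hole: "\<not> (\<exists>x\<in>bw. norm (x - z) < sqrt 6)" and z: "\<forall>p. z $ p - 1 / 2 \<in> \<int>"
  shows "lattice_equiv bw z bw_hole"
proof -
  have "\<exists>k. z $ p = of_int k + 1 / 2" for p
    using z unfolding Ints_def by (metis (no_types) diff_add_cancel imageE)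
  then obtain k where k: "\<And>p. z $ p = of_int (k p) + 1 / 2" by metis
  define e where "e = (\<lambda>p. if even (k p) then k p else k p + 1)"
  define \<sigma> :: "2 ^ 4 \<Rightarrow> int" where "\<sigma> = (\<lambda>p. if even (k p) then 1 else - 1)"
  define F where "F = {p. odd (k p)}"
  \<comment> \<open>Sixteen coordinates at distance 1/2 give squared distance 4 < 6.\<close>
  have near4: False if "\<epsilon> = 1 \<or> \<epsilon> = - 1" "\<And>p. par (u p) = \<epsilon> * hd4 a p" "4 dvd (\<Sum>p\<in>UNIV. u p)"
    "\<And>p. \<bar>u p - y $ p\<bar> = 1 / 2" "lattice_equiv bw z y" for u a y and \<epsilon> :: real
  proof -
    define x :: "real ^ (2 ^ 4)" where "x = (\<chi> p. of_int (u p))"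
    have "x \<in> bw" by (rule bwI[OF that(1) _ that(2,3)]) (simp add: x_def)
    have "(norm (x - y))\<^sup>2 = (\<Sum>p\<in>(UNIV :: (2 ^ 4) set). (1 / 2)\<^sup>2)"
      unfolding norm_vec_power2 by (intro sum.cong refl) (simp add: x_def that(4))
    then have "norm (x - y) < sqrt 6" by (simp add: norm_lt_sqrt CARD_vec power2_eq_square)
    then show False using near_equiv[OF that(5)] hole \<open>x \<in> bw\<close> by blast
  qed
  have F: "even (card {p \<in> F. \<epsilon> * hd4 a p = - 1})" if \<epsilon>: "\<epsilon> = 1 \<or> \<epsilon> = - 1" for a \<epsilon>
  proof -
    have \<epsilon>h: "\<epsilon> * hd4 a p = 1 \<or> \<epsilon> * hd4 a p = - 1" for p
      using \<epsilon> hd4_cases[of a p] by auto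
    define P where "P = {p. \<epsilon> * hd4 a p = - 1}"
    define u where "u = (\<lambda>p. e p + (if p \<in> P then \<sigma> p else 0))"
    have pe: "par (e p) = 1 * hd4 0 p" for p by (simp add: e_def par_def)
    have pu: "par (u p) = \<epsilon> * hd4 a p" for p
      using \<epsilon>h[of p] by (auto simp: u_def e_def par_def P_def \<sigma>_def)
    have "\<bar>e p - z $ p\<bar> = 1 / 2" "\<bar>u p - z $ p\<bar> = 1 / 2" for p
      by (auto simp: e_def u_def \<sigma>_def k)
    then have n: "\<not> 4 dvd (\<Sum>p\<in>UNIV. e p)" "\<not> 4 dvd (\<Sum>p\<in>UNIV. u p)"
      using near4[OF _ pe, of z] near4[OF \<epsilon> pu, of z] lattice_equiv_refl by blast+
    have ev: "even (\<Sum>p\<in>UNIV. e p)" "even (\<Sum>p\<in>UNIV. u p)"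
      using codeword_sum_even[OF _ pe] codeword_sum_even[OF \<epsilon> pu] by blast+
    have "(\<Sum>p\<in>UNIV. u p) = (\<Sum>p\<in>UNIV. e p) + (\<Sum>p\<in>P. \<sigma> p)"
      by (simp add: u_def sum.distrib sum.If_cases)
    also have "(\<Sum>p\<in>P. \<sigma> p) = (\<Sum>p\<in>P. 1 - 2 * (if p \<in> F then 1 else 0))"
      by (intro sum.cong) (auto simp: \<sigma>_def F_def)
    also have "\<dots> = int (card P) - 2 * int (card (F \<inter> P))"
      by (simp add: sum_subtractf sum.If_cases Int_commute flip: sum_distrib_left)
    finally have "(\<Sum>p\<in>UNIV. u p) = (\<Sum>p\<in>UNIV. e p) + (int (card P) - 2 * int (card (F \<inter> P)))" .
    moreover have "4 dvd int (card P)"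
      unfolding P_def using card_odd_codeword[OF \<epsilon>, of a] by (metis int_dvd_int_iff of_nat_numeral)
    moreover have "even D" if "U = E + (C - 2 * D)" "4 dvd C" "\<not> 4 dvd E" "\<not> 4 dvd U" "even E" "even U" for U E C D :: int
      using that by presburger
    ultimately have "even (int (card (F \<inter> P)))" using n ev by metis
    moreover have "F \<inter> P = {p \<in> F. \<epsilon> * hd4 a p = - 1}" by (auto simp: P_def)
    ultimately show ?thesis by simp
  qed
  define y where "y = flip_signs F z"
  have zy: "lattice_equiv bw z y" unfolding y_def by (rule lattice_equiv_flip_signs[OF F])
  define b where "b = (\<lambda>p. if even (k p) then k p div 2 else (- k p - 1) div 2)"
  have y: "y $ p = 1 / 2 + 2 * of_int (b p)" for p
  proof -
    have "even (k p) \<Longrightarrow> real_of_int (k p) = 2 * of_int (k p div 2)"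
      by (metis dvd_mult_div_cancel of_int_mult of_int_numeral)
    moreover have "odd (k p) \<Longrightarrow> - real_of_int (k p) - 1 = 2 * of_int ((- k p - 1) div 2)"
    proof -
      assume "odd (k p)"
      then have "- k p - 1 = 2 * ((- k p - 1) div 2)" by simp
      from arg_cong[OF this, of real_of_int] show ?thesis by simp
    qed
    ultimately show ?thesis by (auto simp: y_def flip_signs_def F_def b_def k)
  qed
  \<comment> \<open>With an even sum, \<open>2 * b\<close> would be a lattice point at squared
    distance 4 from \<open>y\<close>.\<close>
  have "odd (\<Sum>p\<in>UNIV. b p)"
  proof
    assume ev: "even (\<Sum>p\<in>UNIV. b p)"
    show False
    proof (rule near4[of 1 "\<lambda>p. 2 * b p" 0 y])
      have "(\<Sum>p\<in>UNIV. 2 * b p) = 2 * (\<Sum>p\<in>UNIV. b p)" by (simp add: sum_distrib_left)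
      then show "4 dvd (\<Sum>p\<in>UNIV. 2 * b p)" using ev by (auto elim!: evenE)
    qed (auto simp: par_def y zy)
  qed
  then have "4 dvd 2 * ((\<Sum>p\<in>UNIV. b p) - 1)" by (auto elim!: oddE)
  also have "2 * ((\<Sum>p\<in>UNIV. b p) - 1) = (\<Sum>p\<in>UNIV. 2 * (b p - (if p = 0 then 1 else 0)))"
    by (simp add: sum_subtractf flip: sum_distrib_left)
  finally have "4 dvd (\<Sum>p\<in>UNIV. - (2 * (b p - (if p = 0 then 1 else 0))))"
    unfolding sum_negf dvd_minus_iff .
  then have "bw_hole - y \<in> bw"
    by (intro bwI[of 1 _ "\<lambda>p. - (2 * (b p - (if p = 0 then 1 else 0)))" 0])
      (auto simp: bw_hole_def y par_def)
  from lattice_equiv_trans[OF zy lattice_equiv_translate[OF discrete_subgroup_bw this, of y]]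
  show ?thesis by simp
qed

text \<open>After undoing the shift at 0 the coordinate sum is 2 modulo 4, whereas a codeword with
  entries 0 and 1 has weight divisible by 4. So some coordinate differs from 1/2 by at least 3/2,
  and 15/4 + 9/4 = 6.\<close>

lemma bw_hole_far:
  assumes "x \<in> bw"
  shows "6 \<le> (norm (x - bw_hole))\<^sup>2"
proof -
  obtain u a \<epsilon> where u: "\<epsilon> = 1 \<or> \<epsilon> = - 1" "\<And>p. x $ p = of_int (u p)"
    "\<And>p. par (u p) = \<epsilon> * hd4 a p" "4 dvd (\<Sum>p\<in>UNIV. u p)" using assms by (rule bwE) blast
  define v where "v = (\<lambda>p. u p - (if p = 0 then 2 else 0))"
  have pv: "par (v p) = \<epsilon> * hd4 a p" for p by (simp add: v_def par_diff u(3)) (simp add: par_def)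
  have sv: "\<not> 4 dvd (\<Sum>p\<in>UNIV. v p)"
  proof -
    have "(\<Sum>p\<in>UNIV. v p) = (\<Sum>p\<in>UNIV. u p) - 2" by (simp add: v_def sum_subtractf)
    moreover have "\<not> 4 dvd A - 2" if "4 dvd A" for A :: int using that by presburger
    ultimately show ?thesis using u(4) by metis
  qed
  have "\<exists>p. v p \<noteq> 0 \<and> v p \<noteq> 1"
  proof (rule ccontr)
    assume c: "\<not> ?thesis"
    have "(\<Sum>p\<in>UNIV. v p) = (\<Sum>p\<in>UNIV. if \<epsilon> * hd4 a p = - 1 then 1 else 0)"
    proof (intro sum.cong refl)
      fix p
      show "v p = (if \<epsilon> * hd4 a p = - 1 then 1 else 0)"
        unfolding pv[symmetric] using c by (cases "v p = 0") (auto simp: par_def)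
    qed
    also have "\<dots> = int (card {p. \<epsilon> * hd4 a p = - 1})" by (simp add: sum.If_cases)
    finally show False using sv card_odd_codeword[OF u(1), of a] by (metis int_dvd_int_iff of_nat_numeral)
  qed
  then obtain q where q: "v q \<noteq> 0" "v q \<noteq> 1" by blast
  have "6 = (\<Sum>p\<in>UNIV. 1 / 4 + (if p = q then 2 else 0 :: real))"
    by (simp add: sum.distrib CARD_vec)
  also have "\<dots> \<le> (norm (x - bw_hole))\<^sup>2"
    unfolding norm_vec_power2
  proof (intro sum_mono)
    fix p
    have e: "norm ((x - bw_hole) $ p) = \<bar>real_of_int (2 * v p - 1)\<bar> / 2"
      by (simp add: bw_hole_def u(2) v_def) (simp add: field_simps)
    have "1 + (if p = q then 8 else 0) \<le> (2 * v p - 1)\<^sup>2"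
    proof -
      have "1 \<le> \<bar>2 * v p - 1\<bar>" "p = q \<Longrightarrow> 3 \<le> \<bar>2 * v p - 1\<bar>" using q by presburger+
      then have "1\<^sup>2 \<le> (2 * v p - 1)\<^sup>2" "p = q \<Longrightarrow> 3\<^sup>2 \<le> (2 * v p - 1)\<^sup>2"
        by (metis power2_abs power_mono zero_le_one zero_le_numeral)+
      then show ?thesis by auto
    qed
    then have "real_of_int (1 + (if p = q then 8 else 0)) \<le> (real_of_int (2 * v p - 1))\<^sup>2"
      by (metis of_int_le_iff of_int_power)
    then show "1 / 4 + (if p = q then 2 else 0) \<le> (norm ((x - bw_hole) $ p))\<^sup>2"
      unfolding e power_divide power2_abs by (auto split: if_splits)
  qed
  finally show ?thesis .
qed

lemma bw_cover_equiv: "(\<exists>x\<in>bw. norm (x - z) < sqrt 6) \<or> lattice_equiv bw z bw_hole"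
proof (cases "\<exists>x\<in>bw. norm (x - z) < sqrt 6")
  case False
  have cover: "(\<forall>p. y $ p \<in> \<int>) \<or> (\<forall>p. y $ p - 1 / 2 \<in> \<int>)" if "\<not> (\<exists>x\<in>bw. norm (x - y) < sqrt 6)" for y
    using bw_cover[of y] that by (auto simp: norm_lt_sqrt)
  obtain w where w: "lattice_equiv bw z w" "\<not> (\<forall>p. w $ p \<in> \<int>)"
  proof (cases "\<forall>p. z $ p \<in> \<int>")
    case True
    then show ?thesis using bw_hole_integral_step[OF False] that by blast
  next
    case nz: False
    show ?thesis by (rule that[OF lattice_equiv_refl nz])
  qed
  have "\<not> (\<exists>x\<in>bw. norm (x - w) < sqrt 6)" using near_equiv[OF w(1)] False by blast
  then have "lattice_equiv bw w bw_hole" using cover w(2) bw_hole_half_integral by blast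
  then show ?thesis using lattice_equiv_trans[OF w(1)] by blast
qed simp

theorem BW16_deep_holes_stable:
  assumes "deep_hole BW16 c"
  shows "stable_cold_spot BW16 c"
proof -
  let ?s = "1 / sqrt 2 :: real"
  have s: "?s \<noteq> 0" "?s > 0" by auto
  have n: "norm (?s *\<^sub>R x - ?s *\<^sub>R y) = ?s * norm (x - y)" for x y :: "real ^ (2 ^ 4)"
    by (simp flip: scaleR_diff_right)
  have 2: "2 *\<^sub>R bw_hole \<in> bw"
    by (rule bwI[of "- 1" _ "\<lambda>p. 1 + (if p = 0 then 4 else 0)" 0])
      (auto simp: bw_hole_def par_def sum.distrib CARD_vec)
  show ?thesis
    unfolding BW16_eq
  proof (rule deep_holes_stable_central[where c = "?s *\<^sub>R bw_hole" and R = "?s * sqrt 6"])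
    show "discrete_subgroup ((*\<^sub>R) ?s ` bw)" by (rule discrete_subgroup_scale[OF discrete_subgroup_bw s(1)])
    show "2 *\<^sub>R ?s *\<^sub>R bw_hole \<in> (*\<^sub>R) ?s ` bw" using 2 by (metis image_eqI scaleR_left_commute)
    show "?s * sqrt 6 \<le> norm (x - ?s *\<^sub>R bw_hole)" if x: "x \<in> (*\<^sub>R) ?s ` bw" for x
    proof -
      obtain y where "y \<in> bw" "x = ?s *\<^sub>R y" using x by blast
      moreover have "sqrt 6 \<le> norm (y - bw_hole)" using bw_hole_far[OF \<open>y \<in> bw\<close>] by (simp add: sqrt_le_norm)
      ultimately show ?thesis using s(2) by (simp only: n mult_le_cancel_left_pos)
    qed
    obtain y where "y \<in> bw" "norm (y - bw_hole) \<le> sqrt 6"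
      using bw_cover[of bw_hole] bw_hole_far by (metis norm_le_sqrt not_less)
    then show "\<exists>x\<in>(*\<^sub>R) ?s ` bw. norm (x - ?s *\<^sub>R bw_hole) \<le> ?s * sqrt 6"
      using s(2) by (intro bexI[of _ "?s *\<^sub>R y"]) (simp_all only: n mult_le_cancel_left_pos imageI)
    show "(\<exists>x\<in>(*\<^sub>R) ?s ` bw. norm (x - z) < ?s * sqrt 6) \<or> lattice_equiv ((*\<^sub>R) ?s ` bw) z (?s *\<^sub>R bw_hole)" for z
    proof -
      have z: "z = ?s *\<^sub>R (sqrt 2 *\<^sub>R z)" by simp
      from bw_cover_equiv[of "sqrt 2 *\<^sub>R z"] show ?thesis
      proof
        assume "\<exists>x\<in>bw. norm (x - sqrt 2 *\<^sub>R z) < sqrt 6"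
        then obtain y where "y \<in> bw" "norm (y - sqrt 2 *\<^sub>R z) < sqrt 6" by blast
        then have "?s *\<^sub>R y \<in> (*\<^sub>R) ?s ` bw" "norm (?s *\<^sub>R y - z) < ?s * sqrt 6"
          using s(2) by (auto simp only: imageI mult_less_cancel_left_pos n[of y "sqrt 2 *\<^sub>R z", folded z])
        then show ?thesis by blast
      next
        assume "lattice_equiv bw (sqrt 2 *\<^sub>R z) bw_hole"
        from lattice_equiv_scale[OF this s(1)] show ?thesis using z by simp
      qed
    qed
    show "deep_hole ((*\<^sub>R) ?s ` bw) c" using assms by (simp add: BW16_eq)
  qed
qed

subsection \<open>Reflections and dominant points\<close>

definition reflect :: "'a::real_inner \<Rightarrow> 'a \<Rightarrow> 'a" where
  "reflect a x = x - (x \<bullet> a) *\<^sub>R a"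

lemma linear_reflect: "linear (reflect a)"
  by (rule linearI) (simp_all add: reflect_def inner_add_left algebra_simps)

lemma reflect_reflect: "a \<bullet> a = 2 \<Longrightarrow> reflect a (reflect a x) = x"
  by (simp add: reflect_def inner_diff_left algebra_simps)

lemma norm_reflect: "a \<bullet> a = 2 \<Longrightarrow> norm (reflect a x) = norm x"
  by (simp add: norm_eq_sqrt_inner reflect_def inner_diff_left inner_diff_right inner_commute algebra_simps)

lemma discrete_subgroup_scaleR_int:
  assumes L: "discrete_subgroup L" and a: "a \<in> L"
  shows "of_int n *\<^sub>R a \<in> L"
proof -
  have nat: "of_nat m *\<^sub>R a \<in> L" for m
    by (induction m) (auto simp: discrete_subgroup_zero[OF L] algebra_simps intro: discrete_subgroup_add[OF L a])
  show ?thesis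
  proof (cases n)
    case (nonneg m)
    then show ?thesis using nat[of m] by simp
  next
    case (neg m)
    show ?thesis
      using discrete_subgroup_minus[OF L nat[of "Suc m"]]
      by (simp only: neg of_int_minus of_int_of_nat_eq scaleR_minus_left)
  qed
qed

text \<open>The integral pairing with \<open>L\<close> is what makes the reflection preserve
  \<open>L\<close>. Roots of this kind exist in the duals of \<open>E_6\<close> and
  \<open>E_7\<close> because these contain the root lattices.\<close>

definition lattice_root :: "'a::euclidean_space set \<Rightarrow> 'a \<Rightarrow> bool" where
  "lattice_root L a \<longleftrightarrow> a \<in> L \<and> a \<bullet> a = 2 \<and> (\<forall>x\<in>L. x \<bullet> a \<in> \<int>)"

lemma reflect_in_lattice:
  assumes L: "discrete_subgroup L" and a: "lattice_root L a" and x: "x \<in> L"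
  shows "reflect a x \<in> L"
proof -
  obtain n where "x \<bullet> a = of_int n" using a x unfolding lattice_root_def by (auto elim: Ints_cases)
  then show ?thesis
    using discrete_subgroup_diff[OF L x discrete_subgroup_scaleR_int[OF L, of a n]] a
    by (simp add: reflect_def lattice_root_def)
qed

lemma reflect_image_lattice:
  assumes L: "discrete_subgroup L" and a: "lattice_root L a"
  shows "reflect a ` L = L"
  using reflect_in_lattice[OF L a] reflect_reflect[of a] a
  by (auto simp: lattice_root_def intro: image_eqI[where x = "reflect a _"])

text \<open>The reflection in the hyperplane through \<open>c\<close> orthogonal to \<open>a\<close>
  is the linear one followed by translation by \<open>(c \<bullet> a) *\<^sub>R a\<close>, an
  integer multiple of a lattice vector.\<close>

lemma lattice_equiv_reflect_about:
  assumes L: "discrete_subgroup L" and a: "lattice_root L a" and c: "c \<bullet> a \<in> \<int>"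
  shows "lattice_equiv L (c + u) (c + reflect a u)"
proof -
  have "lattice_equiv L (c + u) (reflect a (c + u))"
    by (rule lattice_equiv_linear[OF linear_reflect norm_reflect reflect_image_lattice[OF L a]])
      (use a in \<open>simp add: lattice_root_def\<close>)
  moreover obtain n where n: "c \<bullet> a = of_int n" using c by (auto elim: Ints_cases)
  then have "of_int n *\<^sub>R a \<in> L"
    using a by (intro discrete_subgroup_scaleR_int[OF L]) (simp add: lattice_root_def)
  then have "lattice_equiv L (reflect a (c + u)) (reflect a (c + u) + of_int n *\<^sub>R a)"
    by (rule lattice_equiv_translate[OF L])
  moreover have "reflect a (c + u) + of_int n *\<^sub>R a = c + reflect a u"
    by (simp add: reflect_def inner_add_left n algebra_simps)
  ultimately show ?thesis by (metis lattice_equiv_trans)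
qed

text \<open>The Weyl group argument without the group: \<open>\<rho> \<bullet> g z = g\<^sup>-\<^sup>1 \<rho> \<bullet> z\<close> takes only finitely
  many values over the linear automorphisms \<open>g\<close> of \<open>L\<close>, and at a maximum no reflection helps.\<close>

lemma exists_dominant:
  fixes L :: "'a::euclidean_space set"
  assumes L: "discrete_subgroup L" and \<rho>: "\<rho> \<in> L"
    and S: "\<And>a. a \<in> S \<Longrightarrow> lattice_root L a" "\<And>a. a \<in> S \<Longrightarrow> 0 < \<rho> \<bullet> a"
  obtains w where "lattice_equiv L z w" "norm w = norm z" "\<And>a. a \<in> S \<Longrightarrow> 0 \<le> w \<bullet> a"
proof -
  define G where "G = {g :: 'a \<Rightarrow> 'a. linear g \<and> (\<forall>x. norm (g x) = norm x) \<and> g ` L = L}"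
  have fin: "finite ((\<lambda>g. \<rho> \<bullet> g z) ` G)"
  proof (rule finite_subset)
    show "(\<lambda>g. \<rho> \<bullet> g z) ` G \<subseteq> (\<lambda>y. y \<bullet> z) ` (L \<inter> cball 0 (norm \<rho>))"
    proof safe
      fix g assume "g \<in> G"
      then have g: "linear g" "\<And>x. norm (g x) = norm x" "g ` L = L" by (auto simp: G_def)
      obtain y where y: "y \<in> L" "\<rho> = g y" using \<rho> g(3) by blast
      have "g y \<bullet> g z = y \<bullet> z"
        using g(2)[of "y + z"] g(2)[of y] g(2)[of z] by (simp add: linear_add[OF g(1)] dot_norm)
      moreover have "norm y = norm \<rho>" using y g(2) by simp
      ultimately show "\<rho> \<bullet> g z \<in> (\<lambda>y. y \<bullet> z) ` (L \<inter> cball 0 (norm \<rho>))" using y by auto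
    qed
    show "finite ((\<lambda>y. y \<bullet> z) ` (L \<inter> cball 0 (norm \<rho>)))"
      by (intro finite_imageI discrete_subgroup_finite_cball[OF L])
  qed
  have "id \<in> G" by (auto simp: G_def linear_id)
  then have "Max ((\<lambda>g. \<rho> \<bullet> g z) ` G) \<in> (\<lambda>g. \<rho> \<bullet> g z) ` G" using fin by (intro Max_in) auto
  then obtain g where g1: "g \<in> G" "Max ((\<lambda>g. \<rho> \<bullet> g z) ` G) = \<rho> \<bullet> g z" by blast
  have g: "g \<in> G" "\<And>h. h \<in> G \<Longrightarrow> \<rho> \<bullet> h z \<le> \<rho> \<bullet> g z"
    using g1(1) Max_ge[OF fin] unfolding g1(2) by auto
  show ?thesis
  proof (rule that[of "g z"])
    show "lattice_equiv L z (g z)" "norm (g z) = norm z"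
      using g(1) by (auto simp: G_def intro!: lattice_equiv_linear)
    fix a assume a: "a \<in> S"
    have "(reflect a \<circ> g) ` L = L"
      using g(1) reflect_image_lattice[OF L S(1)[OF a]] unfolding G_def by (metis (mono_tags, lifting) image_comp mem_Collect_eq)
    then have "reflect a \<circ> g \<in> G"
      using g(1) S(1)[OF a]
      by (simp add: G_def linear_compose linear_reflect norm_reflect lattice_root_def)
    then have "\<rho> \<bullet> reflect a (g z) \<le> \<rho> \<bullet> g z" using g(2) by fastforce
    then have "0 \<le> (g z \<bullet> a) * (\<rho> \<bullet> a)" by (simp add: reflect_def inner_diff_right)
    then show "0 \<le> g z \<bullet> a" using S(2)[OF a] by (simp add: zero_le_mult_iff)
  qed
qed

text \<open>First a nearest lattice point is translated to 0, then linear automorphisms are applied;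
  they fix 0 and \<open>L\<close>, so the point stays in the Voronoi cell of 0 while it moves into
  the chamber.\<close>

lemma exists_dominant_voronoi:
  fixes L :: "'a::euclidean_space set"
  assumes L: "discrete_subgroup L" and \<rho>: "\<rho> \<in> L"
    and S: "\<And>a. a \<in> S \<Longrightarrow> lattice_root L a" "\<And>a. a \<in> S \<Longrightarrow> 0 < \<rho> \<bullet> a"
  obtains w x where "lattice_equiv L z w" "x \<in> L" "norm (x - z) = norm w"
    "\<And>a. a \<in> S \<Longrightarrow> 0 \<le> w \<bullet> a" "\<And>y. y \<in> L \<Longrightarrow> w \<bullet> y \<le> (y \<bullet> y) / 2"
proof -
  obtain x where x: "x \<in> L" "infdist z L = norm (x - z)" by (rule exists_nearest[OF L, of z])
  have zx: "lattice_equiv L z (z - x)"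
    using lattice_equiv_translate[OF L discrete_subgroup_minus[OF L x(1)], of z] by simp
  have "\<exists>w. lattice_equiv L (z - x) w \<and> norm w = norm (z - x) \<and> (\<forall>a\<in>S. 0 \<le> w \<bullet> a)"
    by (rule exists_dominant[OF L \<rho> S, where z = "z - x" and S = S]) blast+
  then obtain w where w: "lattice_equiv L (z - x) w" "norm w = norm (z - x)" "\<And>a. a \<in> S \<Longrightarrow> 0 \<le> w \<bullet> a"
    by blast
  have zw: "lattice_equiv L z w" by (rule lattice_equiv_trans[OF zx w(1)])
  show ?thesis
  proof (rule that[OF zw x(1) _ w(3)])
    show "norm (x - z) = norm w" using w(2) by (simp add: norm_minus_commute)
    fix y assume y: "y \<in> L"
    have "norm w = infdist w L"
      using infdist_equiv[OF zw] x(2) w(2) by (simp only: norm_minus_commute)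
    also have "\<dots> \<le> norm (w - y)" using infdist_le[OF y, of w] by (simp only: dist_norm)
    finally have "norm w \<le> norm (w - y)" .
    then have "w \<bullet> w \<le> (w - y) \<bullet> (w - y)" by (simp add: norm_le)
    then show "w \<bullet> y \<le> (y \<bullet> y) / 2" by (simp add: inner_diff_left inner_diff_right inner_commute)
  qed
qed

section \<open>Dual lattices and roots in eight coordinates\<close>

lemma span_group_closure: "span (group_closure S) = span (S :: 'a::real_vector set)"
proof
  have "group_closure S \<subseteq> span S"
  proof
    fix x assume "x \<in> group_closure S"
    then show "x \<in> span S" by induction (auto intro: span_base span_zero span_diff)
  qed
  then show "span (group_closure S) \<subseteq> span S" by (simp add: span_minimal)
  show "span S \<subseteq> span (group_closure S)"
    by (intro span_mono) (auto intro: group_closure.base)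
qed

lemma dual_lattice_group_closure:
  "dual_lattice (group_closure S) = {x \<in> span S. \<forall>v\<in>S. x \<bullet> v \<in> \<int>}"
proof -
  have "x \<bullet> v \<in> \<int>" if "\<forall>v\<in>S. x \<bullet> v \<in> \<int>" "v \<in> group_closure S" for x v
    using that(2) by induction (use that(1) in \<open>auto simp: inner_diff_right\<close>)
  then show ?thesis
    by (auto simp: dual_lattice_def span_group_closure intro: group_closure.base)
qed

text \<open>A nonzero vector of the span has a nonzero, hence at least unit, integral pairing with
  some generator of norm \<open>sqrt 2\<close>; Cauchy-Schwarz bounds its length below.\<close>

lemma discrete_subgroup_dual:
  fixes S :: "'a::euclidean_space set"
  assumes S: "\<And>v. v \<in> S \<Longrightarrow> v \<bullet> v = 2"
  shows "discrete_subgroup {x \<in> span S. \<forall>v\<in>S. x \<bullet> v \<in> \<int>}"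
  unfolding discrete_subgroup_def
proof (intro conjI ballI exI[of _ "1 / sqrt 2 :: real"] impI)
  fix x assume x: "x \<in> {x \<in> span S. \<forall>v\<in>S. x \<bullet> v \<in> \<int>}" "x \<noteq> 0"
  have "\<exists>v\<in>S. x \<bullet> v \<noteq> 0"
  proof (rule ccontr)
    assume "\<not> ?thesis"
    then have "S \<subseteq> {y. x \<bullet> y = 0}" by auto
    moreover have "subspace {y. x \<bullet> y = 0}" by (rule subspace_hyperplane)
    ultimately have "span S \<subseteq> {y. x \<bullet> y = 0}" by (rule span_minimal)
    then show False using x by auto
  qed
  then obtain v where v: "v \<in> S" "x \<bullet> v \<noteq> 0" by blast
  then have "1 \<le> \<bar>x \<bullet> v\<bar>" using x(1) by (auto elim!: Ints_cases)
  also have "\<dots> \<le> norm x * norm v" by (rule Cauchy_Schwarz_ineq2)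
  also have "norm v = sqrt 2" using S[OF v(1)] by (simp add: norm_eq_sqrt_inner)
  finally show "1 / sqrt 2 \<le> norm x" by (simp add: field_simps)
qed (auto simp: span_zero span_diff inner_diff_left)

lemma exhaust_8: "x = 1 \<or> x = 2 \<or> x = 3 \<or> x = 4 \<or> x = 5 \<or> x = 6 \<or> x = 7 \<or> x = 8" for x :: 8
proof (induct x)
  case (of_int z)
  then have "z = 0 \<or> z = 1 \<or> z = 2 \<or> z = 3 \<or> z = 4 \<or> z = 5 \<or> z = 6 \<or> z = 7" by fastforce
  then show ?case by auto
qed

lemma UNIV_8: "UNIV = {1, 2, 3, 4, 5, 6, 7, 8 :: 8}"
  using exhaust_8 by auto

lemma forall_8: "(\<forall>i::8. P i) \<longleftrightarrow> P 1 \<and> P 2 \<and> P 3 \<and> P 4 \<and> P 5 \<and> P 6 \<and> P 7 \<and> P 8"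
  by (metis exhaust_8)

lemma sum_8: "sum f (UNIV :: 8 set) = f 1 + f 2 + f 3 + f 4 + f 5 + f 6 + f 7 + f 8"
  unfolding UNIV_8 by (simp add: ac_simps)

definition v8 :: "real \<Rightarrow> real \<Rightarrow> real \<Rightarrow> real \<Rightarrow> real \<Rightarrow> real \<Rightarrow> real \<Rightarrow> real \<Rightarrow> real ^ 8" where
  "v8 a b c d e f g h = (\<chi> i. if i = 1 then a else if i = 2 then b else if i = 3 then c else if i = 4 then d
     else if i = 5 then e else if i = 6 then f else if i = 7 then g else h)"

lemma v8_nth [simp]:
  "v8 a b c d e f g h $ 1 = a" "v8 a b c d e f g h $ 2 = b" "v8 a b c d e f g h $ 3 = c"
  "v8 a b c d e f g h $ 4 = d" "v8 a b c d e f g h $ 5 = e" "v8 a b c d e f g h $ 6 = f"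
  "v8 a b c d e f g h $ 7 = g" "v8 a b c d e f g h $ 8 = h"
  by (simp_all add: v8_def)

lemma v8_eta: "v8 (x $ 1) (x $ 2) (x $ 3) (x $ 4) (x $ 5) (x $ 6) (x $ 7) (x $ 8) = x"
  by (simp add: vec_eq_iff forall_8)

lemma inner_8: "x \<bullet> y = x $ 1 * y $ 1 + x $ 2 * y $ 2 + x $ 3 * y $ 3 + x $ 4 * y $ 4
    + x $ 5 * y $ 5 + x $ 6 * y $ 6 + x $ 7 * y $ 7 + x $ 8 * y $ 8" for x y :: "real ^ 8"
  by (simp add: inner_vec_def sum_8)

text \<open>One parametrisation for integral and half-integral roots: eight summands h/2 contribute
  4 h to the coordinate sum, so its evenness falls on the \<open>m i\<close>. Integrality of a
  pairing then becomes a linear identity in integers.\<close>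

lemma E8_root_coords:
  assumes "v \<in> E8_roots"
  obtains h s :: int and m :: "8 \<Rightarrow> int" where "\<And>i. v $ i = of_int h / 2 + of_int (m i)"
    "m 1 + m 2 + m 3 + m 4 + m 5 + m 6 + m 7 + m 8 = 2 * s"
proof -
  have v: "(\<forall>i. v $ i \<in> \<int>) \<or> (\<forall>i. v $ i - 1 / 2 \<in> \<int>)" "(\<Sum>i\<in>UNIV. v $ i) / 2 \<in> \<int>"
    using assms by (auto simp: E8_roots_def)
  have "\<exists>h::int. \<forall>i. \<exists>k::int. v $ i = of_int h / 2 + of_int k"
  proof (cases "\<forall>i. v $ i \<in> \<int>")
    case True
    then show ?thesis by (intro exI[of _ 0]) (auto elim: Ints_cases)
  next
    case False
    then have "\<exists>k::int. v $ i - 1 / 2 = of_int k" for i using v(1) by (auto elim: Ints_cases)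
    then show ?thesis by (intro exI[of _ 1]) (auto simp: algebra_simps)
  qed
  then obtain h :: int and m :: "8 \<Rightarrow> int" where m: "\<And>i. v $ i = of_int h / 2 + of_int (m i)" by metis
  obtain n :: int where "(\<Sum>i\<in>UNIV. v $ i) / 2 = of_int n" using v(2) by (auto elim: Ints_cases)
  then have "real_of_int (4 * h + (m 1 + m 2 + m 3 + m 4 + m 5 + m 6 + m 7 + m 8)) = real_of_int (2 * n)"
    by (simp add: sum_8 m)
  then have "4 * h + (m 1 + m 2 + m 3 + m 4 + m 5 + m 6 + m 7 + m 8) = 2 * n" by (simp only: of_int_eq_iff)
  then have "m 1 + m 2 + m 3 + m 4 + m 5 + m 6 + m 7 + m 8 = 2 * (n - 2 * h)" by simp
  then show ?thesis using that m by blast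
qed

lemma E8_roots_norm: "v \<in> E8_roots \<Longrightarrow> v \<bullet> v = 2"
  by (simp add: E8_roots_def power2_norm_eq_inner)

lemma norm_sq_8: "(norm x)\<^sup>2 = (x $ 1)\<^sup>2 + (x $ 2)\<^sup>2 + (x $ 3)\<^sup>2 + (x $ 4)\<^sup>2
    + (x $ 5)\<^sup>2 + (x $ 6)\<^sup>2 + (x $ 7)\<^sup>2 + (x $ 8)\<^sup>2" for x :: "real ^ 8"
  unfolding power2_norm_eq_inner inner_8 by (simp add: power2_eq_square)

lemma E7_root_coords:
  assumes "v \<in> E7_roots"
  obtains h s :: int and m :: "8 \<Rightarrow> int" where "\<And>i. v $ i = of_int h / 2 + of_int (m i)"
    "m 1 = 2 * s - m 2 - m 3 - m 4 - m 5 - m 6 - m 7 - m 8" "h = - m 7 - m 8"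
proof -
  have v: "v \<in> E8_roots" "v $ 7 = - v $ 8" using assms by (auto simp: E7_roots_def)
  obtain h s :: int and m :: "8 \<Rightarrow> int" where m: "\<And>i. v $ i = of_int h / 2 + of_int (m i)"
    "m 1 + m 2 + m 3 + m 4 + m 5 + m 6 + m 7 + m 8 = 2 * s"
    by (rule E8_root_coords[OF v(1)]) blast
  have "real_of_int h = of_int (- m 7 - m 8)" using v(2) by (simp add: m(1) field_simps)
  then have "h = - m 7 - m 8" by (simp only: of_int_eq_iff)
  moreover have "m 1 = 2 * s - m 2 - m 3 - m 4 - m 5 - m 6 - m 7 - m 8" using m(2) by simp
  ultimately show ?thesis using that m(1) by blast
qed

lemma E6_root_coords:
  assumes "v \<in> E6_roots"
  obtains h s :: int and m :: "8 \<Rightarrow> int" where "\<And>i. v $ i = of_int h / 2 + of_int (m i)"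
    "m 1 = 2 * s - m 2 - m 3 - m 4 - m 5 - m 6 - m 7 - m 8" "h = - m 7 - m 8" "m 6 = m 7"
proof -
  have v: "v \<in> E7_roots" "v $ 6 = v $ 7" using assms by (auto simp: E6_roots_def E7_roots_def)
  obtain h s :: int and m :: "8 \<Rightarrow> int" where m: "\<And>i. v $ i = of_int h / 2 + of_int (m i)"
    "m 1 = 2 * s - m 2 - m 3 - m 4 - m 5 - m 6 - m 7 - m 8" "h = - m 7 - m 8"
    by (rule E7_root_coords[OF v(1)]) blast
  have "m 6 = m 7" using v(2) by (simp add: m(1))
  then show ?thesis using that m by blast
qed

lemmas E8_root_simps = E8_roots_def forall_8 sum_8 power2_norm_eq_inner inner_8

text \<open>Bourbaki's simple roots: the first six for \<open>E_6\<close>, all seven for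
  \<open>E_7\<close>. Below, \<open>\<theta>7\<close> and \<open>\<theta>6\<close> are the highest
  roots.\<close>

abbreviation "\<alpha>1 \<equiv> v8 (1/2) (-1/2) (-1/2) (-1/2) (-1/2) (-1/2) (-1/2) (1/2)"
abbreviation "\<alpha>2 \<equiv> v8 1 1 0 0 0 0 0 0"
abbreviation "\<alpha>3 \<equiv> v8 (-1) 1 0 0 0 0 0 0"
abbreviation "\<alpha>4 \<equiv> v8 0 (-1) 1 0 0 0 0 0"
abbreviation "\<alpha>5 \<equiv> v8 0 0 (-1) 1 0 0 0 0"
abbreviation "\<alpha>6 \<equiv> v8 0 0 0 (-1) 1 0 0 0"
abbreviation "\<alpha>7 \<equiv> v8 0 0 0 0 (-1) 1 0 0"

subsection \<open>\<open>E\<^sub>7\<^sup>*\<close>\<close>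

abbreviation "\<theta>7 \<equiv> v8 0 0 0 0 0 0 (-1) 1"

lemma simple_roots_E7:
  "\<alpha>1 \<in> E7_roots" "\<alpha>2 \<in> E7_roots" "\<alpha>3 \<in> E7_roots" "\<alpha>4 \<in> E7_roots" "\<alpha>5 \<in> E7_roots" "\<alpha>6 \<in> E7_roots"
  "\<alpha>7 \<in> E7_roots" "\<theta>7 \<in> E7_roots"
  by (simp_all add: E7_roots_def E8_root_simps)

lemma span_E7_roots: "span E7_roots = {x. x $ 7 = - x $ 8}"
proof
  have "subspace {x :: real ^ 8. x $ 7 = - x $ 8}" by (simp add: subspace_def)
  then show "span E7_roots \<subseteq> {x. x $ 7 = - x $ 8}"
    by (intro span_minimal) (auto simp: E7_roots_def)
  show "{x. x $ 7 = - x $ 8} \<subseteq> span E7_roots"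
  proof
    fix x :: "real ^ 8" assume x: "x \<in> {x. x $ 7 = - x $ 8}"
    let ?t = "x $ 8"
    \<comment> \<open>The coefficients are the pairings of \<open>x\<close> with the fundamental
      weights of \<open>E_7\<close>.\<close>
    have "(2 * ?t) *\<^sub>R \<alpha>1 + ((x $ 1 + x $ 2 + x $ 3 + x $ 4 + x $ 5 + x $ 6) / 2 + 2 * ?t) *\<^sub>R \<alpha>2
      + ((- x $ 1 + x $ 2 + x $ 3 + x $ 4 + x $ 5 + x $ 6) / 2 + 3 * ?t) *\<^sub>R \<alpha>3
      + (x $ 3 + x $ 4 + x $ 5 + x $ 6 + 4 * ?t) *\<^sub>R \<alpha>4 + (x $ 4 + x $ 5 + x $ 6 + 3 * ?t) *\<^sub>R \<alpha>5
      + (x $ 5 + x $ 6 + 2 * ?t) *\<^sub>R \<alpha>6 + (x $ 6 + ?t) *\<^sub>R \<alpha>7 \<in> span E7_roots"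
      by (intro span_add span_scale span_base simple_roots_E7)
    also have "(2 * ?t) *\<^sub>R \<alpha>1 + ((x $ 1 + x $ 2 + x $ 3 + x $ 4 + x $ 5 + x $ 6) / 2 + 2 * ?t) *\<^sub>R \<alpha>2
      + ((- x $ 1 + x $ 2 + x $ 3 + x $ 4 + x $ 5 + x $ 6) / 2 + 3 * ?t) *\<^sub>R \<alpha>3
      + (x $ 3 + x $ 4 + x $ 5 + x $ 6 + 4 * ?t) *\<^sub>R \<alpha>4 + (x $ 4 + x $ 5 + x $ 6 + 3 * ?t) *\<^sub>R \<alpha>5
      + (x $ 5 + x $ 6 + 2 * ?t) *\<^sub>R \<alpha>6 + (x $ 6 + ?t) *\<^sub>R \<alpha>7 = x"
      using x by (simp add: vec_eq_iff forall_8 field_simps)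
    finally show "x \<in> span E7_roots" .
  qed
qed

lemma dual_E7_eq: "dual_lattice E7_lattice = {x. x $ 7 = - x $ 8 \<and> (\<forall>v\<in>E7_roots. x \<bullet> v \<in> \<int>)}"
  by (simp add: E7_lattice_def dual_lattice_group_closure span_E7_roots)

lemma discrete_subgroup_dual_E7: "discrete_subgroup (dual_lattice E7_lattice)"
  unfolding E7_lattice_def dual_lattice_group_closure
  by (rule discrete_subgroup_dual) (auto simp: E7_roots_def E8_roots_norm)

text \<open>After the roots come the Weyl vector, which pairs to 1 with every simple root; the
  fundamental weight of \<alpha>2, which is twice the hole; and the minuscule weight of \<alpha>7,
  of squared norm 3/2.\<close>

lemma E7_dual_members:
  "\<alpha>1 \<in> dual_lattice E7_lattice" "\<alpha>2 \<in> dual_lattice E7_lattice" "\<alpha>3 \<in> dual_lattice E7_lattice"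
  "\<alpha>4 \<in> dual_lattice E7_lattice" "\<alpha>5 \<in> dual_lattice E7_lattice" "\<alpha>6 \<in> dual_lattice E7_lattice"
  "\<alpha>7 \<in> dual_lattice E7_lattice" "\<theta>7 \<in> dual_lattice E7_lattice"
  "v8 0 1 2 3 4 5 (-17/2) (17/2) \<in> dual_lattice E7_lattice"
  "v8 (1/2) (1/2) (1/2) (1/2) (1/2) (1/2) (-1) 1 \<in> dual_lattice E7_lattice"
  "v8 0 0 0 0 0 1 (-1/2) (1/2) \<in> dual_lattice E7_lattice"
proof -
  \<comment> \<open>\<open>f\<close> is the explicit integer value of the pairing with a general
    root in the parametrisation above.\<close>
  have *: "x \<in> dual_lattice E7_lattice" if "x $ 7 = - x $ 8"
    "\<And>h s m. h = - m 7 - m 8 \<Longrightarrow> x \<bullet> v8 (of_int h / 2 + (2 * of_int s - of_int (m 2) - of_int (m 3) - of_int (m 4)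
        - of_int (m 5) - of_int (m 6) - of_int (m 7) - of_int (m 8)))
       (of_int h / 2 + of_int (m 2)) (of_int h / 2 + of_int (m 3)) (of_int h / 2 + of_int (m 4)) (of_int h / 2 + of_int (m 5))
       (of_int h / 2 + of_int (m 6)) (of_int h / 2 + of_int (m 7)) (of_int h / 2 + of_int (m 8)) = of_int (f h s m)"
    for x and f :: "int \<Rightarrow> int \<Rightarrow> (8 \<Rightarrow> int) \<Rightarrow> int"
    unfolding dual_E7_eq mem_Collect_eq
  proof (intro conjI ballI)
    fix v assume "v \<in> E7_roots"
    then obtain h s :: int and m :: "8 \<Rightarrow> int" where m: "\<And>i. v $ i = of_int h / 2 + of_int (m i)"
      "m 1 = 2 * s - m 2 - m 3 - m 4 - m 5 - m 6 - m 7 - m 8" "h = - m 7 - m 8"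
      by (rule E7_root_coords) blast
    have "x \<bullet> v8 (v $ 1) (v $ 2) (v $ 3) (v $ 4) (v $ 5) (v $ 6) (v $ 7) (v $ 8) = of_int (f h s m)"
      using that(2)[OF m(3), of s] by (simp only: m(1,2) of_int_diff of_int_mult of_int_numeral)
    then show "x \<bullet> v \<in> \<int>" by (simp add: v8_eta)
  qed (fact that(1))
  show "\<alpha>1 \<in> dual_lattice E7_lattice"
    by (rule *[where f = "\<lambda>h s m. s - (m 2 + m 3 + m 4 + m 5 + m 6 + m 7) - h"]) (simp_all add: inner_8 field_simps)
  show "\<alpha>2 \<in> dual_lattice E7_lattice"
    by (rule *[where f = "\<lambda>h s m. h + 2 * s - m 3 - m 4 - m 5 - m 6 - m 7 - m 8"]) (simp_all add: inner_8 field_simps)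
  show "\<alpha>3 \<in> dual_lattice E7_lattice"
    by (rule *[where f = "\<lambda>h s m. 2 * m 2 - 2 * s + m 3 + m 4 + m 5 + m 6 + m 7 + m 8"]) (simp_all add: inner_8 field_simps)
  show "\<alpha>4 \<in> dual_lattice E7_lattice"
    by (rule *[where f = "\<lambda>h s m. m 3 - m 2"]) (simp_all add: inner_8 field_simps)
  show "\<alpha>5 \<in> dual_lattice E7_lattice"
    by (rule *[where f = "\<lambda>h s m. m 4 - m 3"]) (simp_all add: inner_8 field_simps)
  show "\<alpha>6 \<in> dual_lattice E7_lattice"
    by (rule *[where f = "\<lambda>h s m. m 5 - m 4"]) (simp_all add: inner_8 field_simps)
  show "\<alpha>7 \<in> dual_lattice E7_lattice"
    by (rule *[where f = "\<lambda>h s m. m 6 - m 5"]) (simp_all add: inner_8 field_simps)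
  show "\<theta>7 \<in> dual_lattice E7_lattice"
    by (rule *[where f = "\<lambda>h s m. m 8 - m 7"]) (simp_all add: inner_8 field_simps)
  show "v8 0 1 2 3 4 5 (-17/2) (17/2) \<in> dual_lattice E7_lattice"
    by (rule *[where f = "\<lambda>h s m. 16 * h + m 2 + 2 * m 3 + 3 * m 4 + 4 * m 5 + 5 * m 6 + 17 * m 8"]) (simp_all add: inner_8 field_simps)
  show "v8 (1/2) (1/2) (1/2) (1/2) (1/2) (1/2) (-1) 1 \<in> dual_lattice E7_lattice"
    by (rule *[where f = "\<lambda>h s m. 3 * h + s + 2 * m 8"]) (simp_all add: inner_8 field_simps)
  show "v8 0 0 0 0 0 1 (-1/2) (1/2) \<in> dual_lattice E7_lattice"
    by (rule *[where f = "\<lambda>h s m. h + m 6 + m 8"]) (simp_all add: inner_8 field_simps)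
qed

text \<open>Half the fundamental weight of \<alpha>2, whose coefficient in the highest root is 2: a
  vertex of the fundamental alcove, of squared norm 7/8.\<close>

abbreviation "E7_hole \<equiv> v8 (1/4) (1/4) (1/4) (1/4) (1/4) (1/4) (-1/2) (1/2)"

text \<open>Let y_i be the pairings with the simple roots and n_i = 2, 2, 3, 4, 3, 2, 1 the
  coefficients of the highest root. The squared norm is the sum of y_i times the pairing with the
  i-th fundamental weight. With w_i denoting 7/8 n_i minus that pairing, 7/8 times the pairing with
  the highest root exceeds the squared norm by the sum of the y_i w_i. All these terms are
  nonnegative and only w2 can vanish, so in the equality case y2 alone survives.\<close>

lemma E7_alcove:
  fixes x1 x2 x3 x4 x5 x6 t :: real
  assumes y: "0 \<le> x1 - x2 - x3 - x4 - x5 - x6 + 2 * t" "0 \<le> x1 + x2" "0 \<le> x2 - x1" "0 \<le> x3 - x2"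
    "0 \<le> x4 - x3" "0 \<le> x5 - x4" "0 \<le> x6 - x5" and t: "2 * t \<le> 1" and w: "x6 + t \<le> 3/4"
    and R: "7/8 \<le> x1\<^sup>2 + x2\<^sup>2 + x3\<^sup>2 + x4\<^sup>2 + x5\<^sup>2 + x6\<^sup>2 + 2 * t\<^sup>2"
  shows "x1 = 1/4 \<and> x2 = 1/4 \<and> x3 = 1/4 \<and> x4 = 1/4 \<and> x5 = 1/4 \<and> x6 = 1/4 \<and> t = 1/2"
proof -
  define y1 where "y1 = (x1 - x2 - x3 - x4 - x5 - x6) / 2 + t"
  define y2 where "y2 = x1 + x2"
  define y3 where "y3 = x2 - x1"
  define y4 where "y4 = x3 - x2"
  define y5 where "y5 = x4 - x3"
  define y6 where "y6 = x5 - x4"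
  define y7 where "y7 = x6 - x5"
  note yd = y1_def y2_def y3_def y4_def y5_def y6_def y7_def
  have y0: "0 \<le> y1" "0 \<le> y2" "0 \<le> y3" "0 \<le> y4" "0 \<le> y5" "0 \<le> y6" "0 \<le> y7"
    using y by (simp_all add: yd field_simps)
  define w1 where "w1 = 7/4 - 2 * t"
  define w2 where "w2 = 7/4 - ((x1 + x2 + x3 + x4 + x5 + x6) / 2 + 2 * t)"
  define w3 where "w3 = 21/8 - ((- x1 + x2 + x3 + x4 + x5 + x6) / 2 + 3 * t)"
  define w4 where "w4 = 7/2 - (x3 + x4 + x5 + x6 + 4 * t)"
  define w5 where "w5 = 21/8 - (x4 + x5 + x6 + 3 * t)"
  define w6 where "w6 = 7/4 - (x5 + x6 + 2 * t)"
  define w7 where "w7 = 7/8 - (x6 + t)"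
  note wd = w1_def w2_def w3_def w4_def w5_def w6_def w7_def
  have rel: "2 * y1 + 2 * y2 + 3 * y3 + 4 * y4 + 3 * y5 + 2 * y6 + y7 = 2 * t"
    by (simp add: yd field_simps)
  \<comment> \<open>The lower bounds spread along the Dynkin diagram from its ends \<alpha>7 and
    \<alpha>1; each relation is a row of the Cartan matrix.\<close>
  have w0: "1/8 \<le> w7" "1/4 \<le> w6" "3/8 \<le> w5" "1/2 \<le> w4" "5/8 \<le> w3" "3/4 \<le> w1"
  proof -
    show 7: "1/8 \<le> w7" using w by (simp add: w7_def)
    have e6: "w6 = 2 * w7 + y7" by (simp add: wd yd field_simps)
    then show "1/4 \<le> w6" using 7 y0 by linarith
    have e5: "w5 = 3 * w7 + 2 * y7 + y6" by (simp add: wd yd field_simps)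
    then show "3/8 \<le> w5" using 7 y0 by linarith
    have e4: "w4 = 4 * w7 + 3 * y7 + 2 * y6 + y5" by (simp add: wd yd field_simps)
    then show "1/2 \<le> w4" using 7 y0 by linarith
    show 1: "3/4 \<le> w1" using t by (simp add: w1_def)
    have "w3 = 2 * w1 + y1 - 7/8" by (simp add: wd yd field_simps)
    then show "5/8 \<le> w3" using 1 y0 by linarith
  qed
  have e2: "w2 = (w4 - y2) / 2" by (simp add: wd yd field_simps)
  have y2: "y2 \<le> 1/2" using rel y0 t by linarith
  have w2: "0 \<le> w2" using e2 w0(4) y2 by simp
  have id: "7/8 * (2 * t) - (x1\<^sup>2 + x2\<^sup>2 + x3\<^sup>2 + x4\<^sup>2 + x5\<^sup>2 + x6\<^sup>2 + 2 * t\<^sup>2)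
      = y1 * w1 + y2 * w2 + y3 * w3 + y4 * w4 + y5 * w5 + y6 * w6 + y7 * w7"
    by (simp add: yd wd power2_eq_square field_simps)
  have p: "0 \<le> y1 * w1" "0 \<le> y2 * w2" "0 \<le> y3 * w3" "0 \<le> y4 * w4" "0 \<le> y5 * w5" "0 \<le> y6 * w6" "0 \<le> y7 * w7"
    using y0 w0 w2 by (auto intro!: mult_nonneg_nonneg)
  have z: "y1 * w1 = 0" "y3 * w3 = 0" "y4 * w4 = 0" "y5 * w5 = 0" "y6 * w6 = 0" "y7 * w7 = 0" "2 * t = 1"
    using id p R t by linarith+
  have z0: "y1 = 0" "y3 = 0" "y4 = 0" "y5 = 0" "y6 = 0" "y7 = 0"
    using z w0 by auto
  then have "y2 = 1/2" using rel z(7) by simp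
  then show ?thesis using z0 z(7) by (simp add: yd)
qed

text \<open>Multiplied by 16, the squared distance is a sum of six odd squares and 8 (l - 1)^2. If l
  differs from 1 this is at least 6 + 8. If l = 1, the pairing with \<alpha>1 forbids all six
  squares to be 1, and 5 + 9 = 14 as well.\<close>

lemma E7_hole_far:
  assumes "x \<in> dual_lattice E7_lattice"
  shows "7/8 \<le> (norm (x - E7_hole))\<^sup>2"
proof -
  have x7: "x $ 7 = - x $ 8" and xv: "\<And>v. v \<in> E7_roots \<Longrightarrow> x \<bullet> v \<in> \<int>"
    using assms by (auto simp: dual_E7_eq)
  have "x \<bullet> \<alpha>2 \<in> \<int>" "x \<bullet> \<alpha>3 \<in> \<int>" "x \<bullet> \<alpha>4 \<in> \<int>" "x \<bullet> \<alpha>5 \<in> \<int>" "x \<bullet> \<alpha>6 \<in> \<int>" "x \<bullet> \<alpha>7 \<in> \<int>" "x \<bullet> \<theta>7 \<in> \<int>" "x \<bullet> \<alpha>1 \<in> \<int>"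
    by (rule xv, rule simple_roots_E7)+
  then obtain a2 a3 a4 a5 a6 a7 l a1 :: int where a:
    "x $ 1 + x $ 2 = a2" "x $ 2 - x $ 1 = a3" "x $ 3 - x $ 2 = a4" "x $ 4 - x $ 3 = a5" "x $ 5 - x $ 4 = a6" "x $ 6 - x $ 5 = a7"
    "x $ 8 - x $ 7 = l" "x $ 1 / 2 - x $ 2 / 2 - x $ 3 / 2 - x $ 4 / 2 - x $ 5 / 2 - x $ 6 / 2 - x $ 7 / 2 + x $ 8 / 2 = a1"
    by (auto simp: inner_8 elim!: Ints_cases)
  define k where "k = a2 - a3"
  define m2 m3 m4 m5 m6 where "m2 = a3" and "m3 = m2 + a4" and "m4 = m3 + a5" and "m5 = m4 + a6" and "m6 = m5 + a7"
  have x: "x $ 1 = k / 2" "x $ 2 = k / 2 + m2" "x $ 3 = k / 2 + m3" "x $ 4 = k / 2 + m4" "x $ 5 = k / 2 + m5"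
    "x $ 6 = k / 2 + m6" "x $ 8 = l / 2" "x $ 7 = - l / 2"
    using a x7 by (auto simp: k_def m2_def m3_def m4_def m5_def m6_def field_simps)
  have "real_of_int (2 * a1) = of_int (l - (m2 + m3 + m4 + m5 + m6) - 2 * k)"
    using a(8) by (simp add: x field_simps)
  then have par: "2 * a1 = l - (m2 + m3 + m4 + m5 + m6) - 2 * k" by (simp only: of_int_eq_iff)
  define Q where "Q = (\<lambda>j. (2 * k + 4 * j - 1)\<^sup>2)"
  have Q1: "1 \<le> Q j" for j
  proof -
    have "1 \<le> \<bar>2 * k + 4 * j - 1\<bar>" by presburger
    then have "1\<^sup>2 \<le> \<bar>2 * k + 4 * j - 1\<bar>\<^sup>2" by (rule power_mono) simp
    then show ?thesis by (simp add: Q_def)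
  qed
  have Q9: "9 \<le> Q j" if "k + 2 * j \<noteq> 0" "k + 2 * j \<noteq> 1" for j
  proof -
    have "3 \<le> \<bar>2 * k + 4 * j - 1\<bar>" using that by presburger
    then have "3\<^sup>2 \<le> \<bar>2 * k + 4 * j - 1\<bar>\<^sup>2" by (rule power_mono) simp
    then show ?thesis by (simp add: Q_def)
  qed
  have "14 \<le> Q 0 + Q m2 + Q m3 + Q m4 + Q m5 + Q m6 + 8 * (l - 1)\<^sup>2"
  proof (cases "l = 1")
    case False
    then have "1 \<le> \<bar>l - 1\<bar>" by presburger
    then have "1\<^sup>2 \<le> \<bar>l - 1\<bar>\<^sup>2" by (rule power_mono) simp
    then have "1 \<le> (l - 1)\<^sup>2" by simp
    then show ?thesis using Q1[of 0] Q1[of m2] Q1[of m3] Q1[of m4] Q1[of m5] Q1[of m6] by linarith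
  next
    case True
    have "\<exists>j\<in>{0, m2, m3, m4, m5, m6}. k + 2 * j \<noteq> 0 \<and> k + 2 * j \<noteq> 1"
    proof (rule ccontr)
      assume "\<not> ?thesis"
      then have "k = 0 \<or> k = 1" "k + 2 * m2 = 0 \<or> k + 2 * m2 = 1" "k + 2 * m3 = 0 \<or> k + 2 * m3 = 1"
        "k + 2 * m4 = 0 \<or> k + 2 * m4 = 1" "k + 2 * m5 = 0 \<or> k + 2 * m5 = 1" "k + 2 * m6 = 0 \<or> k + 2 * m6 = 1"
        by auto
      then have "m2 = 0" "m3 = 0" "m4 = 0" "m5 = 0" "m6 = 0" by presburger+
      then show False using par True by presburger
    qed
    then show ?thesis
      using Q9 Q1[of 0] Q1[of m2] Q1[of m3] Q1[of m4] Q1[of m5] Q1[of m6] True by fastforce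
  qed
  then have "real_of_int 14 \<le> of_int (Q 0 + Q m2 + Q m3 + Q m4 + Q m5 + Q m6 + 8 * (l - 1)\<^sup>2)"
    by (simp only: of_int_le_iff)
  moreover have "16 * (norm (x - E7_hole))\<^sup>2 = of_int (Q 0 + Q m2 + Q m3 + Q m4 + Q m5 + Q m6 + 8 * (l - 1)\<^sup>2)"
    unfolding norm_sq_8 by (simp add: x Q_def power2_eq_square field_simps)
  ultimately show ?thesis by simp
qed

theorem dual_E7_deep_holes_stable:
  assumes "deep_hole (dual_lattice E7_lattice) c"
  shows "stable_cold_spot (dual_lattice E7_lattice) c"
proof (rule deep_holes_stable_central[OF discrete_subgroup_dual_E7 _ _ _ _ assms])
  let ?L = "dual_lattice E7_lattice"
  have e: "2 *\<^sub>R E7_hole = v8 (1/2) (1/2) (1/2) (1/2) (1/2) (1/2) (-1) 1"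
    by (simp add: vec_eq_iff forall_8)
  show "2 *\<^sub>R E7_hole \<in> ?L" unfolding e by (rule E7_dual_members)
  show "sqrt (7/8) \<le> norm (x - E7_hole)" if "x \<in> ?L" for x
    using E7_hole_far[OF that] by (intro real_le_lsqrt) auto
  have "norm (0 - E7_hole) \<le> sqrt (7/8)"
    by (simp add: norm_eq_sqrt_inner inner_8)
  then show "\<exists>x\<in>?L. norm (x - E7_hole) \<le> sqrt (7/8)"
    using discrete_subgroup_zero[OF discrete_subgroup_dual_E7] by blast
  show "(\<exists>x\<in>?L. norm (x - z) < sqrt (7/8)) \<or> lattice_equiv ?L z E7_hole" if z: "z \<in> span ?L" for z
  proof -
    let ?S = "{\<alpha>1, \<alpha>2, \<alpha>3, \<alpha>4, \<alpha>5, \<alpha>6, \<alpha>7}"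
    have root: "lattice_root ?L a" if "a \<in> ?S" for a
    proof -
      have "a \<in> E7_roots" using that simple_roots_E7 by blast
      moreover have "a \<in> ?L" using that E7_dual_members by blast
      ultimately show ?thesis
        unfolding lattice_root_def by (auto simp: E7_roots_def E8_roots_norm dual_E7_eq)
    qed
    have pos: "0 < v8 0 1 2 3 4 5 (-17/2) (17/2) \<bullet> a" if "a \<in> ?S" for a
      using that by (auto simp: inner_8)
    have "\<exists>w x. lattice_equiv ?L z w \<and> x \<in> ?L \<and> norm (x - z) = norm w \<and> (\<forall>a\<in>?S. 0 \<le> w \<bullet> a) \<and>
      (\<forall>y\<in>?L. w \<bullet> y \<le> (y \<bullet> y) / 2)"
      by (rule exists_dominant_voronoi[OF discrete_subgroup_dual_E7 E7_dual_members(9) root pos, where z = z]) blast+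
    then obtain w x where w: "lattice_equiv ?L z w" "x \<in> ?L" "norm (x - z) = norm w"
      "\<And>a. a \<in> ?S \<Longrightarrow> 0 \<le> w \<bullet> a" "\<And>y. y \<in> ?L \<Longrightarrow> w \<bullet> y \<le> (y \<bullet> y) / 2" by blast
    have w7: "w $ 7 = - w $ 8"
    proof -
      have "w \<in> span ?L" by (rule lattice_equiv_span[OF w(1) z])
      moreover have "subspace {x :: real ^ 8. x $ 7 = - x $ 8}" by (simp add: subspace_def)
      then have "span ?L \<subseteq> {x. x $ 7 = - x $ 8}"
        by (intro span_minimal) (auto simp: dual_E7_eq)
      ultimately show ?thesis by blast
    qed
    show ?thesis
    proof (cases "norm w < sqrt (7/8)")
      case True
      then show ?thesis using w(2,3) by metis
    next
      case False
      have "7/8 \<le> (norm w)\<^sup>2" using False by (metis not_less real_sqrt_le_iff real_sqrt_abs abs_norm_cancel)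
      then have n: "7/8 \<le> (w $ 1)\<^sup>2 + (w $ 2)\<^sup>2 + (w $ 3)\<^sup>2 + (w $ 4)\<^sup>2 + (w $ 5)\<^sup>2 + (w $ 6)\<^sup>2 + 2 * (w $ 8)\<^sup>2"
        unfolding norm_sq_8 by (simp add: w7)
      have t: "2 * w $ 8 \<le> 1" using w(5)[OF E7_dual_members(8)] by (simp add: inner_8 w7)
      have o: "w $ 6 + w $ 8 \<le> 3/4" using w(5)[OF E7_dual_members(11)] by (simp add: inner_8 w7)
      have "0 \<le> w \<bullet> \<alpha>1" "0 \<le> w \<bullet> \<alpha>2" "0 \<le> w \<bullet> \<alpha>3" "0 \<le> w \<bullet> \<alpha>4" "0 \<le> w \<bullet> \<alpha>5" "0 \<le> w \<bullet> \<alpha>6" "0 \<le> w \<bullet> \<alpha>7"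
        using w(4) by simp_all
      then have "w $ 1 = 1/4 \<and> w $ 2 = 1/4 \<and> w $ 3 = 1/4 \<and> w $ 4 = 1/4 \<and> w $ 5 = 1/4 \<and> w $ 6 = 1/4 \<and> w $ 8 = 1/2"
        by (intro E7_alcove[OF _ _ _ _ _ _ _ t o n]) (simp_all add: inner_8 w7 field_simps)
      then have "w = E7_hole" by (simp add: vec_eq_iff forall_8 w7)
      then show ?thesis using w(1) by simp
    qed
  qed
qed

subsection \<open>\<open>E\<^sub>6\<^sup>*\<close>\<close>

abbreviation "\<theta>6 \<equiv> v8 (1/2) (1/2) (1/2) (1/2) (1/2) (-1/2) (-1/2) (1/2)"

lemma simple_roots_E6:
  "\<alpha>1 \<in> E6_roots" "\<alpha>2 \<in> E6_roots" "\<alpha>3 \<in> E6_roots" "\<alpha>4 \<in> E6_roots" "\<alpha>5 \<in> E6_roots" "\<alpha>6 \<in> E6_roots"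
  "\<theta>6 \<in> E6_roots"
  by (simp_all add: E6_roots_def E8_root_simps)

lemma span_E6_roots: "span E6_roots = {x. x $ 6 = x $ 7 \<and> x $ 7 = - x $ 8}"
proof
  have "subspace {x :: real ^ 8. x $ 6 = x $ 7 \<and> x $ 7 = - x $ 8}" by (simp add: subspace_def)
  then show "span E6_roots \<subseteq> {x. x $ 6 = x $ 7 \<and> x $ 7 = - x $ 8}"
    by (intro span_minimal) (auto simp: E6_roots_def)
  show "{x. x $ 6 = x $ 7 \<and> x $ 7 = - x $ 8} \<subseteq> span E6_roots"
  proof
    fix x :: "real ^ 8" assume x: "x \<in> {x. x $ 6 = x $ 7 \<and> x $ 7 = - x $ 8}"
    let ?t = "x $ 8"
    have "(2 * ?t) *\<^sub>R \<alpha>1 + ((x $ 1 + x $ 2 + x $ 3 + x $ 4 + x $ 5) / 2 + 3 / 2 * ?t) *\<^sub>R \<alpha>2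
      + ((- x $ 1 + x $ 2 + x $ 3 + x $ 4 + x $ 5) / 2 + 5 / 2 * ?t) *\<^sub>R \<alpha>3
      + (x $ 3 + x $ 4 + x $ 5 + 3 * ?t) *\<^sub>R \<alpha>4 + (x $ 4 + x $ 5 + 2 * ?t) *\<^sub>R \<alpha>5
      + (x $ 5 + ?t) *\<^sub>R \<alpha>6 \<in> span E6_roots"
      by (intro span_add span_scale span_base simple_roots_E6)
    also have "(2 * ?t) *\<^sub>R \<alpha>1 + ((x $ 1 + x $ 2 + x $ 3 + x $ 4 + x $ 5) / 2 + 3 / 2 * ?t) *\<^sub>R \<alpha>2
      + ((- x $ 1 + x $ 2 + x $ 3 + x $ 4 + x $ 5) / 2 + 5 / 2 * ?t) *\<^sub>R \<alpha>3
      + (x $ 3 + x $ 4 + x $ 5 + 3 * ?t) *\<^sub>R \<alpha>4 + (x $ 4 + x $ 5 + 2 * ?t) *\<^sub>R \<alpha>5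
      + (x $ 5 + ?t) *\<^sub>R \<alpha>6 = x"
      using x by (simp add: vec_eq_iff forall_8 field_simps)
    finally show "x \<in> span E6_roots" .
  qed
qed

lemma dual_E6_eq:
  "dual_lattice E6_lattice = {x. x $ 6 = x $ 7 \<and> x $ 7 = - x $ 8 \<and> (\<forall>v\<in>E6_roots. x \<bullet> v \<in> \<int>)}"
  by (auto simp: E6_lattice_def dual_lattice_group_closure span_E6_roots)

lemma discrete_subgroup_dual_E6: "discrete_subgroup (dual_lattice E6_lattice)"
  unfolding E6_lattice_def dual_lattice_group_closure
  by (rule discrete_subgroup_dual) (auto simp: E6_roots_def E8_roots_norm)

text \<open>The last three vectors are the Weyl vector and the two minuscule weights, those of
  \<alpha>1 and \<alpha>6, of squared norm 4/3.\<close>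

lemma E6_dual_members:
  "\<alpha>1 \<in> dual_lattice E6_lattice" "\<alpha>2 \<in> dual_lattice E6_lattice" "\<alpha>3 \<in> dual_lattice E6_lattice"
  "\<alpha>4 \<in> dual_lattice E6_lattice" "\<alpha>5 \<in> dual_lattice E6_lattice" "\<alpha>6 \<in> dual_lattice E6_lattice"
  "\<theta>6 \<in> dual_lattice E6_lattice"
  "v8 0 1 2 3 4 (-4) (-4) 4 \<in> dual_lattice E6_lattice"
  "v8 0 0 0 0 0 (-2/3) (-2/3) (2/3) \<in> dual_lattice E6_lattice"
  "v8 0 0 0 0 1 (-1/3) (-1/3) (1/3) \<in> dual_lattice E6_lattice"
proof -
  have *: "x \<in> dual_lattice E6_lattice" if "x $ 6 = x $ 7" "x $ 7 = - x $ 8"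
    "\<And>h s m. h = - m 7 - m 8 \<Longrightarrow> x \<bullet> v8 (of_int h / 2 + (2 * of_int s - of_int (m 2) - of_int (m 3) - of_int (m 4)
        - of_int (m 5) - of_int (m 7) - of_int (m 7) - of_int (m 8)))
       (of_int h / 2 + of_int (m 2)) (of_int h / 2 + of_int (m 3)) (of_int h / 2 + of_int (m 4)) (of_int h / 2 + of_int (m 5))
       (of_int h / 2 + of_int (m 7)) (of_int h / 2 + of_int (m 7)) (of_int h / 2 + of_int (m 8)) = of_int (f h s m)"
    for x and f :: "int \<Rightarrow> int \<Rightarrow> (8 \<Rightarrow> int) \<Rightarrow> int"
    unfolding dual_E6_eq mem_Collect_eq
  proof (intro conjI ballI)
    fix v assume "v \<in> E6_roots"
    then obtain h s :: int and m :: "8 \<Rightarrow> int" where m: "\<And>i. v $ i = of_int h / 2 + of_int (m i)"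
      "m 1 = 2 * s - m 2 - m 3 - m 4 - m 5 - m 6 - m 7 - m 8" "h = - m 7 - m 8" "m 6 = m 7"
      by (rule E6_root_coords) blast
    have "x \<bullet> v8 (v $ 1) (v $ 2) (v $ 3) (v $ 4) (v $ 5) (v $ 6) (v $ 7) (v $ 8) = of_int (f h s m)"
      using that(3)[OF m(3), of s] by (simp only: m(1,2,4) of_int_diff of_int_mult of_int_numeral)
    then show "x \<bullet> v \<in> \<int>" by (simp add: v8_eta)
  qed (fact that(1,2))+
  show "\<alpha>1 \<in> dual_lattice E6_lattice"
    by (rule *[where f = "\<lambda>h s m. s - (m 2 + m 3 + m 4 + m 5 + 2 * m 7) - h"]) (simp_all add: inner_8 field_simps)
  show "\<alpha>2 \<in> dual_lattice E6_lattice"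
    by (rule *[where f = "\<lambda>h s m. h + 2 * s - m 3 - m 4 - m 5 - 2 * m 7 - m 8"]) (simp_all add: inner_8 field_simps)
  show "\<alpha>3 \<in> dual_lattice E6_lattice"
    by (rule *[where f = "\<lambda>h s m. 2 * m 2 - 2 * s + m 3 + m 4 + m 5 + 2 * m 7 + m 8"]) (simp_all add: inner_8 field_simps)
  show "\<alpha>4 \<in> dual_lattice E6_lattice"
    by (rule *[where f = "\<lambda>h s m. m 3 - m 2"]) (simp_all add: inner_8 field_simps)
  show "\<alpha>5 \<in> dual_lattice E6_lattice"
    by (rule *[where f = "\<lambda>h s m. m 4 - m 3"]) (simp_all add: inner_8 field_simps)
  show "\<alpha>6 \<in> dual_lattice E6_lattice"
    by (rule *[where f = "\<lambda>h s m. m 5 - m 4"]) (simp_all add: inner_8 field_simps)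
  show "\<theta>6 \<in> dual_lattice E6_lattice"
    by (rule *[where f = "\<lambda>h s m. 3 * h + s + 2 * m 8"]) (simp_all add: inner_8 field_simps)
  show "v8 0 1 2 3 4 (-4) (-4) 4 \<in> dual_lattice E6_lattice"
    by (rule *[where f = "\<lambda>h s m. 11 * h + m 2 + 2 * m 3 + 3 * m 4 + 4 * m 5 + 12 * m 8"]) (simp_all add: inner_8 field_simps)
  show "v8 0 0 0 0 0 (-2/3) (-2/3) (2/3) \<in> dual_lattice E6_lattice"
    by (rule *[where f = "\<lambda>h s m. h + 2 * m 8"]) (simp_all add: inner_8 field_simps)
  show "v8 0 0 0 0 1 (-1/3) (-1/3) (1/3) \<in> dual_lattice E6_lattice"
    by (rule *[where f = "\<lambda>h s m. h + m 5 + m 8"]) (simp_all add: inner_8 field_simps)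
qed

text \<open>One third of the fundamental weight of \<alpha>4, the branch node, whose coefficient in
  the highest root is 3.\<close>

abbreviation "E6_hole \<equiv> v8 0 0 (1/3) (1/3) (1/3) (-1/3) (-1/3) (1/3)"

text \<open>The identity of \<open>E7_alcove\<close> with squared radius 2/3 and coefficients 1, 2,
  2, 3, 2, 1. The highest root of \<open>E_6\<close> is the fundamental weight of \<alpha>2, so its
  pairing is \<open>4/3 - w2\<close>. Here several w_i can vanish at the hole, and the equality case
  uses the Cartan relations as well.\<close>

lemma E6_alcove:
  fixes x1 x2 x3 x4 x5 t :: real
  assumes y: "0 \<le> x1 - x2 - x3 - x4 - x5 + 3 * t" "0 \<le> x1 + x2" "0 \<le> x2 - x1" "0 \<le> x3 - x2"
    "0 \<le> x4 - x3" "0 \<le> x5 - x4" and \<theta>: "x1 + x2 + x3 + x4 + x5 + 3 * t \<le> 2"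
    and w: "2 * t \<le> 2/3" "x5 + t \<le> 2/3"
    and R: "2/3 \<le> x1\<^sup>2 + x2\<^sup>2 + x3\<^sup>2 + x4\<^sup>2 + x5\<^sup>2 + 3 * t\<^sup>2"
  shows "x1 = 0 \<and> x2 = 0 \<and> x3 = 1/3 \<and> x4 = 1/3 \<and> x5 = 1/3 \<and> t = 1/3"
proof -
  define y1 where "y1 = (x1 - x2 - x3 - x4 - x5 + 3 * t) / 2"
  define y2 where "y2 = x1 + x2"
  define y3 where "y3 = x2 - x1"
  define y4 where "y4 = x3 - x2"
  define y5 where "y5 = x4 - x3"
  define y6 where "y6 = x5 - x4"
  note yd = y1_def y2_def y3_def y4_def y5_def y6_def
  have y0: "0 \<le> y1" "0 \<le> y2" "0 \<le> y3" "0 \<le> y4" "0 \<le> y5" "0 \<le> y6"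
    using y by (simp_all add: yd field_simps)
  define w1 where "w1 = 2/3 - 2 * t"
  define w2 where "w2 = 4/3 - (x1 + x2 + x3 + x4 + x5 + 3 * t) / 2"
  define w3 where "w3 = 4/3 - (- x1 + x2 + x3 + x4 + x5 + 5 * t) / 2"
  define w4 where "w4 = 2 - (x3 + x4 + x5 + 3 * t)"
  define w5 where "w5 = 4/3 - (x4 + x5 + 2 * t)"
  define w6 where "w6 = 2/3 - (x5 + t)"
  note wd = w1_def w2_def w3_def w4_def w5_def w6_def
  have rel: "y1 + 2 * y2 + 2 * y3 + 3 * y4 + 2 * y5 + y6 = 4/3 - w2"
    by (simp add: yd wd field_simps)
  have e: "w3 = 2 * w1 + y1" "w5 = 2 * w6 + y6" "w4 = 3 * w1 + 2 * y1 + y3" "w4 = 3 * w6 + 2 * y6 + y5"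
    "2 * w2 = w4 - y2 + 2/3"
    by (simp_all add: wd yd field_simps)
  have w0: "0 \<le> w1" "1/3 \<le> w2" "0 \<le> w6" using \<theta> w by (simp_all add: wd field_simps)
  have w0': "0 \<le> w3" "0 \<le> w4" "0 \<le> w5" using w0 e y0 by linarith+
  have id: "8/9 - 2/3 * w2 - (x1\<^sup>2 + x2\<^sup>2 + x3\<^sup>2 + x4\<^sup>2 + x5\<^sup>2 + 3 * t\<^sup>2)
      = y1 * w1 + y2 * w2 + y3 * w3 + y4 * w4 + y5 * w5 + y6 * w6"
    by (simp add: yd wd power2_eq_square field_simps)
  have p: "0 \<le> y1 * w1" "0 \<le> y2 * w2" "0 \<le> y3 * w3" "0 \<le> y4 * w4" "0 \<le> y5 * w5" "0 \<le> y6 * w6"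
    using y0 w0 w0' by (auto intro!: mult_nonneg_nonneg)
  have w2: "w2 = 1/3" using id p R w0(2) by linarith
  have z: "y1 * w1 = 0" "y2 * w2 = 0" "y3 * w3 = 0" "y4 * w4 = 0" "y5 * w5 = 0" "y6 * w6 = 0"
    using id p R w2 by linarith+
  have y2: "y2 = 0" using z(2) w2 by simp
  have "y4 \<noteq> 0"
  proof
    assume "y4 = 0"
    \<comment> \<open>\<open>w4 = 0\<close> by the last relation, which kills \<open>y1\<close>, \<open>y3\<close>, \<open>y5\<close> and \<open>y6\<close>.\<close>
    have "w4 = 0" using e(5) w2 y2 by simp
    then have "y1 = 0" "y3 = 0" "y5 = 0" "y6 = 0" using e(3,4) w0 y0 by linarith+
    then show False using rel w2 y2 \<open>y4 = 0\<close> by simp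
  qed
  then have "w4 = 0" using z(4) by simp
  then have "y1 = 0" "y3 = 0" "y5 = 0" "y6 = 0" "w1 = 0" using e(3,4) w0 y0 by linarith+
  then have "t = 1/3" "y4 = 1/3" using rel w2 y2 by (simp_all add: w1_def)
  then show ?thesis using \<open>y1 = 0\<close> \<open>y3 = 0\<close> \<open>y5 = 0\<close> \<open>y6 = 0\<close> y2 by (simp add: yd)
qed

text \<open>The squared distance is multiplied by 36. For odd \<open>k\<close> every square is odd,
  giving 9 + 9 + 1 + 1 + 1 + 3 = 24. For even \<open>k\<close> the three \<open>C\<close> are even
  and nonzero; the missing 12 come from \<open>D\<close>, from a larger \<open>C\<close>, or from
  one of the first two squares, which then gives 36 alone.\<close>

lemma E6_hole_far:
  assumes "x \<in> dual_lattice E6_lattice"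
  shows "2/3 \<le> (norm (x - E6_hole))\<^sup>2"
proof -
  have x67: "x $ 6 = - x $ 8" "x $ 7 = - x $ 8" and xv: "\<And>v. v \<in> E6_roots \<Longrightarrow> x \<bullet> v \<in> \<int>"
    using assms by (auto simp: dual_E6_eq)
  have "x \<bullet> \<alpha>2 \<in> \<int>" "x \<bullet> \<alpha>3 \<in> \<int>" "x \<bullet> \<alpha>4 \<in> \<int>" "x \<bullet> \<alpha>5 \<in> \<int>" "x \<bullet> \<alpha>6 \<in> \<int>" "x \<bullet> \<alpha>1 \<in> \<int>"
    by (rule xv, rule simple_roots_E6)+
  then obtain a2 a3 a4 a5 a6 j :: int where a:
    "x $ 1 + x $ 2 = a2" "x $ 2 - x $ 1 = a3" "x $ 3 - x $ 2 = a4" "x $ 4 - x $ 3 = a5" "x $ 5 - x $ 4 = a6"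
    "x $ 1 / 2 - x $ 2 / 2 - x $ 3 / 2 - x $ 4 / 2 - x $ 5 / 2 - x $ 6 / 2 - x $ 7 / 2 + x $ 8 / 2 = j"
    by (auto simp: inner_8 elim!: Ints_cases)
  define k where "k = a2 - a3"
  define m2 m3 m4 m5 where "m2 = a3" and "m3 = m2 + a4" and "m4 = m3 + a5" and "m5 = m4 + a6"
  have x: "x $ 1 = k / 2" "x $ 2 = k / 2 + m2" "x $ 3 = k / 2 + m3" "x $ 4 = k / 2 + m4" "x $ 5 = k / 2 + m5"
    using a by (auto simp: k_def m2_def m3_def m4_def m5_def field_simps)
  define D where "D = 4 * j + 2 * (m2 + m3 + m4 + m5) + 3 * k - 2"
  have t: "x $ 8 = (D + 2) / 6" using a(6) by (simp add: x x67 D_def field_simps)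
  define C where "C = (\<lambda>m. 3 * k + 6 * m - 2)"
  have sq: "c * c \<le> y\<^sup>2" if "c \<le> \<bar>y\<bar>" "0 \<le> c" for c y :: int
    using power_mono[OF that, of 2] by (simp add: power2_eq_square)
  have "24 \<le> 9 * k\<^sup>2 + 9 * (k + 2 * m2)\<^sup>2 + (C m3)\<^sup>2 + (C m4)\<^sup>2 + (C m5)\<^sup>2 + 3 * D\<^sup>2"
  proof (cases "odd k")
    case True
    have "1 \<le> \<bar>k\<bar>" "1 \<le> \<bar>k + 2 * m2\<bar>" "1 \<le> \<bar>C m3\<bar>" "1 \<le> \<bar>C m4\<bar>" "1 \<le> \<bar>C m5\<bar>" "1 \<le> \<bar>D\<bar>"
      using True unfolding C_def D_def by presburger+
    from this[THEN sq] show ?thesis by simp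
  next
    case False
    have C2: "2 \<le> \<bar>C m\<bar>" for m using False unfolding C_def by presburger
    have C4: "4 \<le> \<bar>C m\<bar>" if "k = 0" "m \<noteq> 0" for m using that unfolding C_def by presburger
    note c = sq[OF C2, simplified]
    show ?thesis
    proof (cases "D = 0")
      case D: False
      have "2 \<le> \<bar>D\<bar>" using D False unfolding D_def by presburger
      from sq[OF this] c[of m3] c[of m4] c[of m5]
      show ?thesis using zero_le_power2[of k] zero_le_power2[of "k + 2 * m2"] by linarith
    next
      case D: True
      show ?thesis
      proof (cases "k = 0 \<and> m2 = 0")
        case True
        then have "m3 \<noteq> 0 \<or> m4 \<noteq> 0 \<or> m5 \<noteq> 0" using D unfolding D_def by presburger
        then have "16 \<le> (C m3)\<^sup>2 \<or> 16 \<le> (C m4)\<^sup>2 \<or> 16 \<le> (C m5)\<^sup>2"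
          using sq[OF C4] True by fastforce
        then show ?thesis
          using c[of m3] c[of m4] c[of m5] zero_le_power2[of D] zero_le_power2[of k] zero_le_power2[of "k + 2 * m2"]
          by linarith
      next
        case k: False
        have "2 \<le> \<bar>k\<bar> \<or> 2 \<le> \<bar>k + 2 * m2\<bar>" using k False by presburger
        then have "4 \<le> k\<^sup>2 \<or> 4 \<le> (k + 2 * m2)\<^sup>2" using sq[of 2 k] sq[of 2 "k + 2 * m2"] by auto
        then show ?thesis
          using zero_le_power2[of "C m3"] zero_le_power2[of "C m4"] zero_le_power2[of "C m5"]
            zero_le_power2[of D] zero_le_power2[of k] zero_le_power2[of "k + 2 * m2"]
          by linarith
      qed
    qed
  qed
  then have "real_of_int 24 \<le> of_int (9 * k\<^sup>2 + 9 * (k + 2 * m2)\<^sup>2 + (C m3)\<^sup>2 + (C m4)\<^sup>2 + (C m5)\<^sup>2 + 3 * D\<^sup>2)"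
    by (simp only: of_int_le_iff)
  moreover have "36 * (norm (x - E6_hole))\<^sup>2
      = of_int (9 * k\<^sup>2 + 9 * (k + 2 * m2)\<^sup>2 + (C m3)\<^sup>2 + (C m4)\<^sup>2 + (C m5)\<^sup>2 + 3 * D\<^sup>2)"
    unfolding norm_sq_8 by (simp add: x x67 t C_def power2_eq_square field_simps)
  ultimately show ?thesis by simp
qed

definition rot :: "'a::real_inner \<Rightarrow> 'a \<Rightarrow> 'a \<Rightarrow> 'a" where
  "rot a b u = reflect a (reflect b u)"

lemma rot_eq:
  assumes "a \<bullet> b = - 1"
  shows "rot a b u = u - (u \<bullet> b) *\<^sub>R b - (u \<bullet> a + u \<bullet> b) *\<^sub>R a"
  using assms by (simp add: rot_def reflect_def inner_diff_left inner_commute[of b a])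

lemma rot_comp3:
  assumes ab: "a1 \<bullet> b1 = - 1" "a2 \<bullet> b2 = - 1" "a3 \<bullet> b3 = - 1"
    and orth: "a2 \<bullet> a1 = 0" "b2 \<bullet> a1 = 0" "a2 \<bullet> b1 = 0" "b2 \<bullet> b1 = 0"
      "a3 \<bullet> a1 = 0" "b3 \<bullet> a1 = 0" "a3 \<bullet> b1 = 0" "b3 \<bullet> b1 = 0"
      "a3 \<bullet> a2 = 0" "b3 \<bullet> a2 = 0" "a3 \<bullet> b2 = 0" "b3 \<bullet> b2 = 0"
  shows "rot a1 b1 (rot a2 b2 (rot a3 b3 u)) = u - (u \<bullet> b3) *\<^sub>R b3 - (u \<bullet> a3 + u \<bullet> b3) *\<^sub>R a3
    - (u \<bullet> b2) *\<^sub>R b2 - (u \<bullet> a2 + u \<bullet> b2) *\<^sub>R a2 - (u \<bullet> b1) *\<^sub>R b1 - (u \<bullet> a1 + u \<bullet> b1) *\<^sub>R a1"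
  unfolding rot_eq[OF ab(1)] rot_eq[OF ab(2)] rot_eq[OF ab(3)] by (simp add: inner_diff_left orth)

lemma norm_rot: "a \<bullet> a = 2 \<Longrightarrow> b \<bullet> b = 2 \<Longrightarrow> norm (rot a b u) = norm u"
  by (simp add: rot_def norm_reflect)

lemma lattice_equiv_rot:
  assumes L: "discrete_subgroup L" and "lattice_root L a" "lattice_root L b" "c \<bullet> a \<in> \<int>" "c \<bullet> b \<in> \<int>"
  shows "lattice_equiv L (c + u) (c + rot a b u)"
  unfolding rot_def
  by (rule lattice_equiv_trans[OF lattice_equiv_reflect_about[OF L assms(3,5)] lattice_equiv_reflect_about[OF L assms(2,4)]])

abbreviation "\<theta>6' \<equiv> v8 (-1/2) (-1/2) (-1/2) (-1/2) (-1/2) (1/2) (1/2) (-1/2)"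

definition rot6 :: "real ^ 8 \<Rightarrow> real ^ 8" where
  "rot6 u = rot \<alpha>1 \<alpha>3 (rot \<alpha>5 \<alpha>6 (rot \<alpha>2 \<theta>6' u))"

text \<open>The inverse of \<open>rot6\<close>: in each plane the two reflections are taken in the
  opposite order.\<close>

definition rot6' :: "real ^ 8 \<Rightarrow> real ^ 8" where
  "rot6' u = rot \<alpha>3 \<alpha>1 (rot \<alpha>6 \<alpha>5 (rot \<theta>6' \<alpha>2 u))"

text \<open>The roots \<open>\<alpha>1, \<alpha>3\<close>; \<open>\<alpha>5, \<alpha>6\<close>; \<open>\<alpha>2, - \<theta>6\<close> span three orthogonal planes (the
  \<open>A\<^sub>2\<^sup>3\<close> in \<open>E\<^sub>6\<close>), and \<open>rot6\<close> turns each by 120 degrees.\<close>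

lemma rot6_sum:
  assumes "u $ 6 = - u $ 8" "u $ 7 = - u $ 8"
  shows "u + rot6 u + rot6' u = 0"
proof -
  have "rot6 u = u - (u \<bullet> \<theta>6') *\<^sub>R \<theta>6' - (u \<bullet> \<alpha>2 + u \<bullet> \<theta>6') *\<^sub>R \<alpha>2
      - (u \<bullet> \<alpha>6) *\<^sub>R \<alpha>6 - (u \<bullet> \<alpha>5 + u \<bullet> \<alpha>6) *\<^sub>R \<alpha>5 - (u \<bullet> \<alpha>3) *\<^sub>R \<alpha>3 - (u \<bullet> \<alpha>1 + u \<bullet> \<alpha>3) *\<^sub>R \<alpha>1"
    unfolding rot6_def by (rule rot_comp3) (simp_all add: inner_8)
  moreover have "rot6' u = u - (u \<bullet> \<alpha>2) *\<^sub>R \<alpha>2 - (u \<bullet> \<theta>6' + u \<bullet> \<alpha>2) *\<^sub>R \<theta>6'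
      - (u \<bullet> \<alpha>5) *\<^sub>R \<alpha>5 - (u \<bullet> \<alpha>6 + u \<bullet> \<alpha>5) *\<^sub>R \<alpha>6 - (u \<bullet> \<alpha>1) *\<^sub>R \<alpha>1 - (u \<bullet> \<alpha>3 + u \<bullet> \<alpha>1) *\<^sub>R \<alpha>3"
    unfolding rot6'_def by (rule rot_comp3) (simp_all add: inner_8)
  ultimately show ?thesis
    using assms by (simp add: vec_eq_iff forall_8 inner_8 field_simps)
qed

theorem dual_E6_deep_holes_stable:
  assumes "deep_hole (dual_lattice E6_lattice) c"
  shows "stable_cold_spot (dual_lattice E6_lattice) c"
proof -
  let ?L = "dual_lattice E6_lattice"
  note L = discrete_subgroup_dual_E6
  have root: "lattice_root ?L a" if "a \<in> {\<alpha>1, \<alpha>2, \<alpha>3, \<alpha>4, \<alpha>5, \<alpha>6, \<theta>6}" for a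
  proof -
    have "a \<in> E6_roots" using that simple_roots_E6 by blast
    moreover have "a \<in> ?L" using that E6_dual_members by blast
    ultimately show ?thesis
      unfolding lattice_root_def by (auto simp: E6_roots_def E8_roots_norm dual_E6_eq)
  qed
  have \<theta>: "\<theta>6' = - \<theta>6" by (simp add: vec_eq_iff forall_8)
  have root': "lattice_root ?L \<theta>6'"
    using root[of \<theta>6] discrete_subgroup_minus[OF L] unfolding \<theta> by (simp add: lattice_root_def)
  have V: "u $ 6 = - u $ 8 \<and> u $ 7 = - u $ 8" if "u \<in> span ?L" for u
  proof -
    have "subspace {x :: real ^ 8. x $ 6 = - x $ 8 \<and> x $ 7 = - x $ 8}" by (simp add: subspace_def)
    then have "span ?L \<subseteq> {x. x $ 6 = - x $ 8 \<and> x $ 7 = - x $ 8}"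
      by (intro span_minimal) (auto simp: dual_E6_eq)
    then show ?thesis using that by blast
  qed
  show ?thesis
  proof (rule deep_holes_stable[OF L _ _ _ _ _ _ _ _ _ assms,
        where c = E6_hole and R = "sqrt (2/3)" and k = 3
          and g = "\<lambda>j u. if j = 0 then u else if j = 1 then rot6 u else rot6' u"])
    show "E6_hole \<in> span ?L"
    proof -
      \<comment> \<open>The fundamental weight of \<alpha>4 expanded in simple roots.\<close>
      have "2 *\<^sub>R \<alpha>1 + 3 *\<^sub>R \<alpha>2 + 4 *\<^sub>R \<alpha>3 + 6 *\<^sub>R \<alpha>4 + 4 *\<^sub>R \<alpha>5 + 2 *\<^sub>R \<alpha>6 \<in> span ?L"
        by (intro span_add span_scale span_base E6_dual_members)
      from span_scale[OF this, of "1/3"]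
      have "(1/3) *\<^sub>R (2 *\<^sub>R \<alpha>1 + 3 *\<^sub>R \<alpha>2 + 4 *\<^sub>R \<alpha>3 + 6 *\<^sub>R \<alpha>4 + 4 *\<^sub>R \<alpha>5 + 2 *\<^sub>R \<alpha>6) \<in> span ?L" .
      also have "(1/3) *\<^sub>R (2 *\<^sub>R \<alpha>1 + 3 *\<^sub>R \<alpha>2 + 4 *\<^sub>R \<alpha>3 + 6 *\<^sub>R \<alpha>4 + 4 *\<^sub>R \<alpha>5 + 2 *\<^sub>R \<alpha>6) = E6_hole"
        by (simp add: vec_eq_iff forall_8)
      finally show ?thesis .
    qed
    show "sqrt (2/3) \<le> norm (x - E6_hole)" if "x \<in> ?L" for x
      using E6_hole_far[OF that] by (intro real_le_lsqrt) auto
    have "norm (0 - E6_hole) \<le> sqrt (2/3)"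
      by (simp add: norm_eq_sqrt_inner inner_8)
    then show "\<exists>x\<in>?L. norm (x - E6_hole) \<le> sqrt (2/3)"
      using discrete_subgroup_zero[OF L] by blast
    show "(\<exists>x\<in>?L. norm (x - z) < sqrt (2/3)) \<or> lattice_equiv ?L z E6_hole" if z: "z \<in> span ?L" for z
    proof -
      let ?S = "{\<alpha>1, \<alpha>2, \<alpha>3, \<alpha>4, \<alpha>5, \<alpha>6}"
      have r: "lattice_root ?L a" if "a \<in> ?S" for a using that by (intro root) blast
      have pos: "0 < v8 0 1 2 3 4 (-4) (-4) 4 \<bullet> a" if "a \<in> ?S" for a
        using that by (auto simp: inner_8)
      have "\<exists>w x. lattice_equiv ?L z w \<and> x \<in> ?L \<and> norm (x - z) = norm w \<and> (\<forall>a\<in>?S. 0 \<le> w \<bullet> a) \<and>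
        (\<forall>y\<in>?L. w \<bullet> y \<le> (y \<bullet> y) / 2)"
        by (rule exists_dominant_voronoi[OF L E6_dual_members(8) r pos, where z = z]) blast+
      then obtain w x where w: "lattice_equiv ?L z w" "x \<in> ?L" "norm (x - z) = norm w"
        "\<And>a. a \<in> ?S \<Longrightarrow> 0 \<le> w \<bullet> a" "\<And>y. y \<in> ?L \<Longrightarrow> w \<bullet> y \<le> (y \<bullet> y) / 2" by blast
      have w67: "w $ 6 = - w $ 8" "w $ 7 = - w $ 8"
        using V lattice_equiv_span[OF w(1) z] by blast+
      show ?thesis
      proof (cases "norm w < sqrt (2/3)")
        case True
        then show ?thesis using w(2,3) by metis
      next
        case False
        have "2/3 \<le> (norm w)\<^sup>2" using False by (metis not_less real_sqrt_le_iff real_sqrt_abs abs_norm_cancel)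
        then have n: "2/3 \<le> (w $ 1)\<^sup>2 + (w $ 2)\<^sup>2 + (w $ 3)\<^sup>2 + (w $ 4)\<^sup>2 + (w $ 5)\<^sup>2 + 3 * (w $ 8)\<^sup>2"
          unfolding norm_sq_8 by (simp add: w67)
        have t: "w $ 1 + w $ 2 + w $ 3 + w $ 4 + w $ 5 + 3 * w $ 8 \<le> 2"
          using w(5)[OF E6_dual_members(7)] by (simp add: inner_8 w67 field_simps)
        have o1: "2 * w $ 8 \<le> 2/3" using w(5)[OF E6_dual_members(9)] by (simp add: inner_8 w67 field_simps)
        have o6: "w $ 5 + w $ 8 \<le> 2/3" using w(5)[OF E6_dual_members(10)] by (simp add: inner_8 w67 field_simps)
        have "0 \<le> w \<bullet> \<alpha>1" "0 \<le> w \<bullet> \<alpha>2" "0 \<le> w \<bullet> \<alpha>3" "0 \<le> w \<bullet> \<alpha>4" "0 \<le> w \<bullet> \<alpha>5" "0 \<le> w \<bullet> \<alpha>6"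
          using w(4) by simp_all
        then have "w $ 1 = 0 \<and> w $ 2 = 0 \<and> w $ 3 = 1/3 \<and> w $ 4 = 1/3 \<and> w $ 5 = 1/3 \<and> w $ 8 = 1/3"
          by (intro E6_alcove[OF _ _ _ _ _ _ t o1 o6 n]) (simp_all add: inner_8 w67 field_simps)
        then have "w = E6_hole" by (simp add: vec_eq_iff forall_8 w67)
        then show ?thesis using w(1) by simp
      qed
    qed
    have "norm (rot6 u) = norm u" "norm (rot6' u) = norm u" for u
      unfolding rot6_def rot6'_def by (simp_all add: norm_rot inner_8)
    then show "norm (if j = 0 then u else if j = 1 then rot6 u else rot6' u) = norm u" for j :: nat and u by simp
    \<comment> \<open>The hole pairs integrally with every node of the extended Dynkin diagram
      except \<alpha>4, which is why the rotations avoid \<alpha>4 and use the lowest root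
      instead.\<close>
    have i: "E6_hole \<bullet> \<alpha>1 \<in> \<int>" "E6_hole \<bullet> \<alpha>2 \<in> \<int>" "E6_hole \<bullet> \<alpha>3 \<in> \<int>" "E6_hole \<bullet> \<alpha>5 \<in> \<int>"
      "E6_hole \<bullet> \<alpha>6 \<in> \<int>" "E6_hole \<bullet> \<theta>6' \<in> \<int>"
      by (simp_all add: inner_8)
    have "lattice_equiv ?L (E6_hole + u) (E6_hole + rot6 u)" for u
      unfolding rot6_def
      by (rule lattice_equiv_trans[OF lattice_equiv_trans[OF lattice_equiv_rot[OF L] lattice_equiv_rot[OF L]] lattice_equiv_rot[OF L]])
        (use root root' i in \<open>blast intro: root\<close>)+
    moreover have "lattice_equiv ?L (E6_hole + u) (E6_hole + rot6' u)" for u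
      unfolding rot6'_def
      by (rule lattice_equiv_trans[OF lattice_equiv_trans[OF lattice_equiv_rot[OF L] lattice_equiv_rot[OF L]] lattice_equiv_rot[OF L]])
        (use root root' i in \<open>blast intro: root\<close>)+
    ultimately show "lattice_equiv ?L (E6_hole + u) (E6_hole + (if j = 0 then u else if j = 1 then rot6 u else rot6' u))"
      for j :: nat and u by (simp add: lattice_equiv_refl)
    show "(\<Sum>j<3::nat. if j = 0 then u else if j = 1 then rot6 u else rot6' u) = 0" if "u \<in> span ?L" for u
      using rot6_sum[of u] V[OF that] by (simp add: numeral_3_eq_3 add.assoc)
  qed auto
qed

subsection \<open>The Coxeter-Todd lattice\<close>

definition ec :: "real \<Rightarrow> real \<Rightarrow> complex" where
  "ec p q = of_real p + of_real q * \<omega>"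

lemma omega_eq: "\<omega> = Complex (- 1 / 2) (sqrt 3 / 2)"
proof -
  have "\<omega> = cis (2 * pi / 3)"
    by (simp add: \<omega>_def cis_conv_exp mult_ac)
  then show ?thesis by (simp add: complex_eq_iff cos_120 sin_120)
qed

lemma ec_simps: "Re (ec p q) = p - q / 2" "Im (ec p q) = q * sqrt 3 / 2"
  by (simp_all add: ec_def omega_eq)

lemma ec_eq_iff: "ec p q = ec p' q' \<longleftrightarrow> p = p' \<and> q = q'"
  by (auto simp: complex_eq_iff ec_simps)

lemma ec_surj: "\<exists>p q. z = ec p q"
  by (rule exI[of _ "Re z + Im z / sqrt 3"], rule exI[of _ "2 * Im z / sqrt 3"])
    (simp add: complex_eq_iff ec_simps)

lemma ec_add: "ec p q + ec p' q' = ec (p + p') (q + q')"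
  by (simp add: ec_def algebra_simps)

lemma ec_diff: "ec p q - ec p' q' = ec (p - p') (q - q')"
  by (simp add: ec_def algebra_simps)

lemma ec_minus: "- ec p q = ec (- p) (- q)"
  by (simp add: ec_def)

lemma ec_0: "ec 0 0 = 0"
  by (simp add: ec_def)

lemma ec_sum: "(\<Sum>i\<in>A. ec (f i) (g i)) = ec (\<Sum>i\<in>A. f i) (\<Sum>i\<in>A. g i)"
  by (simp add: ec_def sum.distrib sum_distrib_right)

lemma ec_scaleR: "r *\<^sub>R ec p q = ec (r * p) (r * q)"
  by (simp add: ec_def scaleR_conv_of_real algebra_simps)

lemma omega_ec: "\<omega> * ec p q = ec (- q) (p - q)"
  by (simp add: complex_eq_iff ec_simps omega_eq field_simps)

lemma theta_ec: "\<theta> * ec p q = ec (p - 2 * q) (2 * p - q)"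
  by (simp add: complex_eq_iff ec_simps \<theta>_def omega_eq field_simps)

lemma norm_ec: "(norm (ec p q))\<^sup>2 = p\<^sup>2 - p * q + q\<^sup>2"
  by (simp add: cmod_power2 ec_simps power2_diff power_mult_distrib power_divide)

lemma norm_omega_mult: "norm (\<omega> * z) = norm z"
  by (simp add: norm_mult \<omega>_def)

lemma eisenstein_integers_eq: "eisenstein_integers = {ec (of_int a) (of_int b) | a b. True}"
  by (simp add: eisenstein_integers_def ec_def)

lemma eisenstein_norm_ge_1:
  fixes a b :: int
  assumes "a \<noteq> 0 \<or> b \<noteq> 0"
  shows "1 \<le> a\<^sup>2 - a * b + b\<^sup>2"
proof -
  have "4 * (a\<^sup>2 - a * b + b\<^sup>2) = (2 * a - b)\<^sup>2 + 3 * b\<^sup>2" by (simp add: power2_eq_square algebra_simps)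
  moreover have "0 < (2 * a - b)\<^sup>2 + 3 * b\<^sup>2"
    using assms by (cases "b = 0") (auto intro: add_nonneg_pos)
  ultimately have "0 < 4 * (a\<^sup>2 - a * b + b\<^sup>2)" by (simp only:)
  then show ?thesis by simp
qed

lemma three_cases: "t = 0 \<or> t = 1 \<or> t = (2::3)"
  using exhaust_3[of t] by auto

lemma three_numerals [simp]: "(3::3) = 0" "(4::3) = 1" "(6::3) = 0"
  by simp_all

lemma of_int_3: "(of_int n :: 3) = 0 \<longleftrightarrow> 3 dvd n"
proof -
  have e: "(of_int n :: 3) = of_int (n mod 3)"
  proof -
    have "(of_int (3 * (n div 3) + n mod 3) :: 3) = of_int (n mod 3)"
      by (simp only: of_int_add of_int_mult) simp
    then show ?thesis by simp
  qed
  have "n mod 3 = 0 \<or> n mod 3 = 1 \<or> n mod 3 = 2" by presburger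
  then show ?thesis unfolding e dvd_eq_mod_eq_0 by auto
qed

lemma of_int_3_eq: "(of_int m :: 3) = of_int n \<longleftrightarrow> 3 dvd (m - n)"
  using of_int_3[of "m - n"] by simp

lemma sum_const_6: "(\<Sum>i\<in>(UNIV :: 6 set). t) = (0 :: 3)"
  by simp

text \<open>Since \<omega> is 1 modulo \<theta>, the residue field is reached by sending a + b
  \<omega> to a + b modulo 3. The numeral type \<open>3\<close> serves as this field.\<close>

lemma eisenstein_cong_theta:
  "eisenstein_cong \<theta> (ec (of_int a) (of_int b)) (ec (of_int c) (of_int d)) \<longleftrightarrow>
     (of_int (a + b) :: 3) = of_int (c + d)"
proof -
  have "eisenstein_cong \<theta> (ec (of_int a) (of_int b)) (ec (of_int c) (of_int d)) \<longleftrightarrow>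
      (\<exists>p q. ec (of_int a - of_int c) (of_int b - of_int d) = \<theta> * ec (of_int p) (of_int q))"
    by (auto simp: eisenstein_cong_def eisenstein_integers_eq ec_diff)
  also have "\<dots> \<longleftrightarrow> (\<exists>p q. real_of_int (a - c) = of_int (p - 2 * q) \<and> real_of_int (b - d) = of_int (2 * p - q))"
    by (simp add: theta_ec ec_eq_iff)
  also have "\<dots> \<longleftrightarrow> (\<exists>p q. a - c = p - 2 * q \<and> b - d = 2 * p - q)"
    by (simp only: of_int_eq_iff)
  also have "\<dots> \<longleftrightarrow> 3 dvd (a + b - (c + d))"
  proof
    assume "3 dvd (a + b - (c + d))"
    then obtain k where k: "a + b - (c + d) = 3 * k" by (auto elim: dvdE)
    show "\<exists>p q. a - c = p - 2 * q \<and> b - d = 2 * p - q"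
      by (rule exI[of _ "2 * k - (a - c)"], rule exI[of _ "k - (a - c)"]) (use k in auto)
  qed (auto, presburger)
  finally show ?thesis by (simp only: of_int_3_eq)
qed

lemma eisenstein_cong_3:
  "eisenstein_cong 3 (ec (of_int a) (of_int b)) 0 \<longleftrightarrow> 3 dvd a \<and> 3 dvd b"
proof -
  have "eisenstein_cong 3 (ec (of_int a) (of_int b)) 0 \<longleftrightarrow>
      (\<exists>p q. ec (of_int a) (of_int b) = 3 * ec (of_int p) (of_int q))"
    by (auto simp: eisenstein_cong_def eisenstein_integers_eq)
  also have "\<dots> \<longleftrightarrow> (\<exists>p q. real_of_int a = of_int (3 * p) \<and> real_of_int b = of_int (3 * q))"
    using ec_scaleR[of 3] by (simp add: ec_eq_iff scaleR_conv_of_real)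
  also have "\<dots> \<longleftrightarrow> 3 dvd a \<and> 3 dvd b"
    by (simp only: of_int_eq_iff) (auto simp: dvd_def)
  finally show ?thesis .
qed

text \<open>Six equal residues add up to 0 modulo 3, so the sum of the \<open>b i\<close> is minus
  that of the \<open>a i\<close> and needs no check of its own.\<close>

lemma K12I:
  assumes x: "\<And>i. x $ i = ec (of_int (a i)) (of_int (b i))" and m: "\<And>i. (of_int (a i + b i) :: 3) = m"
    and s: "(\<Sum>i\<in>UNIV. (of_int (a i) :: 3)) = 0"
  shows "x \<in> K12"
proof -
  have sa: "(of_int (\<Sum>i\<in>UNIV. a i) :: 3) = 0" using s by simp
  have "(\<Sum>i\<in>UNIV. (of_int (a i + b i) :: 3)) = 0" unfolding m by (rule sum_const_6)
  then have "(of_int (\<Sum>i\<in>UNIV. b i) :: 3) = 0" using s by (simp add: sum.distrib)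
  then have "eisenstein_cong 3 (\<Sum>i\<in>UNIV. x $ i) 0"
    using sa unfolding x ec_sum of_int_sum[symmetric] eisenstein_cong_3 of_int_3 by blast
  then show ?thesis
    unfolding K12_def mem_Collect_eq x eisenstein_cong_theta m by (auto simp: eisenstein_integers_eq)
qed

lemma K12E:
  assumes "x \<in> K12"
  obtains a b :: "6 \<Rightarrow> int" and m :: 3 where "\<And>i. x $ i = ec (of_int (a i)) (of_int (b i))"
    "\<And>i. (of_int (a i + b i) :: 3) = m" "(\<Sum>i\<in>UNIV. (of_int (a i) :: 3)) = 0"
    "(\<Sum>i\<in>UNIV. (of_int (b i) :: 3)) = 0"
proof -
  have "\<forall>i. \<exists>a b. x $ i = ec (of_int a) (of_int b)"
    using assms by (auto simp: K12_def eisenstein_integers_eq)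
  then obtain a b :: "6 \<Rightarrow> int" where x: "\<And>i. x $ i = ec (of_int (a i)) (of_int (b i))" by metis
  have "\<And>i j. eisenstein_cong \<theta> (x $ i) (x $ j)" "eisenstein_cong 3 (\<Sum>i\<in>UNIV. x $ i) 0"
    using assms by (auto simp: K12_def)
  then have r: "\<And>i j. (of_int (a i + b i) :: 3) = of_int (a j + b j)" and s: "3 dvd (\<Sum>i\<in>UNIV. a i)" "3 dvd (\<Sum>i\<in>UNIV. b i)"
    unfolding x ec_sum of_int_sum[symmetric] eisenstein_cong_3 eisenstein_cong_theta by blast+
  have "(of_int (\<Sum>i\<in>UNIV. a i) :: 3) = 0" "(of_int (\<Sum>i\<in>UNIV. b i) :: 3) = 0"
    using s unfolding of_int_3 by blast+
  then show ?thesis using that[OF x r[of _ 1]] by simp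
qed

lemma discrete_subgroup_K12: "discrete_subgroup K12"
  unfolding discrete_subgroup_def
proof (intro conjI ballI exI[of _ "1::real"] impI)
  show "0 \<in> K12" by (rule K12I[of _ "\<lambda>_. 0" "\<lambda>_. 0" 0]) (simp_all add: ec_0)
  fix x y assume "x \<in> K12"
  then obtain a b m where x: "\<And>i. x $ i = ec (of_int (a i)) (of_int (b i))"
    "\<And>i. (of_int (a i + b i) :: 3) = m" "(\<Sum>i\<in>UNIV. (of_int (a i) :: 3)) = 0"
    by (rule K12E) blast
  show "x - y \<in> K12" if y: "y \<in> K12"
  proof -
    obtain c d n where y: "\<And>i. y $ i = ec (of_int (c i)) (of_int (d i))"
      "\<And>i. (of_int (c i + d i) :: 3) = n" "(\<Sum>i\<in>UNIV. (of_int (c i) :: 3)) = 0"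
      using y by (rule K12E) blast
    show ?thesis
    proof (rule K12I)
      show "(x - y) $ i = ec (of_int (a i - c i)) (of_int (b i - d i))" for i by (simp add: x y ec_diff)
      have "(of_int (a i - c i + (b i - d i)) :: 3) = of_int (a i + b i) - of_int (c i + d i)" for i by simp
      then show "(of_int (a i - c i + (b i - d i)) :: 3) = m - n" for i by (simp only: x y)
      show "(\<Sum>i\<in>UNIV. (of_int (a i - c i) :: 3)) = 0" using x(3) y(3) by (simp add: sum_subtractf)
    qed
  qed
  assume "x \<noteq> 0"
  then obtain i where "x $ i \<noteq> 0" by (auto simp: vec_eq_iff)
  then have "a i \<noteq> 0 \<or> b i \<noteq> 0" by (auto simp: x(1) ec_0)
  then have "1 \<le> (a i)\<^sup>2 - a i * b i + (b i)\<^sup>2" by (rule eisenstein_norm_ge_1)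
  then have "real_of_int 1 \<le> of_int ((a i)\<^sup>2 - a i * b i + (b i)\<^sup>2)" by (simp only: of_int_le_iff)
  then have "1 \<le> (norm (x $ i))\<^sup>2" by (simp add: x(1) norm_ec)
  then have "1 \<le> norm (x $ i)" using power_mono_iff[of 1 "norm (x $ i)" 2] by simp
  also have "\<dots> \<le> norm x" by (rule Finite_Cartesian_Product.norm_nth_le)
  finally show "1 \<le> norm x" .
qed simp

section \<open>Covering bound for the Coxeter-Todd lattice\<close>

text \<open>\<open>p i, x i, y i\<close> are the barycentric coordinates of the \<open>i\<close>-th coordinate of a point; the
  two bounds below are the costs of rounding to the class of the first vertex after one
  or two corrections.\<close>

lemma barycentric_cost:
  fixes p x y :: "6 \<Rightarrow> real"
  assumes nn: "\<And>i. 0 \<le> p i" "\<And>i. 0 \<le> x i" "\<And>i. 0 \<le> y i" and sum1: "\<And>i. p i + x i + y i = 1"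
    and S: "2 \<le> (\<Sum>i\<in>UNIV. p i)"
  defines "C \<equiv> \<Sum>i\<in>UNIV. 1 - p i - (1 - (p i)\<^sup>2 - (x i)\<^sup>2 - (y i)\<^sup>2) / 2"
  shows "(\<exists>i. C + 3 * (1 - x i) < 4 \<or> C + 3 * (1 - y i) < 4) \<or> (\<exists>i j. i \<noteq> j \<and> C + 3 * (p i + p j) < 4) \<or>
    (\<exists>i. C + 3 * (1 - x i) \<le> 4 \<or> C + 3 * (1 - y i) \<le> 4) \<and>
      ((\<forall>i. (p i = 0 \<or> p i = 1) \<and> (x i = 0 \<or> x i = 1) \<and> (y i = 0 \<or> y i = 1)) \<or>
       (\<forall>i. p i = 1/3 \<and> x i = 1/3 \<and> y i = 1/3))"
proof -
  obtain i1 where i1: "\<And>i. p i1 \<le> p i"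
    using ex_is_arg_min_if_finite[of UNIV p] by (auto simp: is_arg_min_def not_less)
  have "UNIV - {i1} \<noteq> ({} :: 6 set)"
  proof
    assume "UNIV - {i1} = {}"
    then have "card (UNIV :: 6 set) \<le> card {i1}" by (intro card_mono) auto
    then show False by simp
  qed
  then obtain i2 where i2: "i2 \<noteq> i1" "\<And>i. i \<noteq> i1 \<Longrightarrow> p i2 \<le> p i"
    using ex_is_arg_min_if_finite[of "UNIV - {i1}" p] by (auto simp: is_arg_min_def not_less)
  define a where "a = p i1"
  define b where "b = p i2"
  have ab: "0 \<le> a" "a \<le> b" "b \<le> 1"
    using nn[of i1] i1[of i2] nn[of i2] sum1[of i2] by (auto simp: a_def b_def)
  obtain i0 where i0: "\<And>i. max (x i) (y i) \<le> max (x i0) (y i0)"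
    using ex_is_arg_min_if_finite[of UNIV "\<lambda>i. - max (x i) (y i)"]
    unfolding is_arg_min_def by (metis UNIV_I finite UNIV_not_empty neg_less_iff_less not_less)
  define X where "X = max (x i0) (y i0)"
  have X: "x i \<le> X" "y i \<le> X" for i using i0[of i] by (auto simp: X_def)
  have X0: "0 \<le> X" using X(1)[of i1] nn(2)[of i1] by linarith
  define S where "S = (\<Sum>i\<in>UNIV. p i)"
  \<comment> \<open>\<open>u\<close> and \<open>v\<close> are the slacks in bounding x^2 and y^2 by
    X x and X y, and p^2 by its chord over the interval from \<open>b\<close> to 1. The index
    \<open>i1\<close> is exempt since \<open>p i1\<close> may lie below \<open>b\<close>.\<close>
  define u where "u = (\<lambda>i. x i * (X - x i) + y i * (X - y i))"
  define v where "v = (\<lambda>i. if i = i1 then 0 else (p i - b) * (1 - p i))"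
  have u0: "0 \<le> u i" for i unfolding u_def using nn[of i] X[of i] by (intro add_nonneg_nonneg mult_nonneg_nonneg) auto
  have v0: "0 \<le> v i" for i
  proof (cases "i = i1")
    case False
    then have "b \<le> p i" "p i \<le> 1" using i2(2)[of i] nn[of i] sum1[of i] by (auto simp: b_def)
    then show ?thesis using False by (simp add: v_def)
  qed (simp add: v_def)
  have C_eq: "C = 3 - S + 3 * X - X * S / 2 + ((1 + b) * S - 6 * b) / 2 - (\<Sum>i\<in>UNIV. u i) / 2
      - (\<Sum>i\<in>UNIV. v i) / 2 + (a\<^sup>2 - (1 + b) * a + b) / 2"
  proof -
    have e: "1 - p i - (1 - (p i)\<^sup>2 - (x i)\<^sup>2 - (y i)\<^sup>2) / 2 =
        1/2 - p i + X / 2 - X * p i / 2 + ((1 + b) * p i - b) / 2 - u i / 2 - v i / 2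
        + (if i = i1 then (a\<^sup>2 - (1 + b) * a + b) / 2 else 0)" for i
    proof -
      have y: "y i = 1 - p i - x i" using sum1[of i] by simp
      show ?thesis
        by (auto simp: u_def v_def y a_def power2_eq_square field_simps)
    qed
    have "C = (\<Sum>i\<in>UNIV. 1/2 - p i + X / 2 - X * p i / 2 + ((1 + b) * p i - b) / 2 - u i / 2 - v i / 2
        + (if i = i1 then (a\<^sup>2 - (1 + b) * a + b) / 2 else 0))"
      unfolding C_def by (intro sum.cong refl e)
    also have "\<dots> = 3 - S + 3 * X - X * S / 2 + ((1 + b) * S - 6 * b) / 2 - (\<Sum>i\<in>UNIV. u i) / 2 - (\<Sum>i\<in>UNIV. v i) / 2
        + (a\<^sup>2 - (1 + b) * a + b) / 2"
      by (simp add: sum.distrib sum_subtractf S_def sum_distrib_left flip: sum_divide_distrib)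
    finally show ?thesis .
  qed
  define W where "W = (1 + X - b) / 2 * (S - 2) + (b - a) * (1 + a) / 2 + (\<Sum>i\<in>UNIV. u i) / 2 + (\<Sum>i\<in>UNIV. v i) / 2"
  have W0: "0 \<le> (1 + X - b) / 2 * (S - 2)" "0 \<le> (b - a) * (1 + a) / 2" "0 \<le> (\<Sum>i\<in>UNIV. u i)" "0 \<le> (\<Sum>i\<in>UNIV. v i)"
    using S ab X0 u0 v0 by (auto simp: S_def intro!: sum_nonneg mult_nonneg_nonneg)
  \<comment> \<open>With \<delta> = X + a + b - 1 the two options cost 4 - W - \<delta> and 4 - W +
    2 \<delta>, so one of them is below 4 unless W = \<delta> = 0.\<close>
  have cB: "C + 3 * (1 - X) = 4 - W - (X + a + b - 1)"
    unfolding C_eq W_def by (simp add: field_simps power2_eq_square)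
  have W: "0 \<le> W" using W0 unfolding W_def by linarith
  have Xc: "\<exists>i. P (x i) \<or> P (y i)" if "P X" for P
    using that by (auto simp: X_def max_def split: if_splits)
  consider "X + a + b < 1" | "0 < W + (X + a + b - 1)" | "X + a + b = 1" "W = 0"
    using W by linarith
  then show ?thesis
  proof cases
    case 1
    moreover have "C + 3 - 3 * X = 4 - W - (X + a + b - 1)" using cB by simp
    ultimately have "C + 3 * a + 3 * b < 4" using W by linarith
    then have "C + 3 * (p i1 + p i2) < 4" unfolding a_def b_def by simp
    then show ?thesis using i2(1)[symmetric] by blast
  next
    case 2
    then have "C + 3 * (1 - X) < 4" using cB by linarith
    then have "\<exists>i. C + 3 * (1 - x i) < 4 \<or> C + 3 * (1 - y i) < 4"
      by (rule Xc[where P = "\<lambda>t. C + 3 * (1 - t) < 4"])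
    then show ?thesis by blast
  next
    case 3
    have "C + 3 * (1 - X) \<le> 4" using cB 3 by linarith
    then have near: "\<exists>i. C + 3 * (1 - x i) \<le> 4 \<or> C + 3 * (1 - y i) \<le> 4"
      by (rule Xc[where P = "\<lambda>t. C + 3 * (1 - t) \<le> 4"])
    have z: "(1 + X - b) / 2 * (S - 2) = 0" "(b - a) * (1 + a) / 2 = 0" "(\<Sum>i\<in>UNIV. u i) = 0" "(\<Sum>i\<in>UNIV. v i) = 0"
      using 3(2) W0 unfolding W_def by linarith+
    have ba: "b = a" using z(2) ab by auto
    have Xa: "X = 1 - 2 * a" using 3(1) ba by simp
    have "1 + X - b \<noteq> 0" using Xa ba X0 ab by auto
    then have S2: "S = 2" using z(1) by simp
    have "u i = 0" for i using z(3) u0 by (simp add: sum_nonneg_eq_0_iff)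
    then have xy: "(x i = 0 \<or> x i = X) \<and> (y i = 0 \<or> y i = X)" for i
    proof -
      have "0 \<le> x i * (X - x i)" "0 \<le> y i * (X - y i)" using nn[of i] X[of i] by auto
      moreover have "x i * (X - x i) + y i * (X - y i) = 0" using \<open>u i = 0\<close> unfolding u_def .
      ultimately have "x i * (X - x i) = 0 \<and> y i * (X - y i) = 0" by (simp only: add_nonneg_eq_0_iff)
      then show ?thesis by auto
    qed
    \<comment> \<open>Both \<open>x i1\<close> and \<open>y i1\<close> are 0 or 1 - 2 a: one nonzero
      value forces a = 0, two force a = 1/3.\<close>
    have "a + x i1 + y i1 = 1" using sum1[of i1] by (simp add: a_def)
    then have "a = 0 \<or> a = 1/3" using xy[of i1] X0 unfolding Xa by auto
    then show ?thesis
    proof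
      assume a: "a = 0"
      have "\<forall>i. (p i = 0 \<or> p i = 1) \<and> (x i = 0 \<or> x i = 1) \<and> (y i = 0 \<or> y i = 1)"
      proof
        fix i
        have "x i = 0 \<or> x i = 1" "y i = 0 \<or> y i = 1" using xy[of i] unfolding Xa a by auto
        then show "(p i = 0 \<or> p i = 1) \<and> (x i = 0 \<or> x i = 1) \<and> (y i = 0 \<or> y i = 1)"
          using sum1[of i] nn(1)[of i] by auto
      qed
      then show ?thesis by (intro disjI2 conjI disjI1 near)
    next
      assume a: "a = 1/3"
      have "(\<Sum>i\<in>UNIV. p i - 1/3) = 0" using S2 by (simp add: sum_subtractf S_def)
      moreover have "0 \<le> p i - 1/3" for i using i1[of i] a by (simp add: a_def)
      ultimately have p3: "p i = 1/3" for i by (simp add: sum_nonneg_eq_0_iff)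
      have X3: "X = 1/3" using Xa a by simp
      have "x i = 1/3 \<and> y i = 1/3" for i
        using xy[of i] sum1[of i] p3[of i] unfolding X3 by auto
      then have "\<forall>i. p i = 1/3 \<and> x i = 1/3 \<and> y i = 1/3" using p3 by simp
      then show ?thesis by (intro disjI2 conjI near)
    qed
  qed
qed

lemma three_minus: "(- 1 :: 3) = 2" "(- 2 :: 3) = 1"
  by (rule minus_unique, simp)+

text \<open>\<open>m\<close> is the residue of a + b \<omega> modulo \<theta>, and \<open>s\<close>
  refines it to the residue modulo 3. A vector of such numbers lies in \<open>K12\<close> when
  \<open>m\<close> is common to all coordinates and the \<open>s\<close> sum to 0.\<close>

definition near_class :: "complex \<Rightarrow> 3 \<Rightarrow> 3 \<Rightarrow> real \<Rightarrow> bool" where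
  "near_class z m s c \<longleftrightarrow> (\<exists>a b :: int. of_int (a + b) = m \<and> of_int a = s \<and>
     (norm (z - ec (of_int a) (of_int b)))\<^sup>2 \<le> c)"

lemma near_classI:
  assumes "of_int (a + b) = m" "of_int a = s" "(norm (z - ec (of_int a) (of_int b)))\<^sup>2 \<le> c"
  shows "near_class z m s c"
  using assms unfolding near_class_def by blast

lemma near_class_mono: "near_class z m s c \<Longrightarrow> c \<le> c' \<Longrightarrow> near_class z m s c'"
  unfolding near_class_def by (blast intro: order_trans)

lemma near_class_K12:
  assumes "\<And>i. near_class (z $ i) m (s i) (c i)" "(\<Sum>i\<in>UNIV. s i) = 0"
  shows "\<exists>x\<in>K12. (norm (x - z))\<^sup>2 \<le> (\<Sum>i\<in>UNIV. c i)"
proof -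
  have "\<forall>i. \<exists>a b :: int. of_int (a + b) = m \<and> of_int a = s i \<and> (norm (z $ i - ec (of_int a) (of_int b)))\<^sup>2 \<le> c i"
    using assms(1) unfolding near_class_def by blast
  then obtain a b :: "6 \<Rightarrow> int" where ab: "\<And>i. of_int (a i + b i) = m" "\<And>i. of_int (a i) = s i"
    "\<And>i. (norm (z $ i - ec (of_int (a i)) (of_int (b i))))\<^sup>2 \<le> c i" by metis
  define x where "x = (\<chi> i. ec (of_int (a i)) (of_int (b i)))"
  have "x \<in> K12" by (rule K12I[of _ a b m]) (simp_all add: x_def ab assms(2) del: of_int_add)
  moreover have "(norm (x - z))\<^sup>2 \<le> (\<Sum>i\<in>UNIV. c i)"
    unfolding norm_vec_power2 by (intro sum_mono) (use ab(3) in \<open>simp add: x_def norm_minus_commute\<close>)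
  ultimately show ?thesis by blast
qed

text \<open>Every complex number lies in a triangle of side 1 whose vertices \<open>A k + B k * \<omega>\<close> belong to the
  residue classes \<open>k\<close> modulo \<open>\<theta>\<close>; the sum of the vertices modulo 3 distinguishes the two orientations.\<close>

lemma eisenstein_triangle:
  obtains A B :: "3 \<Rightarrow> int" and l :: "3 \<Rightarrow> real"
  where "\<And>k. 0 \<le> l k" "l 0 + l 1 + l 2 = 1"
    "z = ec (l 0 * A 0 + l 1 * A 1 + l 2 * A 2) (l 0 * B 0 + l 1 * B 1 + l 2 * B 2)"
    "\<And>k. of_int (A k + B k) = k" "(of_int (A 0 + A 1 + A 2) :: 3) \<noteq> 0"
    "\<And>k. (A (k + 1) - A k)\<^sup>2 - (A (k + 1) - A k) * (B (k + 1) - B k) + (B (k + 1) - B k)\<^sup>2 = 1"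
proof -
  obtain p q where z: "z = ec p q" using ec_surj by blast
  define a where "a = \<lfloor>p\<rfloor>"
  define b where "b = \<lfloor>q\<rfloor>"
  define f where "f = p - a"
  define g where "g = q - b"
  have fg: "0 \<le> f" "f \<le> 1" "0 \<le> g" "g \<le> 1"
    unfolding f_def g_def a_def b_def by linarith+
  have pq: "p = a + f" "q = b + g" by (simp_all add: f_def g_def)
  define c :: 3 where "c = of_int (a + b)"
  have c: "c = 0 \<or> c = 1 \<or> c = 2" by (rule three_cases)
  \<comment> \<open>The rhombus with corner a + b \<omega> is cut along its diagonal 1 + \<omega>,
    which has length 1, into two equilateral triangles. The shift by \<open>c\<close> then relabels
    each vertex by its residue.\<close>
  define A' where "A' = (\<lambda>k::3. if k = 0 then a else if k = 1 then (if g \<le> f then a + 1 else a) else a + 1)"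
  define B' where "B' = (\<lambda>k::3. if k = 0 then b else if k = 1 then (if g \<le> f then b else b + 1) else b + 1)"
  define l' where "l' = (\<lambda>k::3. if k = 0 then 1 - max f g else if k = 1 then \<bar>f - g\<bar> else min f g)"
  define A where "A = (\<lambda>k. A' (k - c))"
  define B where "B = (\<lambda>k. B' (k - c))"
  define l where "l = (\<lambda>k. l' (k - c))"
  have shift: "h (0 - c) + h (1 - c) + h (2 - c) = h 0 + h 1 + h (2::3)" for h :: "3 \<Rightarrow> 'b::ab_semigroup_add"
    using c by (auto simp: add_ac three_minus)
  have step: "k = 0 \<or> k = 1 \<or> k = 2" for k :: 3 by (rule three_cases)
  show ?thesis
  proof (rule that[of l A B])
    show "0 \<le> l k" for k using fg by (auto simp: l_def l'_def)
    show "l 0 + l 1 + l 2 = 1" unfolding l_def shift by (auto simp: l'_def)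
    show "z = ec (l 0 * A 0 + l 1 * A 1 + l 2 * A 2) (l 0 * B 0 + l 1 * B 1 + l 2 * B 2)"
      unfolding l_def A_def B_def shift[of "\<lambda>k. l' k * real_of_int (A' k)"] shift[of "\<lambda>k. l' k * real_of_int (B' k)"]
      by (auto simp: l'_def A'_def B'_def z pq ec_eq_iff algebra_simps)
    have r: "of_int (A' k + B' k) = c + k" for k
      using step[of k] by (auto simp: A'_def B'_def c_def)
    show "of_int (A k + B k) = k" for k unfolding A_def B_def r by simp
    have "(of_int (A' 0 + A' 1 + A' 2) :: 3) = (if g \<le> f then 2 else 1)"
    proof -
      have "(of_int (3 * a + 2) :: 3) = 2" "(of_int (3 * a + 1) :: 3) = 1"
        by (simp_all only: of_int_add of_int_mult) simp_all
      moreover have "A' 0 + A' 1 + A' 2 = (if g \<le> f then 3 * a + 2 else 3 * a + 1)" by (auto simp: A'_def)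
      ultimately show ?thesis by simp
    qed
    then show "(of_int (A 0 + A 1 + A 2) :: 3) \<noteq> 0" unfolding A_def shift by simp
    have "(A' (k + 1) - A' k)\<^sup>2 - (A' (k + 1) - A' k) * (B' (k + 1) - B' k) + (B' (k + 1) - B' k)\<^sup>2 = 1" for k
      using step[of k] by (auto simp: A'_def B'_def)
    note side = this
    show "(A (k + 1) - A k)\<^sup>2 - (A (k + 1) - A k) * (B (k + 1) - B k) + (B (k + 1) - B k)\<^sup>2 = 1" for k
    proof -
      have e: "k + 1 - c = (k - c) + 1" by simp
      show ?thesis unfolding A_def B_def e by (rule side)
    qed
  qed
qed

text \<open>Two sides of an equilateral triangle of side 1 have inner product 1/2.\<close>

lemma eisenstein_norm_comb:
  fixes u1 u2 v1 v2 x y :: real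
  assumes "u1\<^sup>2 - u1 * u2 + u2\<^sup>2 = 1" "v1\<^sup>2 - v1 * v2 + v2\<^sup>2 = 1"
    "(v1 - u1)\<^sup>2 - (v1 - u1) * (v2 - u2) + (v2 - u2)\<^sup>2 = 1"
  shows "(norm (ec (x * u1 + y * v1) (x * u2 + y * v2)))\<^sup>2 = x\<^sup>2 + x * y + y\<^sup>2"
  unfolding norm_ec using assms by algebra

text \<open>From vertex \<open>m\<close>, with sides u and v, the points s u + t v of class
  \<open>m\<close> are those with s + 2 t divisible by 3. The four roundings are 0, u + v, 2 u - v
  and 2 v - u; modulo 3 the last two are both minus the second.\<close>

lemma eisenstein_roundings:
  fixes A B :: "3 \<Rightarrow> int" and l :: "3 \<Rightarrow> real" and m :: 3
  assumes l1: "l 0 + l 1 + l 2 = 1"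
    and z: "z = ec (l 0 * A 0 + l 1 * A 1 + l 2 * A 2) (l 0 * B 0 + l 1 * B 1 + l 2 * B 2)"
    and res: "\<And>k. of_int (A k + B k) = k"
    and side: "\<And>k. (A (k + 1) - A k)\<^sup>2 - (A (k + 1) - A k) * (B (k + 1) - B k) + (B (k + 1) - B k)\<^sup>2 = 1"
  defines "c \<equiv> 1 - l m - (1 - (l m)\<^sup>2 - (l (m + 1))\<^sup>2 - (l (m + 2))\<^sup>2) / 2"
    and "\<epsilon> \<equiv> (of_int (A 0 + A 1 + A 2) :: 3)"
  shows "near_class z m (of_int (A m)) c"
    and "near_class z m (of_int (A m) + \<epsilon>) (c + 3 * l m)"
    and "near_class z m (of_int (A m) - \<epsilon>) (c + 3 * (1 - l (m + 1)))"
    and "near_class z m (of_int (A m) - \<epsilon>) (c + 3 * (1 - l (m + 2)))"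
proof -
  have shift: "h 0 + h 1 + h (2::3) = h m + h (m + 1) + h (m + 2)" for h :: "3 \<Rightarrow> 'b::ab_semigroup_add"
    using three_cases[of m] by (auto simp: add_ac)
  have m3: "m + 2 + 1 = m" "m + 1 + 1 = m + 2" using three_cases[of m] by auto
  define x where "x = l (m + 1)"
  define y where "y = l (m + 2)"
  have lm: "l m = 1 - x - y" using l1 shift[of l] by (simp add: x_def y_def)
  define u1 u2 v1 v2 :: int where "u1 = A (m + 1) - A m" and "u2 = B (m + 1) - B m"
    and "v1 = A (m + 2) - A m" and "v2 = B (m + 2) - B m"
  have N: "u1\<^sup>2 - u1 * u2 + u2\<^sup>2 = 1" "v1\<^sup>2 - v1 * v2 + v2\<^sup>2 = 1"
    "(v1 - u1)\<^sup>2 - (v1 - u1) * (v2 - u2) + (v2 - u2)\<^sup>2 = 1"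
    using side[of m] side[of "m + 1"] side[of "m + 2"] unfolding m3 u1_def u2_def v1_def v2_def
    by (simp_all add: power2_eq_square algebra_simps)
  have Nr: "(real_of_int u1)\<^sup>2 - real_of_int u1 * real_of_int u2 + (real_of_int u2)\<^sup>2 = 1"
    "(real_of_int v1)\<^sup>2 - real_of_int v1 * real_of_int v2 + (real_of_int v2)\<^sup>2 = 1"
    "(real_of_int v1 - u1)\<^sup>2 - (real_of_int v1 - u1) * (real_of_int v2 - u2) + (real_of_int v2 - u2)\<^sup>2 = 1"
    using N[THEN arg_cong[where f = real_of_int]] by simp_all
  have A: "A (m + 1) = A m + u1" "A (m + 2) = A m + v1" "B (m + 1) = B m + u2" "B (m + 2) = B m + v2"
    by (simp_all add: u1_def u2_def v1_def v2_def)
  have zm: "z = ec (A m + (x * u1 + y * v1)) (B m + (x * u2 + y * v2))"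
    unfolding z shift[of "\<lambda>k. l k * real_of_int (A k)"] shift[of "\<lambda>k. l k * real_of_int (B k)"]
    unfolding A lm x_def[symmetric] y_def[symmetric] by (simp add: ec_eq_iff algebra_simps)
  have c: "c = x\<^sup>2 + x * y + y\<^sup>2"
    unfolding c_def lm x_def[symmetric] y_def[symmetric] by (simp add: power2_eq_square field_simps)
  have n: "(norm (z - ec (of_int (A m + s * u1 + t * v1)) (of_int (B m + s * u2 + t * v2))))\<^sup>2
      = (x - s)\<^sup>2 + (x - s) * (y - t) + (y - t)\<^sup>2" for s t :: int
  proof -
    have "z - ec (of_int (A m + s * u1 + t * v1)) (of_int (B m + s * u2 + t * v2))
        = ec ((x - s) * u1 + (y - t) * v1) ((x - s) * u2 + (y - t) * v2)"
      by (simp add: zm ec_diff ec_eq_iff algebra_simps)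
    then show ?thesis using eisenstein_norm_comb[OF Nr, of "x - s" "y - t"] by simp
  qed
  have u: "(of_int (u1 + u2) :: 3) = 1" "(of_int (v1 + v2) :: 3) = 2"
  proof -
    have "(of_int (u1 + u2) :: 3) = of_int (A (m + 1) + B (m + 1)) - of_int (A m + B m)"
      by (simp add: u1_def u2_def)
    then show "(of_int (u1 + u2) :: 3) = 1" by (simp only: res) simp
    have "(of_int (v1 + v2) :: 3) = of_int (A (m + 2) + B (m + 2)) - of_int (A m + B m)"
      by (simp add: v1_def v2_def)
    then show "(of_int (v1 + v2) :: 3) = 2" by (simp only: res) simp
  qed
  have r: "(of_int (A m + s * u1 + t * v1 + (B m + s * u2 + t * v2)) :: 3) = m + of_int s + 2 * of_int t" for s t :: int
  proof -
    have "A m + s * u1 + t * v1 + (B m + s * u2 + t * v2) = (A m + B m) + s * (u1 + u2) + t * (v1 + v2)"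
      by (simp add: algebra_simps)
    then show ?thesis by (simp only: of_int_add[of "A m + B m + _"] of_int_add[of "A m + B m"] of_int_mult res u) simp
  qed
  have "A 0 + A 1 + A 2 = 3 * A m + u1 + v1" unfolding shift[of A] A by simp
  then have \<epsilon>: "\<epsilon> = of_int u1 + of_int v1"
    unfolding \<epsilon>_def by (simp only: of_int_add of_int_mult) simp
  have three: "t + t + t = 0" for t :: 3 using three_cases[of t] by auto
  have pt: "near_class z m (of_int (A m) + of_int s * of_int u1 + of_int t * of_int v1) e"
    if "(of_int s + 2 * of_int t :: 3) = 0" "(x - s)\<^sup>2 + (x - s) * (y - t) + (y - t)\<^sup>2 \<le> e" for s t :: int and e
  proof (rule near_classI)
    show "(of_int (A m + s * u1 + t * v1 + (B m + s * u2 + t * v2)) :: 3) = m"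
      unfolding r using that(1) by (simp only: add.assoc add_0_right)
    show "(norm (z - ec (of_int (A m + s * u1 + t * v1)) (of_int (B m + s * u2 + t * v2))))\<^sup>2 \<le> e"
      unfolding n by (rule that(2))
  qed simp
  have 1: "x\<^sup>2 + x * y + y\<^sup>2 \<le> c" by (simp add: c)
  show "near_class z m (of_int (A m)) c"
    using pt[of 0 0 c] 1 by simp
  have 2: "(x - 1)\<^sup>2 + (x - 1) * (y - 1) + (y - 1)\<^sup>2 \<le> c + 3 * l m"
    unfolding c lm by (simp add: power2_eq_square algebra_simps)
  show "near_class z m (of_int (A m) + \<epsilon>) (c + 3 * l m)"
    using pt[of 1 1 "c + 3 * l m"] 2 unfolding \<epsilon> by (simp add: add.assoc)
  have 3: "(x - 2)\<^sup>2 + (x - 2) * (y + 1) + (y + 1)\<^sup>2 \<le> c + 3 * (1 - x)"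
    unfolding c by (simp add: power2_eq_square algebra_simps)
  have e3: "2 * of_int u1 - of_int v1 = - \<epsilon>" unfolding \<epsilon> using three[of "of_int u1"] by (simp add: algebra_simps)
  show "near_class z m (of_int (A m) - \<epsilon>) (c + 3 * (1 - l (m + 1)))"
  proof -
    have "near_class z m (of_int (A m) + of_int 2 * of_int u1 + of_int (- 1) * of_int v1) (c + 3 * (1 - x))"
      by (rule pt) (use 3 in simp_all)
    moreover have "of_int (A m) + of_int 2 * of_int u1 + of_int (- 1) * of_int v1
        = of_int (A m) + (2 * of_int u1 - of_int v1 :: 3)" by simp
    ultimately show ?thesis by (simp only: e3 x_def[symmetric] add_uminus_conv_diff)
  qed
  have 4: "(x + 1)\<^sup>2 + (x + 1) * (y - 2) + (y - 2)\<^sup>2 \<le> c + 3 * (1 - y)"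
    unfolding c by (simp add: power2_eq_square algebra_simps)
  have e4: "2 * of_int v1 - of_int u1 = - \<epsilon>" unfolding \<epsilon> using three[of "of_int v1"] by (simp add: algebra_simps)
  show "near_class z m (of_int (A m) - \<epsilon>) (c + 3 * (1 - l (m + 2)))"
  proof -
    have "near_class z m (of_int (A m) + of_int (- 1) * of_int u1 + of_int 2 * of_int v1) (c + 3 * (1 - y))"
      by (rule pt) (use 4 in simp_all)
    moreover have "of_int (A m) + of_int (- 1) * of_int u1 + of_int 2 * of_int v1
        = of_int (A m) + (2 * of_int v1 - of_int u1 :: 3)" by simp
    ultimately show ?thesis by (simp only: e4 y_def[symmetric] add_uminus_conv_diff)
  qed
qed

text \<open>The three roundings of a coordinate change the sum modulo 3 by \<open>0\<close>, \<open>\<epsilon>\<close> and \<open>- \<epsilon>\<close>, so any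
  required correction is met by one coordinate at the higher price or by two at the lower one.\<close>

lemma K12_roundings:
  fixes p x y c :: "6 \<Rightarrow> real" and s \<epsilon> :: "6 \<Rightarrow> 3"
  assumes nn: "\<And>i. 0 \<le> p i" "\<And>i. 0 \<le> x i" "\<And>i. 0 \<le> y i" and sum1: "\<And>i. p i + x i + y i = 1"
    and \<epsilon>: "\<And>i. \<epsilon> i \<noteq> 0"
    and n0: "\<And>i. near_class (z $ i) m (s i) (c i)"
    and n1: "\<And>i. near_class (z $ i) m (s i + \<epsilon> i) (c i + 3 * p i)"
    and nx: "\<And>i. near_class (z $ i) m (s i - \<epsilon> i) (c i + 3 * (1 - x i))"
    and ny: "\<And>i. near_class (z $ i) m (s i - \<epsilon> i) (c i + 3 * (1 - y i))"
  defines "C \<equiv> \<Sum>i\<in>UNIV. c i"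
  shows "(\<Sum>i\<in>UNIV. s i) = 0 \<Longrightarrow> \<exists>w\<in>K12. (norm (w - z))\<^sup>2 \<le> C"
    and "(\<Sum>i\<in>UNIV. s i) = - \<epsilon> i \<Longrightarrow> \<exists>w\<in>K12. (norm (w - z))\<^sup>2 \<le> C + 3 * p i"
    and "\<exists>w\<in>K12. (norm (w - z))\<^sup>2 \<le> C + 3 * (1 - x i)"
    and "\<exists>w\<in>K12. (norm (w - z))\<^sup>2 \<le> C + 3 * (1 - y i)"
    and "i \<noteq> j \<Longrightarrow> \<exists>w\<in>K12. (norm (w - z))\<^sup>2 \<le> C + 3 * (p i + p j)"
proof -
  define S where "S = (\<Sum>i\<in>UNIV. s i)"
  have two: "\<exists>w\<in>K12. (norm (w - z))\<^sup>2 \<le> C + (e + e')"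
    if "i \<noteq> j" "near_class (z $ i) m (s i + d) (c i + e)" "near_class (z $ j) m (s j + d') (c j + e')" "S + (d + d') = 0"
    for i j d d' e e'
  proof -
    define s' where "s' = (\<lambda>k. s k + ((if k = i then d else 0) + (if k = j then d' else 0)))"
    define c' where "c' = (\<lambda>k. c k + ((if k = i then e else 0) + (if k = j then e' else 0)))"
    have "near_class (z $ k) m (s' k) (c' k)" for k
      using that(1-3) n0[of k] by (auto simp: s'_def c'_def)
    moreover have "(\<Sum>k\<in>UNIV. s' k) = 0"
      using that(4) by (simp add: s'_def sum.distrib S_def)
    moreover have "(\<Sum>k\<in>UNIV. c' k) = C + (e + e')"
      by (simp add: c'_def sum.distrib C_def)
    ultimately show ?thesis using near_class_K12[of z m s' c'] by simp
  qed
  have ex_other: "\<exists>j. j \<noteq> i" for i :: 6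
    by (rule exI[of _ "i + 1"]) simp
  have one: "\<exists>w\<in>K12. (norm (w - z))\<^sup>2 \<le> C + e"
    if "near_class (z $ i) m (s i + d) (c i + e)" "S + d = 0" for i d e
  proof -
    obtain j where "i \<noteq> j" using ex_other by metis
    then show ?thesis using two[of i j d e 0 0] that n0[of j] by simp
  qed
  have zero: "\<exists>w\<in>K12. (norm (w - z))\<^sup>2 \<le> C + e" if "S = 0" "0 \<le> e" for e
    using one[of undefined 0 e] near_class_mono[OF n0[of undefined], of "c undefined + e"] that by simp
  have tri: "S = 0 \<or> S = - \<epsilon> i \<or> S = \<epsilon> i" for i
    using three_cases[of S] three_cases[of "\<epsilon> i"] \<epsilon>[of i] by (auto simp: three_minus)
  show "\<exists>w\<in>K12. (norm (w - z))\<^sup>2 \<le> C" if "(\<Sum>i\<in>UNIV. s i) = 0"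
    using zero[of 0] that by (simp add: S_def)
  show single: "\<exists>w\<in>K12. (norm (w - z))\<^sup>2 \<le> C + 3 * p i" if "(\<Sum>i\<in>UNIV. s i) = - \<epsilon> i" for i
    using one[OF n1[of i]] that by (simp add: S_def)
  have big: "\<exists>w\<in>K12. (norm (w - z))\<^sup>2 \<le> C + 3 * (1 - t)"
    if t: "near_class (z $ i) m (s i - \<epsilon> i) (c i + 3 * (1 - t))" "0 \<le> t" "p i \<le> 1 - t" for i t
    using tri[of i]
  proof (elim disjE)
    assume "S = 0"
    then show ?thesis using zero[of "3 * (1 - t)"] t nn(1)[of i] by simp
  next
    assume "S = - \<epsilon> i"
    then obtain w where "w \<in> K12" "(norm (w - z))\<^sup>2 \<le> C + 3 * p i" using single[of i] by (auto simp: S_def)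
    then show ?thesis using t(3) by (intro bexI[of _ w]) auto
  next
    assume "S = \<epsilon> i"
    then show ?thesis using one[of i "- \<epsilon> i"] t(1) by simp
  qed
  show "\<exists>w\<in>K12. (norm (w - z))\<^sup>2 \<le> C + 3 * (1 - x i)"
    by (rule big[OF nx nn(2)]) (use sum1[of i] nn(3)[of i] in linarith)
  show "\<exists>w\<in>K12. (norm (w - z))\<^sup>2 \<le> C + 3 * (1 - y i)"
    by (rule big[OF ny nn(3)]) (use sum1[of i] nn(2)[of i] in linarith)
  show "\<exists>w\<in>K12. (norm (w - z))\<^sup>2 \<le> C + 3 * (p i + p j)" if ij: "i \<noteq> j"
  proof -
    have weaken: ?thesis if w: "\<exists>w\<in>K12. (norm (w - z))\<^sup>2 \<le> C + 3 * p k" and k: "k = i \<or> k = j" for k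
    proof -
      obtain w where "w \<in> K12" "(norm (w - z))\<^sup>2 \<le> C + 3 * p k" using w by blast
      then show ?thesis using k nn(1)[of i] nn(1)[of j] by (intro bexI[of _ w]) auto
    qed
    consider "S = 0" | "S = - \<epsilon> i" | "S = - \<epsilon> j" | "S = \<epsilon> i" "S = \<epsilon> j"
      using tri[of i] tri[of j] by blast
    then show ?thesis
    proof cases
      case 1
      then show ?thesis using zero[of "3 * (p i + p j)"] nn(1)[of i] nn(1)[of j] by simp
    next
      case 2
      then show ?thesis using weaken[OF single[of i]] by (simp add: S_def)
    next
      case 3
      then show ?thesis using weaken[OF single[of j]] by (simp add: S_def)
    next
      case 4
      \<comment> \<open>Both corrections equal \<open>S\<close>, and three times \<open>S\<close> is
        0.\<close>
      have "S + (\<epsilon> i + \<epsilon> j) = 0" using 4 three_cases[of S] by auto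
      from two[OF ij n1 n1 this] show ?thesis by (simp only: distrib_left)
    qed
  qed
qed

text \<open>The barycentric weights total 6 over the three classes, so some class \<open>m\<close>
  has weight at least 2, as \<open>barycentric_cost\<close> requires. Its borderline cases are all
  coordinates at vertices or all at centroids; among the latter only triangles of one common
  orientation remain.\<close>

lemma K12_cover:
  "(\<exists>x\<in>K12. (norm (x - z))\<^sup>2 < 4) \<or>
   (\<exists>x\<in>K12. (norm (x - z))\<^sup>2 \<le> 4) \<and>
     ((\<forall>i. z $ i \<in> eisenstein_integers) \<or>
      (\<exists>a b. \<forall>i. z $ i = ec (1/3 + of_int (a i)) (2/3 + of_int (b i))) \<or>
      (\<exists>a b. \<forall>i. - z $ i = ec (1/3 + of_int (a i)) (2/3 + of_int (b i))))"
proof -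
  have "\<forall>i. \<exists>A B :: 3 \<Rightarrow> int. \<exists>l :: 3 \<Rightarrow> real. (\<forall>k. 0 \<le> l k) \<and> l 0 + l 1 + l 2 = 1 \<and>
    z $ i = ec (l 0 * A 0 + l 1 * A 1 + l 2 * A 2) (l 0 * B 0 + l 1 * B 1 + l 2 * B 2) \<and>
    (\<forall>k. of_int (A k + B k) = k) \<and> (of_int (A 0 + A 1 + A 2) :: 3) \<noteq> 0 \<and>
    (\<forall>k. (A (k + 1) - A k)\<^sup>2 - (A (k + 1) - A k) * (B (k + 1) - B k) + (B (k + 1) - B k)\<^sup>2 = 1)"
  proof
    fix i
    show "\<exists>A B :: 3 \<Rightarrow> int. \<exists>l :: 3 \<Rightarrow> real. (\<forall>k. 0 \<le> l k) \<and> l 0 + l 1 + l 2 = 1 \<and>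
      z $ i = ec (l 0 * A 0 + l 1 * A 1 + l 2 * A 2) (l 0 * B 0 + l 1 * B 1 + l 2 * B 2) \<and>
      (\<forall>k. of_int (A k + B k) = k) \<and> (of_int (A 0 + A 1 + A 2) :: 3) \<noteq> 0 \<and>
      (\<forall>k. (A (k + 1) - A k)\<^sup>2 - (A (k + 1) - A k) * (B (k + 1) - B k) + (B (k + 1) - B k)\<^sup>2 = 1)"
      by (rule eisenstein_triangle[of "z $ i"]) (intro exI conjI allI; assumption)
  qed
  from this[unfolded choice_iff] obtain A B :: "6 \<Rightarrow> 3 \<Rightarrow> int" and l :: "6 \<Rightarrow> 3 \<Rightarrow> real" where
    l0: "\<And>i k. 0 \<le> l i k" and l1: "\<And>i. l i 0 + l i 1 + l i 2 = 1"
    and z: "\<And>i. z $ i = ec (l i 0 * A i 0 + l i 1 * A i 1 + l i 2 * A i 2) (l i 0 * B i 0 + l i 1 * B i 1 + l i 2 * B i 2)"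
    and res: "\<And>i k. of_int (A i k + B i k) = k" and ne: "\<And>i. (of_int (A i 0 + A i 1 + A i 2) :: 3) \<noteq> 0"
    and side: "\<And>i k. (A i (k + 1) - A i k)\<^sup>2 - (A i (k + 1) - A i k) * (B i (k + 1) - B i k) + (B i (k + 1) - B i k)\<^sup>2 = 1"
    by blast
  define \<epsilon> where "\<epsilon> = (\<lambda>i. of_int (A i 0 + A i 1 + A i 2) :: 3)"
  have \<epsilon>0: "\<epsilon> i \<noteq> 0" for i using ne[of i] by (simp only: \<epsilon>_def not_False_eq_True)
  have "\<exists>m. 2 \<le> (\<Sum>i\<in>UNIV. l i m)"
  proof (rule ccontr)
    assume "\<not> ?thesis"
    then have "(\<Sum>i\<in>UNIV. l i 0) < 2" "(\<Sum>i\<in>UNIV. l i 1) < 2" "(\<Sum>i\<in>UNIV. l i 2) < 2" by (auto simp: not_le)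
    moreover have "(\<Sum>i\<in>UNIV. l i 0) + (\<Sum>i\<in>UNIV. l i 1) + (\<Sum>i\<in>UNIV. l i 2) = 6"
      unfolding sum.distrib[symmetric] l1 by simp
    ultimately show False by linarith
  qed
  then obtain m where m: "2 \<le> (\<Sum>i\<in>UNIV. l i m)" by blast
  define p where "p = (\<lambda>i. l i m)"
  define x where "x = (\<lambda>i. l i (m + 1))"
  define y where "y = (\<lambda>i. l i (m + 2))"
  define c where "c = (\<lambda>i. 1 - p i - (1 - (p i)\<^sup>2 - (x i)\<^sup>2 - (y i)\<^sup>2) / 2)"
  define C where "C = (\<Sum>i\<in>UNIV. c i)"
  have pxy: "p i + x i + y i = 1" for i
    using l1[of i] three_cases[of m] by (auto simp: p_def x_def y_def add_ac)
  have nn: "0 \<le> p i" "0 \<le> x i" "0 \<le> y i" for i by (simp_all add: p_def x_def y_def l0)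
  have nc: "near_class (z $ i) m (of_int (A i m)) (c i)"
    "near_class (z $ i) m (of_int (A i m) + \<epsilon> i) (c i + 3 * p i)"
    "near_class (z $ i) m (of_int (A i m) - \<epsilon> i) (c i + 3 * (1 - x i))"
    "near_class (z $ i) m (of_int (A i m) - \<epsilon> i) (c i + 3 * (1 - y i))" for i
    using eisenstein_roundings[of "l i" "z $ i" "A i" "B i" m, OF l1 z res side] unfolding p_def x_def y_def c_def \<epsilon>_def by simp_all
  note opt = K12_roundings[of p x y \<epsilon> z m "\<lambda>i. of_int (A i m)" c, OF nn pxy \<epsilon>0 nc, folded C_def]
  have fin: "?thesis" if "\<exists>w\<in>K12. (norm (w - z))\<^sup>2 \<le> e" "e < 4" for e
    using that by force
  have bary: "(\<exists>i. C + 3 * (1 - x i) < 4 \<or> C + 3 * (1 - y i) < 4) \<or> (\<exists>i j. i \<noteq> j \<and> C + 3 * (p i + p j) < 4) \<or>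
    (\<exists>i. C + 3 * (1 - x i) \<le> 4 \<or> C + 3 * (1 - y i) \<le> 4) \<and>
      ((\<forall>i. (p i = 0 \<or> p i = 1) \<and> (x i = 0 \<or> x i = 1) \<and> (y i = 0 \<or> y i = 1)) \<or>
       (\<forall>i. p i = 1/3 \<and> x i = 1/3 \<and> y i = 1/3))"
    unfolding C_def c_def by (rule barycentric_cost[OF nn pxy]) (use m in \<open>simp add: p_def\<close>)
  then consider (xy) i where "C + 3 * (1 - x i) < 4 \<or> C + 3 * (1 - y i) < 4"
    | (pp) i j where "i \<noteq> j" "C + 3 * (p i + p j) < 4"
    | (eq) "\<exists>i. C + 3 * (1 - x i) \<le> 4 \<or> C + 3 * (1 - y i) \<le> 4"
      "(\<forall>i. (p i = 0 \<or> p i = 1) \<and> (x i = 0 \<or> x i = 1) \<and> (y i = 0 \<or> y i = 1)) \<or>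
       (\<forall>i. p i = 1/3 \<and> x i = 1/3 \<and> y i = 1/3)"
    by blast
  then show ?thesis
  proof cases
    case xy
    then show ?thesis using fin[OF opt(3)] fin[OF opt(4)] by blast
  next
    case pp
    then show ?thesis using fin[OF opt(5)] by blast
  next
    case eq
    obtain i where i: "C + 3 * (1 - x i) \<le> 4 \<or> C + 3 * (1 - y i) \<le> 4" using eq(1) by blast
    have near: "\<exists>w\<in>K12. (norm (w - z))\<^sup>2 \<le> 4"
      using i opt(3)[of i] opt(4)[of i] by (meson order_trans)
    from eq(2) show ?thesis
    proof
      assume *: "\<forall>i. (p i = 0 \<or> p i = 1) \<and> (x i = 0 \<or> x i = 1) \<and> (y i = 0 \<or> y i = 1)"
      have l01: "l i k = 0 \<or> l i k = 1" for i k
      proof -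
        have "k = m \<or> k = m + 1 \<or> k = m + 2"
          using three_cases[of k] three_cases[of m] by auto
        then show ?thesis using * by (auto simp: p_def x_def y_def)
      qed
      have "z $ i \<in> eisenstein_integers" for i
      proof -
        have "(l i 0 = 1 \<and> l i 1 = 0 \<and> l i 2 = 0) \<or> (l i 0 = 0 \<and> l i 1 = 1 \<and> l i 2 = 0) \<or> (l i 0 = 0 \<and> l i 1 = 0 \<and> l i 2 = 1)"
          using l01[of i 0] l01[of i 1] l01[of i 2] l1[of i] by auto
        then have "z $ i = ec (A i 0) (B i 0) \<or> z $ i = ec (A i 1) (B i 1) \<or> z $ i = ec (A i 2) (B i 2)"
          unfolding z by auto
        then show ?thesis unfolding eisenstein_integers_eq by blast
      qed
      then show ?thesis using near by blast
    next
      assume *: "\<forall>i. p i = 1/3 \<and> x i = 1/3 \<and> y i = 1/3"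
      have l3: "l i k = 1/3" for i k
      proof -
        have "k = m \<or> k = m + 1 \<or> k = m + 2"
          using three_cases[of k] three_cases[of m] by auto
        then show ?thesis using * by (auto simp: p_def x_def y_def)
      qed
      have C2: "C = 2" by (simp add: C_def c_def * power2_eq_square)
      show ?thesis
      proof (cases "(\<Sum>i\<in>UNIV. (of_int (A i m) :: 3)) = 0 \<or> (\<exists>i. (\<Sum>i\<in>UNIV. (of_int (A i m) :: 3)) = - \<epsilon> i)")
        case True
        then show ?thesis
        proof (elim disjE exE)
          assume "(\<Sum>i\<in>UNIV. (of_int (A i m) :: 3)) = 0"
          from fin[OF opt(1)[OF this]] show ?thesis by (simp add: C2)
        next
          fix i assume "(\<Sum>i\<in>UNIV. (of_int (A i m) :: 3)) = - \<epsilon> i"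
          from fin[OF opt(2)[OF this]] show ?thesis by (simp add: C2 *)
        qed
      next
        case False
        \<comment> \<open>Corrections 0 and \<open>- \<epsilon> i\<close> would cost 2 and 3 in
          total, both below 4. Their failure forces every orientation \<open>\<epsilon> i\<close> to
          equal \<open>S\<close>.\<close>
        define S where "S = (\<Sum>i\<in>UNIV. (of_int (A i m) :: 3))"
        have S: "S \<noteq> 0" "\<And>i. S \<noteq> - \<epsilon> i" using False by (auto simp: S_def)
        have \<epsilon>S: "\<epsilon> i = S" for i
          using S(1) S(2)[of i] \<epsilon>0[of i] three_cases[of S] three_cases[of "\<epsilon> i"] by (auto simp: three_minus)
        define \<alpha> where "\<alpha> = (\<lambda>i. A i 0 + A i 1 + A i 2)"
        define \<beta> where "\<beta> = (\<lambda>i. B i 0 + B i 1 + B i 2)"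
        have zi: "z $ i = ec (\<alpha> i / 3) (\<beta> i / 3)" for i
          unfolding z l3 by (simp add: \<alpha>_def \<beta>_def ec_eq_iff)
        have \<alpha>S: "(of_int (\<alpha> i) :: 3) = S" for i using \<epsilon>S[of i] by (simp only: \<epsilon>_def \<alpha>_def)
        have \<beta>S: "(of_int (\<beta> i) :: 3) = - S" for i
        proof -
          have "(of_int (\<alpha> i + \<beta> i) :: 3) = of_int (A i 0 + B i 0) + of_int (A i 1 + B i 1) + of_int (A i 2 + B i 2)"
            by (simp add: \<alpha>_def \<beta>_def)
          also have "\<dots> = 0" unfolding res by simp
          finally have "(of_int (\<alpha> i) :: 3) + of_int (\<beta> i) = 0" by simp
          then show ?thesis unfolding \<alpha>S by (simp add: eq_neg_iff_add_eq_0 add.commute)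
        qed
        consider "S = 1" | "S = 2" using S(1) three_cases[of S] by blast
        then show ?thesis
        proof cases
          case 1
          have "3 dvd (\<alpha> i - 1)" "3 dvd (\<beta> i - 2)" for i
            using \<alpha>S[of i] \<beta>S[of i] of_int_3_eq[of "\<alpha> i" 1] of_int_3_eq[of "\<beta> i" 2] 1 by (simp_all add: three_minus)
          then have "\<alpha> i = 1 + 3 * ((\<alpha> i - 1) div 3)" "\<beta> i = 2 + 3 * ((\<beta> i - 2) div 3)" for i by auto
          then have e: "real_of_int (\<alpha> i) = 1 + 3 * of_int ((\<alpha> i - 1) div 3)"
            "real_of_int (\<beta> i) = 2 + 3 * of_int ((\<beta> i - 2) div 3)" for i
            by (metis of_int_1 of_int_add of_int_mult of_int_numeral)+
          have "z $ i = ec (1/3 + of_int ((\<alpha> i - 1) div 3)) (2/3 + of_int ((\<beta> i - 2) div 3))" for i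
            unfolding zi ec_eq_iff using e[of i] by simp
          then have "\<exists>a b. \<forall>i. z $ i = ec (1/3 + of_int (a i)) (2/3 + of_int (b i))"
            by (intro exI[of _ "\<lambda>i. (\<alpha> i - 1) div 3"] exI[of _ "\<lambda>i. (\<beta> i - 2) div 3"] allI)
          then show ?thesis using near by blast
        next
          case 2
          have "3 dvd (- \<alpha> i - 1)" "3 dvd (- \<beta> i - 2)" for i
            using \<alpha>S[of i] \<beta>S[of i] of_int_3_eq[of "- \<alpha> i" 1] of_int_3_eq[of "- \<beta> i" 2] 2 by (simp_all add: three_minus)
          then have "- \<alpha> i = 1 + 3 * ((- \<alpha> i - 1) div 3)" "- \<beta> i = 2 + 3 * ((- \<beta> i - 2) div 3)" for i by auto
          then have e: "- real_of_int (\<alpha> i) = 1 + 3 * of_int ((- \<alpha> i - 1) div 3)"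
            "- real_of_int (\<beta> i) = 2 + 3 * of_int ((- \<beta> i - 2) div 3)" for i
            by (metis of_int_1 of_int_add of_int_minus of_int_mult of_int_numeral)+
          have "- z $ i = ec (1/3 + of_int ((- \<alpha> i - 1) div 3)) (2/3 + of_int ((- \<beta> i - 2) div 3))" for i
            unfolding zi ec_minus ec_eq_iff using e[of i] by simp
          then have "\<exists>a b. \<forall>i. - z $ i = ec (1/3 + of_int (a i)) (2/3 + of_int (b i))"
            by (intro exI[of _ "\<lambda>i. (- \<alpha> i - 1) div 3"] exI[of _ "\<lambda>i. (- \<beta> i - 2) div 3"] allI)
          then show ?thesis using near by blast
        qed
      qed
    qed
  qed
qed

section \<open>Symmetries of the Coxeter-Todd lattice\<close>

definition omega_rot :: "3 \<Rightarrow> complex \<Rightarrow> complex" where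
  "omega_rot k z = (if k = 0 then z else if k = 1 then \<omega> * z else \<omega> * (\<omega> * z))"

lemma omega_cubed: "\<omega> * (\<omega> * (\<omega> * z)) = z"
proof -
  obtain p q where "z = ec p q" using ec_surj by blast
  then show ?thesis by (simp add: omega_ec)
qed

lemma omega_rot_inverse: "omega_rot (- k) (omega_rot k z) = z"
  using three_cases[of k] by (auto simp: omega_rot_def three_minus omega_cubed)

text \<open>Powers of \<omega> keep the residue modulo \<theta> but move the finer residue by
  \<open>- k\<close> times it. Hence diagonal rotations with exponents summing to 0 preserve
  \<open>K12\<close>.\<close>

lemma omega_rot_integral:
  "\<exists>a' b' :: int. omega_rot k (ec a b) = ec a' b' \<and> (of_int (a' + b') :: 3) = of_int (a + b) \<and>
     (of_int a' :: 3) = of_int a - k * of_int (a + b)" for a b :: int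
proof -
  have three: "t + t + t = 0" for t :: 3 using three_cases[of t] by auto
  consider "k = 0" | "k = 1" | "k = 2" using three_cases by blast
  then show ?thesis
  proof cases
    case 1
    then show ?thesis by (intro exI[of _ a] exI[of _ b]) (simp add: omega_rot_def)
  next
    case 2
    have "(of_int (- b + (a - b)) :: 3) = of_int (a + b)"
      using three[of "of_int b"] by (simp add: algebra_simps)
    then show ?thesis
      using 2 by (intro exI[of _ "- b"] exI[of _ "a - b"]) (simp add: omega_rot_def omega_ec)
  next
    case 3
    have "(of_int ((b - a) + - a) :: 3) = of_int (a + b)" "(of_int (b - a) :: 3) = of_int a - 2 * of_int (a + b)"
      using three[of "of_int a"] three[of "of_int b"] by (simp_all add: algebra_simps)
    then show ?thesis
      using 3 by (intro exI[of _ "b - a"] exI[of _ "- a"]) (simp add: omega_rot_def omega_ec)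
  qed
qed

definition diag_rot :: "(6 \<Rightarrow> 3) \<Rightarrow> complex ^ 6 \<Rightarrow> complex ^ 6" where
  "diag_rot k x = (\<chi> i. omega_rot (k i) (x $ i))"

lemma linear_diag_rot: "linear (diag_rot k)"
  by (rule linearI) (auto simp: diag_rot_def omega_rot_def vec_eq_iff algebra_simps)

lemma norm_diag_rot: "norm (diag_rot k x) = norm x"
  by (simp add: norm_vec_def diag_rot_def omega_rot_def norm_omega_mult if_distrib[of norm] cong: if_cong)

lemma diag_rot_K12:
  assumes k: "(\<Sum>i\<in>UNIV. k i) = 0" and x: "x \<in> K12"
  shows "diag_rot k x \<in> K12"
proof -
  obtain a b :: "6 \<Rightarrow> int" and m where x: "\<And>i. x $ i = ec (of_int (a i)) (of_int (b i))"
    "\<And>i. (of_int (a i + b i) :: 3) = m" "(\<Sum>i\<in>UNIV. (of_int (a i) :: 3)) = 0"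
    using x by (rule K12E) blast
  have "\<forall>i. \<exists>a' b' :: int. omega_rot (k i) (x $ i) = ec a' b' \<and> (of_int (a' + b') :: 3) = m \<and>
      (of_int a' :: 3) = of_int (a i) - k i * m"
  proof
    fix i
    show "\<exists>a' b' :: int. omega_rot (k i) (x $ i) = ec a' b' \<and> (of_int (a' + b') :: 3) = m \<and>
        (of_int a' :: 3) = of_int (a i) - k i * m"
      using omega_rot_integral[of "k i" "a i" "b i"] unfolding x(1) x(2)[of i] .
  qed
  then obtain a' b' :: "6 \<Rightarrow> int" where a': "\<And>i. omega_rot (k i) (x $ i) = ec (a' i) (b' i)"
    "\<And>i. (of_int (a' i + b' i) :: 3) = m" "\<And>i. (of_int (a' i) :: 3) = of_int (a i) - k i * m"
    by metis
  show ?thesis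
  proof (rule K12I[OF _ a'(2)])
    show "diag_rot k x $ i = ec (a' i) (b' i)" for i by (simp add: diag_rot_def a'(1))
    show "(\<Sum>i\<in>UNIV. (of_int (a' i) :: 3)) = 0"
      by (simp only: a'(3) sum_subtractf x(3) k flip: sum_distrib_right) simp
  qed
qed

lemma lattice_equiv_diag_rot:
  assumes k: "(\<Sum>i\<in>UNIV. k i) = 0"
  shows "lattice_equiv K12 z (diag_rot k z)"
proof (rule lattice_equiv_linear[OF linear_diag_rot norm_diag_rot])
  have inv: "diag_rot k (diag_rot (\<lambda>i. - k i) x) = x" for x
    using omega_rot_inverse[of "- k _"] by (simp add: diag_rot_def vec_eq_iff)
  have "(\<Sum>i\<in>UNIV. - k i) = 0" using k by (simp add: sum_negf)
  then show "diag_rot k ` K12 = K12"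
    using diag_rot_K12[OF k] diag_rot_K12[of "\<lambda>i. - k i"] inv by (metis image_eqI image_subsetI subsetI subset_antisym)
qed

lemma lattice_equiv_K12_minus: "lattice_equiv K12 z (- z)"
  by (rule lattice_equiv_involution) (auto intro: linear_uminus discrete_subgroup_minus[OF discrete_subgroup_K12])

text \<open>The complex reflection of order 2 in the minimal vector \<open>(1, \<dots>, 1)\<close>.\<close>

definition refl_ones :: "complex ^ 6 \<Rightarrow> complex ^ 6" where
  "refl_ones x = (\<chi> i. x $ i - (1/3) *\<^sub>R (\<Sum>j\<in>UNIV. x $ j))"

lemma lattice_equiv_refl_ones: "lattice_equiv K12 z (refl_ones z)"
proof (rule lattice_equiv_involution)
  show "linear refl_ones"
    by (rule linearI) (simp_all add: refl_ones_def vec_eq_iff sum.distrib scaleR_sum_right[symmetric] algebra_simps)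
  show "refl_ones (refl_ones x) = x" for x
  proof -
    have "(\<Sum>j\<in>(UNIV :: 6 set). x $ j - (1/3) *\<^sub>R (\<Sum>j\<in>UNIV. x $ j)) = - (\<Sum>j\<in>UNIV. x $ j)"
      by (simp add: sum_subtractf scaleR_conv_of_real)
    then show ?thesis by (simp add: refl_ones_def vec_eq_iff)
  qed
  show "norm (refl_ones x) = norm x" for x
  proof -
    define s where "s = (\<Sum>j\<in>UNIV. x $ j)"
    have "(norm (refl_ones x))\<^sup>2 = (\<Sum>i\<in>UNIV. (norm (x $ i))\<^sup>2 - (2/3) * (x $ i \<bullet> s) + (1/9) * (s \<bullet> s))"
      unfolding norm_vec_power2
      by (intro sum.cong refl)
        (simp add: refl_ones_def power2_norm_eq_inner inner_diff_left inner_diff_right inner_commute flip: s_def)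
    also have "\<dots> = (norm x)\<^sup>2 - (2/3) * (\<Sum>i\<in>UNIV. x $ i \<bullet> s) + 6 * ((1/9) * (s \<bullet> s))"
      unfolding norm_vec_power2 sum.distrib sum_subtractf sum_distrib_left[symmetric] by simp
    also have "(\<Sum>i\<in>UNIV. x $ i \<bullet> s) = s \<bullet> s" by (simp add: s_def inner_sum_left)
    finally show ?thesis by (simp add: power2_eq_iff_nonneg)
  qed
  fix x assume "x \<in> K12"
  then obtain a b :: "6 \<Rightarrow> int" and m where x: "\<And>i. x $ i = ec (of_int (a i)) (of_int (b i))"
    "\<And>i. (of_int (a i + b i) :: 3) = m" "(\<Sum>i\<in>UNIV. (of_int (a i) :: 3)) = 0" "(\<Sum>i\<in>UNIV. (of_int (b i) :: 3)) = 0"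
    by (rule K12E) blast
  have "3 dvd (\<Sum>i\<in>UNIV. a i)" "3 dvd (\<Sum>i\<in>UNIV. b i)" using x(3,4) by (simp_all flip: of_int_3)
  then obtain c d where cd: "(\<Sum>i\<in>UNIV. a i) = 3 * c" "(\<Sum>i\<in>UNIV. b i) = 3 * d" by (auto elim!: dvdE)
  have s: "(1/3) *\<^sub>R (\<Sum>j\<in>UNIV. x $ j) = ec (of_int c) (of_int d)"
    unfolding x ec_sum of_int_sum[symmetric] cd by (simp add: ec_scaleR)
  show "refl_ones x \<in> K12"
  proof (rule K12I)
    show "refl_ones x $ i = ec (of_int (a i - c)) (of_int (b i - d))" for i
    proof -
      have "refl_ones x $ i = x $ i - (1/3) *\<^sub>R (\<Sum>j\<in>UNIV. x $ j)" by (simp add: refl_ones_def)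
      then show ?thesis unfolding s by (simp add: x(1) ec_diff)
    qed
    have "(of_int (a i - c + (b i - d)) :: 3) = of_int (a i + b i) - of_int (c + d)" for i by simp
    then show "(of_int (a i - c + (b i - d)) :: 3) = m - of_int (c + d)" for i by (simp only: x(2))
    show "(\<Sum>i\<in>UNIV. (of_int (a i - c) :: 3)) = 0" using x(3) by (simp add: sum_subtractf)
  qed
qed

section \<open>Holes of the Coxeter-Todd lattice up to symmetry\<close>

text \<open>The fractional part (1 + 2 \<omega>) / 3 is \<theta> / 3, the centroid of the triangle
  0, \<omega>, 1 + \<omega>.\<close>

definition centroidal :: "complex ^ 6 \<Rightarrow> (6 \<Rightarrow> int) \<Rightarrow> (6 \<Rightarrow> int) \<Rightarrow> bool" where
  "centroidal z a b \<longleftrightarrow> (\<forall>i. z $ i = ec (1/3 + of_int (a i)) (2/3 + of_int (b i)))"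

text \<open>The three vertices of the triangle, one of each class, have squared distance 1/3, and
  \<open>d\<close> records which of them has first coordinate a + 1. The next points of each class
  lie at squared distance 4/3 and supply the correction by 1.\<close>

lemma near_class_centroid:
  fixes a b :: int and m :: 3
  defines "r \<equiv> (of_int (a + b) :: 3)"
  defines "d \<equiv> (if m - r = 2 then 1 else 0 :: 3)"
  shows "near_class (ec (1/3 + a) (2/3 + b)) m (of_int a + d) (1/3)"
    and "near_class (ec (1/3 + a) (2/3 + b)) m (of_int a + d + 1) (4/3)"
proof -
  have cases: "(m = r \<and> d = 0) \<or> (m = r + 1 \<and> d = 0) \<or> (m = r + 2 \<and> d = 1)"
    using three_cases[of m] three_cases[of r] by (auto simp: d_def three_minus)
  have n: "near_class (ec (1/3 + a) (2/3 + b)) (r + of_int (s + t)) (of_int a + of_int s) c"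
    if "(1/3 - of_int s)\<^sup>2 - (1/3 - of_int s) * (2/3 - of_int t) + (2/3 - of_int t)\<^sup>2 \<le> c" for s t :: int and c
    by (rule near_classI[of "a + s" "b + t"]) (use that in \<open>auto simp: r_def ec_diff norm_ec\<close>)
  show "near_class (ec (1/3 + a) (2/3 + b)) m (of_int a + d) (1/3)"
    using cases n[of 0 0 "1/3"] n[of 0 1 "1/3"] n[of 1 1 "1/3"] by (auto simp: power2_eq_square)
  show "near_class (ec (1/3 + a) (2/3 + b)) m (of_int a + d + 1) (4/3)"
    using cases n[of 1 2 "4/3"] n[of 1 0 "4/3"] n[of "- 1" 0 "4/3"] by (auto simp: power2_eq_square three_minus add.assoc)
qed

text \<open>A sum 0 would give a lattice point at squared distance 2; a sum 2 is repaired by one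
  correction at total cost 5/3 + 4/3 = 3. Both are below 4.\<close>

lemma centroidal_hole:
  fixes m :: 3
  assumes hole: "\<not> (\<exists>x\<in>K12. norm (x - z) < 2)" and z: "centroidal z a b"
  shows "(\<Sum>i\<in>UNIV. of_int (a i) + (if m - of_int (a i + b i) = 2 then 1 else 0)) = (1 :: 3)"
proof -
  define s where "s = (\<lambda>i. of_int (a i) + (if m - of_int (a i + b i) = 2 then 1 else 0 :: 3))"
  have z': "z $ i = ec (1/3 + a i) (2/3 + b i)" for i using z by (simp add: centroidal_def)
  have far: "\<not> (norm (x - z))\<^sup>2 < 4" if "x \<in> K12" for x
    using hole that power2_less_imp_less[of "norm (x - z)" 2] by fastforce
  have "(\<Sum>i\<in>UNIV. s i) \<noteq> 0"
  proof
    assume "(\<Sum>i\<in>UNIV. s i) = 0"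
    then have "\<exists>x\<in>K12. (norm (x - z))\<^sup>2 \<le> (\<Sum>i\<in>(UNIV :: 6 set). 1/3)"
      by (rule near_class_K12[of z m s "\<lambda>_. 1/3", rotated]) (simp only: z' s_def near_class_centroid(1))
    then show False using far by force
  qed
  moreover have "(\<Sum>i\<in>UNIV. s i) \<noteq> 2"
  proof
    assume "(\<Sum>i\<in>UNIV. s i) = 2"
    then have "(\<Sum>i\<in>UNIV. s i + (if i = 1 then 1 else 0)) = 0" by (simp add: sum.distrib)
    then have "\<exists>x\<in>K12. (norm (x - z))\<^sup>2 \<le> (\<Sum>i\<in>(UNIV :: 6 set). if i = 1 then 4/3 else 1/3)"
      by (rule near_class_K12[of z m "\<lambda>i. s i + (if i = 1 then 1 else 0)" "\<lambda>i. if i = 1 then 4/3 else 1/3", rotated])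
        (simp add: z' s_def near_class_centroid del: of_int_add)
    moreover have "(\<Sum>i\<in>(UNIV :: 6 set). if i = 1 then 4/3 else 1/3) = (\<Sum>i\<in>(UNIV :: 6 set). 1/3 + (if i = 1 then 1 else 0 :: real))"
      by (intro sum.cong) auto
    ultimately show False using far by (force simp: sum.distrib)
  qed
  ultimately show ?thesis using three_cases[of "\<Sum>i\<in>UNIV. s i"] by (auto simp: s_def)
qed

text \<open>Multiplication by \<omega> moves \<theta> / 3 by -(1 + \<omega>), which has residue 1
  modulo \<theta>. So a rotation can set the residue of a coordinate at will.\<close>

lemma centroidal_rot:
  "\<exists>a' b' :: int. omega_rot k (ec (1/3 + a) (2/3 + b)) = ec (1/3 + a') (2/3 + b') \<and>
     (of_int (a' + b') :: 3) = of_int (a + b) + k" for a b :: int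
proof -
  have three: "t + t + t = 0" for t :: 3 using three_cases[of t] by auto
  consider "k = 0" | "k = 1" | "k = 2" using three_cases by blast
  then show ?thesis
  proof cases
    case 1
    then show ?thesis by (intro exI[of _ a] exI[of _ b]) (simp add: omega_rot_def)
  next
    case 2
    have "(of_int (- b - 1 + (a - b - 1)) :: 3) = of_int (a + b) + 1"
      using three[of "of_int b"] three[of 1] by (simp add: algebra_simps)
    then show ?thesis
      using 2 by (intro exI[of _ "- b - 1"] exI[of _ "a - b - 1"]) (simp add: omega_rot_def omega_ec ec_eq_iff)
  next
    case 3
    have "(of_int (b - a + (- a - 1)) :: 3) = of_int (a + b) + 2"
      using three[of "of_int a"] three[of 1] by (simp add: algebra_simps)
    then show ?thesis
      using 3 by (intro exI[of _ "b - a"] exI[of _ "- a - 1"]) (simp add: omega_rot_def omega_ec ec_eq_iff)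
  qed
qed

text \<open>\<theta> / 3 everywhere, plus 1 - \<omega> in the first coordinate: all residues modulo
  \<theta> are 0, and the first coordinates sum to 1 as \<open>centroidal_hole\<close> demands for
  \<open>m = 0\<close>.\<close>

definition K12_centroid :: "complex ^ 6" where
  "K12_centroid = (\<chi> i. ec (1/3 + (if i = 1 then 1 else 0)) (2/3 - (if i = 1 then 1 else 0)))"

text \<open>Subtracting the conditions of \<open>centroidal_hole\<close> for m = 2 and m = 0 shows
  that the residues sum to 0, so the rotations that make them all 0 form a symmetry. The condition
  for m = 0 then fixes the point modulo \<open>K12\<close>.\<close>

lemma centroidal_equiv:
  assumes hole: "\<not> (\<exists>x\<in>K12. norm (x - z) < 2)" and z: "centroidal z a b"
  shows "lattice_equiv K12 z K12_centroid"
proof -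
  define r where "r = (\<lambda>i. of_int (a i + b i) :: 3)"
  have "(\<Sum>i\<in>UNIV. r i) = 0"
  proof -
    have D: "(if 2 - t = 2 then 1 else 0) - (if 0 - t = 2 then 1 else 0) = t + (1 :: 3)" for t :: 3
      using three_cases[of t] by (auto simp: three_minus)
    have "(\<Sum>i\<in>UNIV. r i + 1) = (\<Sum>i\<in>UNIV. of_int (a i) + (if 2 - of_int (a i + b i) = (2 :: 3) then 1 else 0))
        - (\<Sum>i\<in>UNIV. of_int (a i) + (if 0 - of_int (a i + b i) = (2 :: 3) then 1 else 0 :: 3))"
      unfolding sum_subtractf[symmetric] by (intro sum.cong refl) (simp only: r_def add_diff_cancel_left D)
    also have "\<dots> = 0" by (simp only: centroidal_hole[OF hole z]) simp
    finally show ?thesis by (simp add: sum.distrib)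
  qed
  then have k: "(\<Sum>i\<in>UNIV. - r i) = 0" by (simp add: sum_negf)
  define y where "y = diag_rot (\<lambda>i. - r i) z"
  have zy: "lattice_equiv K12 z y" unfolding y_def by (rule lattice_equiv_diag_rot[OF k])
  have "\<forall>i. \<exists>a' b' :: int. y $ i = ec (1/3 + a') (2/3 + b') \<and> (of_int (a' + b') :: 3) = 0"
  proof
    fix i
    show "\<exists>a' b' :: int. y $ i = ec (1/3 + a') (2/3 + b') \<and> (of_int (a' + b') :: 3) = 0"
      using centroidal_rot[of "- r i" "a i" "b i"] z by (simp add: y_def diag_rot_def centroidal_def r_def del: of_int_add)
  qed
  then obtain a' b' :: "6 \<Rightarrow> int" where y: "\<And>i. y $ i = ec (1/3 + a' i) (2/3 + b' i)"
    "\<And>i. (of_int (a' i + b' i) :: 3) = 0" by metis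
  have "\<not> (\<exists>x\<in>K12. norm (x - y) < 2)" using near_equiv[OF zy] hole by blast
  from centroidal_hole[OF this, of a' b' 0]
  have sa: "(\<Sum>i\<in>UNIV. (of_int (a' i) :: 3)) = 1" by (simp add: centroidal_def y del: of_int_add)
  have "K12_centroid - y \<in> K12"
  proof (rule K12I[of _ "\<lambda>i. (if i = 1 then 1 else 0) - a' i" "\<lambda>i. - (if i = 1 then 1 else 0) - b' i" 0])
    show "(K12_centroid - y) $ i = ec (of_int ((if i = 1 then 1 else 0) - a' i)) (of_int (- (if i = 1 then 1 else 0) - b' i))" for i
      by (simp add: K12_centroid_def y(1) ec_diff ec_eq_iff)
    have "(of_int ((if i = 1 then 1 else 0) - a' i + (- (if i = 1 then 1 else 0) - b' i)) :: 3) = - of_int (a' i + b' i)" for i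
      by simp
    then show "(of_int ((if i = 1 then 1 else 0) - a' i + (- (if i = 1 then 1 else 0) - b' i)) :: 3) = 0" for i
      by (simp only: y(2)) simp
    show "(\<Sum>i\<in>UNIV. (of_int ((if i = 1 then 1 else 0) - a' i) :: 3)) = 0"
      by (simp add: sum_subtractf sa if_distrib[of of_int] cong: if_cong)
  qed
  from lattice_equiv_trans[OF zy lattice_equiv_translate[OF discrete_subgroup_K12 this, of y]]
  show ?thesis by simp
qed

text \<open>If the coordinate sum is not divisible by 3, \<open>refl_ones\<close> leaves the
  integral points. Otherwise two residues modulo \<theta> differ, since \<open>z\<close> is no
  lattice point; multiplying these two coordinates by \<omega> and its square shifts the sum of
  first coordinates by the difference of the residues, which leads back to the first case.\<close>

lemma integral_hole_step:
  assumes hole: "\<not> (\<exists>x\<in>K12. norm (x - z) < 2)" and z: "\<forall>i. z $ i \<in> eisenstein_integers"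
  obtains w where "lattice_equiv K12 z w" "\<not> (\<forall>i. w $ i \<in> eisenstein_integers)"
proof -
  note outer = that
  have "\<forall>i. \<exists>a b. z $ i = ec (of_int a) (of_int b)" using z by (auto simp: eisenstein_integers_eq)
  then obtain a b :: "6 \<Rightarrow> int" where ab: "\<And>i. z $ i = ec (a i) (b i)" by metis
  have fin: thesis if y: "lattice_equiv K12 z y" "\<And>i. y $ i = ec (of_int (c i)) (of_int (d i))"
    and nd: "\<not> (3 dvd (\<Sum>i\<in>UNIV. c i) \<and> 3 dvd (\<Sum>i\<in>UNIV. d i))" for y c d
  proof (rule outer)
    show "lattice_equiv K12 z (refl_ones y)" by (rule lattice_equiv_trans[OF y(1) lattice_equiv_refl_ones])
    show "\<not> (\<forall>i. refl_ones y $ i \<in> eisenstein_integers)"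
    proof
      assume "\<forall>i. refl_ones y $ i \<in> eisenstein_integers"
      then have "refl_ones y $ 1 \<in> eisenstein_integers" ..
      then obtain p q :: int where "refl_ones y $ 1 = ec p q" unfolding eisenstein_integers_eq by auto
      then have "ec (c 1) (d 1) - (1/3) *\<^sub>R ec (\<Sum>i\<in>UNIV. real_of_int (c i)) (\<Sum>i\<in>UNIV. real_of_int (d i)) = ec p q"
        by (simp add: refl_ones_def y(2) ec_sum)
      then have "real_of_int (\<Sum>i\<in>UNIV. c i) = of_int (3 * (c 1 - p))" "real_of_int (\<Sum>i\<in>UNIV. d i) = of_int (3 * (d 1 - q))"
        by (simp_all add: ec_scaleR ec_diff ec_eq_iff field_simps)
      then have "(\<Sum>i\<in>UNIV. c i) = 3 * (c 1 - p)" "(\<Sum>i\<in>UNIV. d i) = 3 * (d 1 - q)" by (simp_all only: of_int_eq_iff)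
      then show False using nd by simp
    qed
  qed
  show thesis
  proof (cases "3 dvd (\<Sum>i\<in>UNIV. a i) \<and> 3 dvd (\<Sum>i\<in>UNIV. b i)")
    case False
    then show ?thesis using fin[OF lattice_equiv_refl ab] by blast
  next
    case True
    then have sa: "(\<Sum>i\<in>UNIV. (of_int (a i) :: 3)) = 0" by (simp flip: of_int_3 of_int_sum)
    define r where "r = (\<lambda>i. of_int (a i + b i) :: 3)"
    have "\<exists>i j. r i \<noteq> r j"
    proof (rule ccontr)
      assume "\<not> ?thesis"
      then have "(of_int (a i + b i) :: 3) = r 1" for i unfolding r_def by blast
      then have "z \<in> K12" using ab sa by (intro K12I)
      then show False using hole by force
    qed
    then obtain i1 i2 where i12: "r i1 \<noteq> r i2" by blast
    then have ne: "i1 \<noteq> i2" by auto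
    define k where "k = (\<lambda>i. (if i = i1 then 1 else 0) + (if i = i2 then 2 else 0) :: 3)"
    have k: "(\<Sum>i\<in>UNIV. k i) = 0" by (simp add: k_def sum.distrib)
    have "\<forall>i. \<exists>a' b' :: int. diag_rot k z $ i = ec a' b' \<and> (of_int a' :: 3) = of_int (a i) - k i * r i"
    proof
      fix i
      obtain a' b' :: int where "omega_rot (k i) (ec (a i) (b i)) = ec a' b'"
        "(of_int a' :: 3) = of_int (a i) - k i * of_int (a i + b i)"
        using omega_rot_integral[of "k i" "a i" "b i"] by blast
      then show "\<exists>a' b' :: int. diag_rot k z $ i = ec a' b' \<and> (of_int a' :: 3) = of_int (a i) - k i * r i"
        unfolding r_def by (intro exI[of _ a'] exI[of _ b'] conjI) (simp_all only: diag_rot_def vec_lambda_beta ab)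
    qed
    then obtain a' b' :: "6 \<Rightarrow> int" where a': "\<And>i. diag_rot k z $ i = ec (a' i) (b' i)"
      "\<And>i. (of_int (a' i) :: 3) = of_int (a i) - k i * r i" by metis
    have "(\<Sum>i\<in>UNIV. (of_int (a' i) :: 3)) = - (\<Sum>i\<in>UNIV. k i * r i)"
      by (simp add: a'(2) sum_subtractf sa)
    also have "(\<Sum>i\<in>UNIV. k i * r i) = r i1 + 2 * r i2"
      by (simp add: k_def distrib_right sum.distrib if_distribR if_distrib[of "\<lambda>t. t * _"] cong: if_cong)
    finally have "(\<Sum>i\<in>UNIV. (of_int (a' i) :: 3)) \<noteq> 0"
      using i12 three_cases[of "r i1"] three_cases[of "r i2"] by (auto simp: three_minus)
    then have "\<not> 3 dvd (\<Sum>i\<in>UNIV. a' i)" by (simp flip: of_int_3)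
    then show ?thesis using fin[OF lattice_equiv_diag_rot[OF k] a'(1)] by blast
  qed
qed

lemma exhaust_6: "x = 1 \<or> x = 2 \<or> x = 3 \<or> x = 4 \<or> x = 5 \<or> x = 6" for x :: 6
proof (induct x)
  case (of_int z)
  then have "z = 0 \<or> z = 1 \<or> z = 2 \<or> z = 3 \<or> z = 4 \<or> z = 5" by fastforce
  then show ?case by auto
qed

lemma UNIV_6: "UNIV = {1, 2, 3, 4, 5, 6 :: 6}"
  using exhaust_6 by auto

lemma sum_6: "sum f (UNIV :: 6 set) = f 1 + f 2 + f 3 + f 4 + f 5 + f 6"
  unfolding UNIV_6 by (simp add: ac_simps)

text \<open>Each residue modulo 3 occurs exactly twice.\<close>

definition hole_residue :: "6 \<Rightarrow> int" where
  "hole_residue i = (if i = 1 \<or> i = 2 then 0 else if i = 3 \<or> i = 4 then 1 else - 1)"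

text \<open>A second representative of the orbit: distances to the lattice and the rotation about
  the hole are easy in integral coordinates, while \<open>K12_centroid\<close> serves as normal
  form.\<close>

definition K12_hole :: "complex ^ 6" where
  "K12_hole = (\<chi> i. ec (of_int (hole_residue i)) 0)"

text \<open>Only two coordinates can match the class of \<open>x\<close>; each of the other four
  differs by a nonzero Eisenstein integer, of norm at least 1.\<close>

lemma K12_hole_far:
  assumes "x \<in> K12"
  shows "2 \<le> norm (x - K12_hole)"
proof -
  obtain a b :: "6 \<Rightarrow> int" and m where x: "\<And>i. x $ i = ec (of_int (a i)) (of_int (b i))"
    "\<And>i. (of_int (a i + b i) :: 3) = m" using assms by (rule K12E) blast
  have n: "(if m = of_int (hole_residue i) then 0 else 1) \<le> (norm ((x - K12_hole) $ i))\<^sup>2" for i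
  proof (cases "m = of_int (hole_residue i)")
    case False
    then have "a i - hole_residue i \<noteq> 0 \<or> b i \<noteq> 0" using x(2)[of i] by auto
    then have "real_of_int 1 \<le> of_int ((a i - hole_residue i)\<^sup>2 - (a i - hole_residue i) * b i + (b i)\<^sup>2)"
      unfolding of_int_le_iff by (rule eisenstein_norm_ge_1)
    then show ?thesis using False by (simp add: K12_hole_def x(1) ec_diff norm_ec)
  qed simp
  have "4 \<le> (\<Sum>i\<in>UNIV. if m = of_int (hole_residue i) then 0 else 1 :: real)"
    using three_cases[of m] by (auto simp: sum_6 hole_residue_def three_minus)
  also have "\<dots> \<le> (norm (x - K12_hole))\<^sup>2"
    unfolding norm_vec_power2 by (intro sum_mono n)
  finally have "2\<^sup>2 \<le> (norm (x - K12_hole))\<^sup>2" by simp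
  then show ?thesis by (rule power2_le_imp_le) simp
qed

lemma K12_hole_span: "K12_hole \<in> span K12"
proof -
  have "3 *\<^sub>R K12_hole \<in> K12"
    by (rule K12I[of _ "\<lambda>i. 3 * hole_residue i" "\<lambda>_. 0" 0]) (simp_all add: K12_hole_def ec_scaleR)
  from span_mul[OF span_base[OF this], of "1/3"] show ?thesis by simp
qed

text \<open>(1 - \<omega>) times the hole is a lattice vector, so rotation by \<omega> about the
  hole is rotation about 0 followed by a translation.\<close>

lemma lattice_equiv_K12_hole_rot: "lattice_equiv K12 (K12_hole + u) (K12_hole + diag_rot (\<lambda>_. 1) u)"
proof -
  have "(K12_hole - diag_rot (\<lambda>_. 1) K12_hole) \<in> K12"
  proof (rule K12I[of _ hole_residue "\<lambda>i. - hole_residue i" 0])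
    show "(K12_hole - diag_rot (\<lambda>_. 1) K12_hole) $ i = ec (of_int (hole_residue i)) (of_int (- hole_residue i))" for i
      by (simp add: K12_hole_def diag_rot_def omega_rot_def omega_ec ec_diff)
    show "(\<Sum>i\<in>UNIV. (of_int (hole_residue i) :: 3)) = 0" by (simp add: sum_6 hole_residue_def)
  qed simp
  from lattice_equiv_translate[OF discrete_subgroup_K12 this, of "diag_rot (\<lambda>_. 1) (K12_hole + u)"]
  have "lattice_equiv K12 (diag_rot (\<lambda>_. 1) (K12_hole + u)) (K12_hole + diag_rot (\<lambda>_. 1) u)"
    by (simp add: linear_add[OF linear_diag_rot] algebra_simps)
  with lattice_equiv_diag_rot[of "\<lambda>_. 1" "K12_hole + u"] show ?thesis
    using lattice_equiv_trans by (simp add: sum_const_6) blast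
qed

lemma K12_hole_equiv:
  assumes hole: "\<not> (\<exists>x\<in>K12. norm (x - z) < 2)"
  shows "lattice_equiv K12 z K12_centroid"
proof -
  obtain w where w: "lattice_equiv K12 z w" "\<not> (\<forall>i. w $ i \<in> eisenstein_integers)"
  proof (cases "\<forall>i. z $ i \<in> eisenstein_integers")
    case True
    then show ?thesis using integral_hole_step[OF hole] that by blast
  qed (use that lattice_equiv_refl in blast)
  have hw: "\<not> (\<exists>x\<in>K12. norm (x - w) < 2)" using near_equiv[OF w(1)] hole by blast
  \<comment> \<open>Negation exchanges the two orientations of centroids left open by
    \<open>K12_cover\<close>.\<close>
  have wm: "lattice_equiv K12 z (- w)" using lattice_equiv_trans[OF w(1) lattice_equiv_K12_minus] .
  have hm: "\<not> (\<exists>x\<in>K12. norm (x - (- w)) < 2)" using near_equiv[OF wm] hole by blast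
  have "\<not> (\<exists>x\<in>K12. (norm (x - w))\<^sup>2 < 4)"
    using hw power2_less_imp_less[of "norm (_ - w)" 2] by fastforce
  then have "(\<exists>a b. centroidal w a b) \<or> (\<exists>a b. centroidal (- w) a b)"
    using K12_cover[of w] w(2) unfolding centroidal_def vector_uminus_component by blast
  then consider a b where "centroidal w a b" | a b where "centroidal (- w) a b"
    by blast
  then show ?thesis
  proof cases
    case 1
    from lattice_equiv_trans[OF w(1) centroidal_equiv[OF hw 1]] show ?thesis .
  next
    case 2
    from lattice_equiv_trans[OF wm centroidal_equiv[OF hm 2]] show ?thesis .
  qed
qed

theorem K12_deep_holes_stable:
  assumes "deep_hole K12 z"
  shows "stable_cold_spot K12 z"
proof -
  let ?om = "diag_rot (\<lambda>_. 1)"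
  define g where "g = (\<lambda>(j :: nat) u. if j = 0 then u else if j = 1 then ?om u else ?om (?om u))"
  show ?thesis
  proof (rule deep_holes_stable[OF discrete_subgroup_K12 K12_hole_span K12_hole_far, where k = 3 and g = g])
    have hole: "\<not> (\<exists>x\<in>K12. norm (x - K12_hole) < 2)" using K12_hole_far by force
    then have "\<not> (\<exists>x\<in>K12. (norm (x - K12_hole))\<^sup>2 < 4)"
      using power2_less_imp_less[of "norm (_ - K12_hole)" 2] by fastforce
    then obtain x where "x \<in> K12" "(norm (x - K12_hole))\<^sup>2 \<le> 2\<^sup>2" using K12_cover[of K12_hole] by auto
    then show "\<exists>x\<in>K12. norm (x - K12_hole) \<le> 2" using power2_le_imp_le[of "norm (x - K12_hole)" 2] by auto
    show "(\<exists>x\<in>K12. norm (x - z) < 2) \<or> lattice_equiv K12 z K12_hole" for z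
      using K12_hole_equiv[of z] lattice_equiv_sym[OF K12_hole_equiv[OF hole]] lattice_equiv_trans by blast
    have e: "lattice_equiv K12 (K12_hole + u) (K12_hole + ?om (?om u))" for u
      using lattice_equiv_trans[OF lattice_equiv_K12_hole_rot lattice_equiv_K12_hole_rot] .
    show "lattice_equiv K12 (K12_hole + u) (K12_hole + g j u)" for j u
      using lattice_equiv_refl[of K12 "K12_hole + u"] lattice_equiv_K12_hole_rot[of u] e[of u] by (simp add: g_def)
    show "norm (g j u) = norm u" for j u by (simp add: g_def norm_diag_rot)
    have "t + \<omega> * t + \<omega> * (\<omega> * t) = 0" for t
    proof -
      obtain p q where "t = ec p q" using ec_surj by blast
      then show ?thesis by (simp add: omega_ec ec_add ec_0)
    qed
    then show "(\<Sum>j<3. g j u) = 0" for u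
      by (simp add: g_def numeral_3_eq_3 diag_rot_def omega_rot_def vec_eq_iff)
  qed (use assms in \<open>simp_all add: g_def\<close>)
qed

theorem mainTheorem5:
  shows "(\<forall>c. deep_hole (dual_lattice E6_lattice) c \<longrightarrow>
              stable_cold_spot (dual_lattice E6_lattice) c) \<and>
         (\<forall>c. deep_hole (dual_lattice E7_lattice) c \<longrightarrow>
              stable_cold_spot (dual_lattice E7_lattice) c) \<and>
         (\<forall>c. deep_hole K12 c \<longrightarrow> stable_cold_spot K12 c) \<and>
         (\<forall>c. deep_hole BW16 c \<longrightarrow> stable_cold_spot BW16 c)"
  using dual_E6_deep_holes_stable dual_E7_deep_holes_stable K12_deep_holes_stable BW16_deep_holes_stable
  by blast

end
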